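(* There is a one-to-one correspondence between conjugacy classes of finite maximal diagonalizable subgroups of $\mathrm{PGL}(n,\mathbb{C})$ and nonsingular symplectic abelian groups of order $n^2$.
   Context: Here $n$ is a positive integer. A subgroup of $\mathrm{PGL}(n,\mathbb{C})$ is diagonalizable if it is abelian and consists of semisimple elements; a maximal diagonalizable subgroup is one maximal with respect to inclusion among diagonalizable subgroups. A symplectic abelian group is an abelian group $H$ together with a $\mathbb{Z}$-bilinear map $\langle\cdot,\cdot\rangle:H\times H\to\mathbb{C}^{\times}$ (a homomorphism in each variable) that is anti-symmetric, i.e. $\langle a,b\rangle=\langle b,a\rangle^{-1}$ for all $a,b\in H$. It is nonsingular if $\langle a,b\rangle=1$ for all $b\in H$ implies that $a$ is the identity element of $H$. Two symplectic abelian groups are isometric if there is a group isomorphism between them preserving the respective pairings; symplectic abelian groups are counted here up to isometry.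
   Formalization: The pairing is also required to be alternating (⟨a,a⟩ = 1 for all a), which is automatic for odd n. With anti-symmetry alone the claim fails for n = 2: (Z/2)² has two non-isometric nonsingular pairings, but PGL(2,C) has only one class. *)

theory Defs
  imports "Jordan_Normal_Form.Matrix" "HOL-Algebra.Coset"
begin

section \<open>The group PGL(n, C)\<close>

definition GL :: "nat \<Rightarrow> complex mat monoid" where
  "GL n = units_of (ring_mat TYPE(complex) n ())"

definition scalars :: "nat \<Rightarrow> complex mat set" where
  "scalars n = {c \<cdot>\<^sub>m 1\<^sub>m n | c. c \<noteq> 0}"

definition PGL :: "nat \<Rightarrow> complex mat set monoid" where
  "PGL n = GL n Mod scalars n"

lemma carrier_GL: "carrier (GL n) = {A \<in> carrier_mat n n. \<exists>B \<in> carrier_mat n n. B * A = 1\<^sub>m n \<and> A * B = 1\<^sub>m n}"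
  by (auto simp: GL_def units_of_def Units_def ring_mat_simps)

lemma mult_GL [simp]: "A \<otimes>\<^bsub>GL n\<^esub> B = A * B"
  by (simp add: GL_def units_of_def ring_mat_simps)

lemma one_GL [simp]: "\<one>\<^bsub>GL n\<^esub> = 1\<^sub>m n"
  by (simp add: GL_def units_of_def ring_mat_simps)

lemma group_GL: "group (GL n)"
proof -
  interpret ring "ring_mat TYPE(complex) n ()" by (rule ring_mat)
  show ?thesis unfolding GL_def by (rule units_group)
qed

lemma scalar_mult_scalar:
  "(c \<cdot>\<^sub>m 1\<^sub>m n) * (d \<cdot>\<^sub>m 1\<^sub>m n) = (c * d) \<cdot>\<^sub>m (1\<^sub>m n :: complex mat)"
  by (subst mult_smult_assoc_mat[of _ n n _ n], simp, simp) (auto intro!: eq_matI)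

lemma scalars_subset: "scalars n \<subseteq> carrier (GL n)"
proof
  fix A assume "A \<in> scalars n"
  then obtain c where c: "c \<noteq> 0" "A = c \<cdot>\<^sub>m 1\<^sub>m n" by (auto simp: scalars_def)
  let ?B = "inverse c \<cdot>\<^sub>m 1\<^sub>m n :: complex mat"
  have "?B * A = 1\<^sub>m n" "A * ?B = 1\<^sub>m n"
    using c by (auto simp: scalar_mult_scalar intro!: eq_matI)
  then show "A \<in> carrier (GL n)"
    unfolding carrier_GL using c by (intro CollectI conjI bexI[of _ ?B]) auto
qed

lemma scalar_central:
  assumes "A \<in> carrier (GL n)" "S \<in> scalars n"
  shows "A * S = S * A"
proof -
  obtain c where c: "S = c \<cdot>\<^sub>m 1\<^sub>m n" using assms by (auto simp: scalars_def)
  have A: "A \<in> carrier_mat n n" using assms by (simp add: carrier_GL)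
  have "A * S = c \<cdot>\<^sub>m A" using A by (simp add: c mult_smult_distrib[of _ n n _ n])
  moreover have "S * A = c \<cdot>\<^sub>m A" using A by (simp add: c mult_smult_assoc_mat[of _ n n _ n])
  ultimately show ?thesis by simp
qed

lemma scalars_normal: "scalars n \<lhd> GL n"
proof -
  interpret group "GL n" by (rule group_GL)
  have sub: "subgroup (scalars n) (GL n)"
  proof (rule subgroupI)
    have "1 \<cdot>\<^sub>m 1\<^sub>m n \<in> scalars n" unfolding scalars_def by (intro CollectI exI[of _ 1]) simp
    then show "scalars n \<noteq> {}" by auto
  next
    fix A assume A: "A \<in> scalars n"
    then obtain c where c: "c \<noteq> 0" "A = c \<cdot>\<^sub>m 1\<^sub>m n" by (auto simp: scalars_def)
    let ?B = "inverse c \<cdot>\<^sub>m 1\<^sub>m n :: complex mat"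
    have B: "?B \<in> scalars n" unfolding scalars_def using c by (intro CollectI exI[of _ "inverse c"]) simp
    have "?B \<otimes>\<^bsub>GL n\<^esub> A = \<one>\<^bsub>GL n\<^esub>"
      using c by (auto simp: scalar_mult_scalar intro!: eq_matI)
    then have "inv\<^bsub>GL n\<^esub> A = ?B"
      using A B scalars_subset by (intro inv_equality) auto
    then show "inv\<^bsub>GL n\<^esub> A \<in> scalars n" using B by simp
  next
    fix A B assume "A \<in> scalars n" "B \<in> scalars n"
    then obtain c d where "c \<noteq> 0" "A = c \<cdot>\<^sub>m 1\<^sub>m n" "d \<noteq> 0" "B = d \<cdot>\<^sub>m 1\<^sub>m n"
      by (auto simp: scalars_def)
    then show "A \<otimes>\<^bsub>GL n\<^esub> B \<in> scalars n"
      unfolding scalars_def by (auto simp: scalar_mult_scalar intro!: exI[of _ "c * d"])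
  qed (rule scalars_subset)
  show ?thesis
  proof (rule normalI[OF sub], intro ballI)
    fix A assume "A \<in> carrier (GL n)"
    then show "scalars n #>\<^bsub>GL n\<^esub> A = A <#\<^bsub>GL n\<^esub> scalars n"
      by (auto simp: r_coset_def l_coset_def scalar_central)
  qed
qed

lemma group_PGL: "group (PGL n)"
  unfolding PGL_def by (rule normal.factorgroup_is_group[OF scalars_normal])

section \<open>Diagonalizable subgroups\<close>

text \<open>An element of \<open>PGL n\<close> is a coset of \<open>scalars n\<close>, i.e. the set of its lifts to \<open>GL n\<close>. It is
  semisimple iff it is the image of a semisimple, i.e. diagonalizable, matrix; the lifts differ by
  nonzero scalars, so asking this of one lift or of every lift is the same.\<close>

definition semisimple_mat :: "complex mat \<Rightarrow> bool" where
  "semisimple_mat A \<longleftrightarrow> (\<exists>D. diagonal_mat D \<and> similar_mat A D)"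

definition semisimple_PGL :: "nat \<Rightarrow> complex mat set \<Rightarrow> bool" where
  "semisimple_PGL n X \<longleftrightarrow> X \<in> carrier (PGL n) \<and> (\<exists>A \<in> X. semisimple_mat A)"

definition diagonalizable_subgroup :: "nat \<Rightarrow> complex mat set set \<Rightarrow> bool" where
  "diagonalizable_subgroup n F \<longleftrightarrow>
     subgroup F (PGL n) \<and>
     (\<forall>X \<in> F. \<forall>Y \<in> F. X \<otimes>\<^bsub>PGL n\<^esub> Y = Y \<otimes>\<^bsub>PGL n\<^esub> X) \<and>
     (\<forall>X \<in> F. semisimple_PGL n X)"

definition maximal_diagonalizable_subgroup :: "nat \<Rightarrow> complex mat set set \<Rightarrow> bool" where
  "maximal_diagonalizable_subgroup n F \<longleftrightarrow>
     diagonalizable_subgroup n F \<and>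
     (\<forall>F'. diagonalizable_subgroup n F' \<and> F \<subseteq> F' \<longrightarrow> F' = F)"

definition finite_maximal_diagonalizable_subgroups :: "nat \<Rightarrow> complex mat set set set" where
  "finite_maximal_diagonalizable_subgroups n =
     {F. finite F \<and> maximal_diagonalizable_subgroup n F}"

definition conjugate_in :: "('a, 'b) monoid_scheme \<Rightarrow> 'a set \<Rightarrow> 'a set \<Rightarrow> bool" where
  "conjugate_in G F F' \<longleftrightarrow> (\<exists>g \<in> carrier G. F' = (\<lambda>x. g \<otimes>\<^bsub>G\<^esub> x \<otimes>\<^bsub>G\<^esub> inv\<^bsub>G\<^esub> g) ` F)"

definition conjugacy_classes_fmds :: "nat \<Rightarrow> complex mat set set set set" where
  "conjugacy_classes_fmds n =
     finite_maximal_diagonalizable_subgroups n //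
       {(F, F'). F \<in> finite_maximal_diagonalizable_subgroups n \<and>
                 F' \<in> finite_maximal_diagonalizable_subgroups n \<and> conjugate_in (PGL n) F F'}"

section \<open>Symplectic abelian groups\<close>

text \<open>The pairing takes values in \<open>C - {0}\<close>. As usual for symplectic forms, it is required to be
  alternating, \<open>\<langle>a,a\<rangle> = 1\<close>. This implies anti-symmetry, but anti-symmetry by itself only gives
  \<open>\<langle>a,a\<rangle> = 1\<close> or \<open>\<langle>a,a\<rangle> = -1\<close>. For instance \<open>\<langle>a,b\<rangle> = (-1)^(a1 b1 + a2 b2)\<close> on \<open>(Z/2)^2\<close> is
  anti-symmetric and nonsingular of order \<open>2^2\<close>, yet it does not correspond to any subgroup of
  PGL(2, C), whose finite maximal diagonalizable subgroups form a single conjugacy class (of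
  Klein four-groups).\<close>

locale symplectic_abelian_group = comm_group H for H :: "('h, 'm) monoid_scheme" (structure) +
  fixes pairing :: "'h \<Rightarrow> 'h \<Rightarrow> complex"
  assumes pairing_nonzero: "\<lbrakk>a \<in> carrier H; b \<in> carrier H\<rbrakk> \<Longrightarrow> pairing a b \<noteq> 0"
    and pairing_mult_left: "\<lbrakk>a \<in> carrier H; b \<in> carrier H; c \<in> carrier H\<rbrakk> \<Longrightarrow>
          pairing (a \<otimes> b) c = pairing a c * pairing b c"
    and pairing_mult_right: "\<lbrakk>a \<in> carrier H; b \<in> carrier H; c \<in> carrier H\<rbrakk> \<Longrightarrow>
          pairing a (b \<otimes> c) = pairing a b * pairing a c"
    and pairing_antisym: "\<lbrakk>a \<in> carrier H; b \<in> carrier H\<rbrakk> \<Longrightarrow>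
          pairing a b = inverse (pairing b a)"
    and pairing_alternating: "a \<in> carrier H \<Longrightarrow> pairing a a = 1"

definition nonsingular_pairing :: "('h, 'm) monoid_scheme \<Rightarrow> ('h \<Rightarrow> 'h \<Rightarrow> complex) \<Rightarrow> bool" where
  "nonsingular_pairing H p \<longleftrightarrow>
     (\<forall>a \<in> carrier H. (\<forall>b \<in> carrier H. p a b = 1) \<longrightarrow> a = \<one>\<^bsub>H\<^esub>)"

definition isometric ::
  "('h, 'm) monoid_scheme \<times> ('h \<Rightarrow> 'h \<Rightarrow> complex) \<Rightarrow>
   ('k, 'l) monoid_scheme \<times> ('k \<Rightarrow> 'k \<Rightarrow> complex) \<Rightarrow> bool" where
  "isometric S S' \<longleftrightarrow> (\<exists>h \<in> iso (fst S) (fst S').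
     \<forall>a \<in> carrier (fst S). \<forall>b \<in> carrier (fst S). snd S' (h a) (h b) = snd S a b)"

text \<open>Since HOL has no set of all groups, the groups below have elements of type \<^typ>\<open>nat\<close>. By
  \<open>isometric_to_nat\<close> this reaches every isometry class of finite nonsingular symplectic groups,
  over any type. Values of the multiplication and the pairing outside the carrier are irrelevant,
  as they are ignored by \<^const>\<open>isometric\<close>.\<close>

definition nonsingular_symplectic_groups :: "nat \<Rightarrow> (nat monoid \<times> (nat \<Rightarrow> nat \<Rightarrow> complex)) set" where
  "nonsingular_symplectic_groups m =
     {(H, p). symplectic_abelian_group H p \<and> nonsingular_pairing H p \<and>
              finite (carrier H) \<and> order H = m}"

definition isometry_classes_nsg :: "nat \<Rightarrow> (nat monoid \<times> (nat \<Rightarrow> nat \<Rightarrow> complex)) set set" where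
  "isometry_classes_nsg m =
     nonsingular_symplectic_groups m //
       {(S, S'). S \<in> nonsingular_symplectic_groups m \<and>
                 S' \<in> nonsingular_symplectic_groups m \<and> isometric S S'}"

section \<open>Conjugacy and isometry are equivalence relations\<close>

lemma equiv_conjugate:
  "equiv (finite_maximal_diagonalizable_subgroups n)
     {(F, F'). F \<in> finite_maximal_diagonalizable_subgroups n \<and>
               F' \<in> finite_maximal_diagonalizable_subgroups n \<and> conjugate_in (PGL n) F F'}"
proof -
  interpret group "PGL n" by (rule group_PGL)
  have sub: "F \<subseteq> carrier (PGL n)" if "F \<in> finite_maximal_diagonalizable_subgroups n" for F
    using that subgroup.subset
    unfolding finite_maximal_diagonalizable_subgroups_def maximal_diagonalizable_subgroup_def
      diagonalizable_subgroup_def by blast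
  have refl: "conjugate_in (PGL n) F F" if "F \<subseteq> carrier (PGL n)" for F
  proof -
    have "(\<lambda>x. \<one>\<^bsub>PGL n\<^esub> \<otimes>\<^bsub>PGL n\<^esub> x \<otimes>\<^bsub>PGL n\<^esub> inv\<^bsub>PGL n\<^esub> \<one>\<^bsub>PGL n\<^esub>) ` F = (\<lambda>x. x) ` F"
      using that by (intro image_cong) auto
    then show ?thesis unfolding conjugate_in_def by (intro bexI[of _ "\<one>\<^bsub>PGL n\<^esub>"]) auto
  qed
  have sym: "conjugate_in (PGL n) F' F"
    if F: "F \<subseteq> carrier (PGL n)" and c: "conjugate_in (PGL n) F F'" for F F'
  proof -
    obtain g where g: "g \<in> carrier (PGL n)"
      "F' = (\<lambda>x. g \<otimes>\<^bsub>PGL n\<^esub> x \<otimes>\<^bsub>PGL n\<^esub> inv\<^bsub>PGL n\<^esub> g) ` F"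
      using c unfolding conjugate_in_def by auto
    have "inv\<^bsub>PGL n\<^esub> g \<otimes>\<^bsub>PGL n\<^esub> (g \<otimes>\<^bsub>PGL n\<^esub> x \<otimes>\<^bsub>PGL n\<^esub> inv\<^bsub>PGL n\<^esub> g) \<otimes>\<^bsub>PGL n\<^esub> inv\<^bsub>PGL n\<^esub> (inv\<^bsub>PGL n\<^esub> g) = x"
      if "x \<in> F" for x
    proof -
      have x: "x \<in> carrier (PGL n)" using that F by auto
      have "inv\<^bsub>PGL n\<^esub> g \<otimes>\<^bsub>PGL n\<^esub> (g \<otimes>\<^bsub>PGL n\<^esub> x \<otimes>\<^bsub>PGL n\<^esub> inv\<^bsub>PGL n\<^esub> g) = x \<otimes>\<^bsub>PGL n\<^esub> inv\<^bsub>PGL n\<^esub> g"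
        using x g(1) by (simp add: m_assoc[symmetric])
      then show ?thesis using x g(1) by (simp add: m_assoc)
    qed
    then have "(\<lambda>x. inv\<^bsub>PGL n\<^esub> g \<otimes>\<^bsub>PGL n\<^esub> x \<otimes>\<^bsub>PGL n\<^esub> inv\<^bsub>PGL n\<^esub> (inv\<^bsub>PGL n\<^esub> g)) ` F' = F"
      unfolding g(2) image_image by (simp cong: image_cong)
    then show ?thesis unfolding conjugate_in_def using g(1) by (metis inv_closed)
  qed
  have trans: "conjugate_in (PGL n) F F''"
    if F: "F \<subseteq> carrier (PGL n)" and c: "conjugate_in (PGL n) F F'" "conjugate_in (PGL n) F' F''" for F F' F''
  proof -
    obtain g h where g: "g \<in> carrier (PGL n)" "h \<in> carrier (PGL n)"
      "F' = (\<lambda>x. g \<otimes>\<^bsub>PGL n\<^esub> x \<otimes>\<^bsub>PGL n\<^esub> inv\<^bsub>PGL n\<^esub> g) ` F"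
      "F'' = (\<lambda>x. h \<otimes>\<^bsub>PGL n\<^esub> x \<otimes>\<^bsub>PGL n\<^esub> inv\<^bsub>PGL n\<^esub> h) ` F'"
      using c unfolding conjugate_in_def by blast
    have "F'' = (\<lambda>x. (h \<otimes>\<^bsub>PGL n\<^esub> g) \<otimes>\<^bsub>PGL n\<^esub> x \<otimes>\<^bsub>PGL n\<^esub> inv\<^bsub>PGL n\<^esub> (h \<otimes>\<^bsub>PGL n\<^esub> g)) ` F"
      unfolding g(3,4) image_image using F g(1,2)
      by (intro image_cong) (auto simp: inv_mult_group m_assoc subset_iff)
    then show ?thesis unfolding conjugate_in_def using g(1,2) by blast
  qed
  show ?thesis
    by (intro equivI refl_onI symI transI) (use sub in \<open>auto intro: refl sym trans\<close>)
qed

lemma isometric_refl: "isometric S S"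
  unfolding isometric_def using id_iso[of "fst S"] by (intro bexI[of _ id]) (auto simp: id_def)

lemma isometric_sym:
  assumes "group (fst S)" "isometric S S'"
  shows "isometric S' S"
proof -
  obtain h where h: "h \<in> iso (fst S) (fst S')"
    "\<forall>a \<in> carrier (fst S). \<forall>b \<in> carrier (fst S). snd S' (h a) (h b) = snd S a b"
    using assms(2) unfolding isometric_def by blast
  let ?k = "inv_into (carrier (fst S)) h"
  have bij: "bij_betw h (carrier (fst S)) (carrier (fst S'))" using h(1) by (simp add: iso_def)
  have "?k \<in> iso (fst S') (fst S)" using group.iso_set_sym[OF assms(1) h(1)] .
  moreover have "snd S (?k a) (?k b) = snd S' a b"
    if "a \<in> carrier (fst S')" "b \<in> carrier (fst S')" for a b
  proof -
    have "?k a \<in> carrier (fst S)" "?k b \<in> carrier (fst S)" "h (?k a) = a" "h (?k b) = b"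
      using that bij by (auto simp: bij_betw_def inv_into_into f_inv_into_f)
    then show ?thesis using h(2) by metis
  qed
  ultimately show ?thesis unfolding isometric_def by blast
qed

lemma isometric_trans:
  assumes "isometric S S'" "isometric S' S''"
  shows "isometric S S''"
proof -
  obtain h k where h: "h \<in> iso (fst S) (fst S')"
    "\<forall>a \<in> carrier (fst S). \<forall>b \<in> carrier (fst S). snd S' (h a) (h b) = snd S a b"
    and k: "k \<in> iso (fst S') (fst S'')"
    "\<forall>a \<in> carrier (fst S'). \<forall>b \<in> carrier (fst S'). snd S'' (k a) (k b) = snd S' a b"
    using assms unfolding isometric_def by blast
  have "h a \<in> carrier (fst S')" if "a \<in> carrier (fst S)" for a
    using h(1) that by (auto simp: iso_def bij_betw_def)
  then show ?thesis unfolding isometric_def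
    using h(2) k(2) iso_set_trans[OF h(1) k(1)] by (intro bexI[of _ "k \<circ> h"]) auto
qed

lemma equiv_isometric:
  "equiv (nonsingular_symplectic_groups m)
     {(S, S'). S \<in> nonsingular_symplectic_groups m \<and>
               S' \<in> nonsingular_symplectic_groups m \<and> isometric S S'}"
proof -
  have "group (fst S)" if "S \<in> nonsingular_symplectic_groups m" for S
    using that unfolding nonsingular_symplectic_groups_def symplectic_abelian_group_def comm_group_def
    by auto
  then show ?thesis
    by (intro equivI refl_onI symI transI)
       (auto intro: isometric_refl isometric_sym isometric_trans)
qed

lemma isometric_to_nat:
  fixes H :: "'h monoid"
  assumes H: "symplectic_abelian_group H p" "nonsingular_pairing H p"
    and fin: "finite (carrier H)"
  shows "\<exists>S \<in> nonsingular_symplectic_groups (order H). isometric (H, p) S"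
proof -
  interpret symplectic_abelian_group H p by (rule H)
  obtain f :: "'h \<Rightarrow> nat" where inj: "inj_on f (carrier H)"
    using fin finite_imp_inj_to_nat_seg by blast
  let ?g = "inv_into (carrier H) f"
  define K where "K = \<lparr>carrier = f ` carrier H, mult = (\<lambda>x y. f (?g x \<otimes>\<^bsub>H\<^esub> ?g y)), one = f \<one>\<^bsub>H\<^esub>\<rparr>"
  define q where "q = (\<lambda>x y. p (?g x) (?g y))"
  have gf [simp]: "?g (f a) = a" if "a \<in> carrier H" for a using inj that by simp
  have Kc [simp]: "carrier K = f ` carrier H" by (simp add: K_def)
  have Km [simp]: "f a \<otimes>\<^bsub>K\<^esub> f b = f (a \<otimes>\<^bsub>H\<^esub> b)" if "a \<in> carrier H" "b \<in> carrier H" for a b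
    using that by (simp add: K_def)
  have K1 [simp]: "\<one>\<^bsub>K\<^esub> = f \<one>\<^bsub>H\<^esub>" by (simp add: K_def)
  have qf [simp]: "q (f a) (f b) = p a b" if "a \<in> carrier H" "b \<in> carrier H" for a b
    using that by (simp add: q_def)
  have comm: "comm_group K"
  proof (rule comm_groupI)
    fix x assume "x \<in> carrier K"
    then obtain a where "a \<in> carrier H" "x = f a" by auto
    then show "\<exists>y \<in> carrier K. y \<otimes>\<^bsub>K\<^esub> x = \<one>\<^bsub>K\<^esub>"
      by (intro bexI[of _ "f (inv\<^bsub>H\<^esub> a)"]) auto
  qed (auto simp: m_assoc intro: arg_cong[OF m_comm])
  have "symplectic_abelian_group K q"
    by (intro symplectic_abelian_group.intro[OF comm] symplectic_abelian_group_axioms.intro)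
       (auto simp: pairing_nonzero pairing_mult_left pairing_mult_right pairing_alternating
             intro: pairing_antisym)
  moreover have "nonsingular_pairing K q"
    using H(2) unfolding nonsingular_pairing_def by auto
  moreover have "order K = order H" using inj by (simp add: order_def card_image)
  ultimately have "(K, q) \<in> nonsingular_symplectic_groups (order H)"
    using fin by (auto simp: nonsingular_symplectic_groups_def)
  moreover have "isometric (H, p) (K, q)"
    unfolding isometric_def using inj
    by (auto simp: iso_def hom_def bij_betw_def intro!: bexI[of _ f])
  ultimately show ?thesis by blast
qed

end

theory Submission
  imports Defs "HOL-Algebra.Multiplicative_Group" "Jordan_Normal_Form.Spectral_Radius"
    "Jordan_Normal_Form.Jordan_Normal_Form_Existence"
begin

text \<open>Lifts of commuting elements of \<open>PGL\<close> commute up to a scalar, so an abelian subgroup \<open>F\<close> of \<open>PGL\<close>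
  carries a commutator pairing, which is alternating. If \<open>F\<close> is finite, the lifts form a projective
  representation \<open>A\<close> of \<open>F\<close>. Call such a faithful projective representation a Heisenberg representation
  if only scalar matrices commute with all \<open>A x\<close>. The theorem holds because finite maximal diagonalizable
  subgroups are exactly the images of Heisenberg representations, and because these are classified by
  their pairing.

  A finite maximal diagonalizable subgroup has scalar commutant (\<open>scalar_commutant_if_maximal\<close>): as in
  Maschke's theorem, averaging over the group shows that a nonscalar commutant contains a nontrivial
  idempotent. It generates a torus that commutes with the subgroup, and adjoining torsion elements
  of this torus contradicts maximality.

  Conversely, let the commutant be scalar. The pairing is nonsingular, since lifts of elements of its
  radical lie in the commutant. The average of any matrix over the group is a scalar matrix, which gives
  the orthogonality relations of Schur (\<open>orthogonality\<close>). Together with nonsingularity, they imply that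
  the group has order \<open>n\<^sup>2\<close> (\<open>card_eq\<close>) and that its image in \<open>PGL\<close> is its own centralizer
  (\<open>self_centralizing\<close>), hence maximal (\<open>image_maximal\<close>). Its elements are semisimple because
  they have finite order (\<open>semisimple_if_power_scalar\<close>).

  Two Heisenberg representations \<open>A\<close> and \<open>B\<close> of the same group with the same pairing are conjugate
  (\<open>heisenberg_rep_unique\<close>): the operators that send \<open>M\<close> to \<open>B x * M * inv (A x)\<close> commute and have
  finite order up to scalars, so they have a common eigenvector \<open>M\<close>, and a Schur type argument shows that
  \<open>M\<close> is invertible.

  Every nonsingular symplectic group of order \<open>n\<^sup>2\<close> has a Heisenberg representation (\<open>ex_heisenberg_rep\<close>):
  splitting off hyperbolic pairs writes it as the product of two isotropic subgroups \<open>L\<close> and \<open>M\<close>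
  (\<open>ex_polarization\<close>), which act on the functions on \<open>M\<close> by characters and by translations.\<close>

section \<open>Complex matrices\<close>

text \<open>The middle dimension is fixed here, so that the simplifier can discharge the carrier conditions
  of the associative and distributive laws.\<close>

lemma mult_square_carrier [simp, intro]:
  "A \<in> carrier_mat n n \<Longrightarrow> B \<in> carrier_mat n n \<Longrightarrow> A * B \<in> carrier_mat n n"
  by (rule mult_carrier_mat)

lemma GL_carrier_mat [simp, intro]: "A \<in> carrier (GL n) \<Longrightarrow> A \<in> carrier_mat n n"
  by (simp add: carrier_GL)

lemma GL_I:
  assumes "A \<in> carrier_mat n n" "B \<in> carrier_mat n n" "B * A = 1\<^sub>m n"
  shows "A \<in> carrier (GL n)"
  unfolding carrier_GL using assms mat_mult_left_right_inverse[of B n A] by blast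

lemma GL_mult [simp, intro]:
  "A \<in> carrier (GL n) \<Longrightarrow> B \<in> carrier (GL n) \<Longrightarrow> A * B \<in> carrier (GL n)"
  using monoid.m_closed[OF group.is_monoid[OF group_GL], of A n B] by (simp only: mult_GL)

lemma GL_inv [simp, intro]: "A \<in> carrier (GL n) \<Longrightarrow> inv\<^bsub>GL n\<^esub> A \<in> carrier (GL n)"
  by (rule group.inv_closed[OF group_GL])

lemma GL_inv_mult:
  assumes "A \<in> carrier (GL n)"
  shows "inv\<^bsub>GL n\<^esub> A * A = 1\<^sub>m n" "A * inv\<^bsub>GL n\<^esub> A = 1\<^sub>m n"
  using group.l_inv[OF group_GL assms] group.r_inv[OF group_GL assms] by simp_all

lemma GL_inv_cancel:
  assumes A: "A \<in> carrier (GL n)" and B: "B \<in> carrier_mat n n"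
  shows "inv\<^bsub>GL n\<^esub> A * (A * B) = B" "A * (inv\<^bsub>GL n\<^esub> A * B) = B"
    "B * A * inv\<^bsub>GL n\<^esub> A = B" "B * inv\<^bsub>GL n\<^esub> A * A = B"
proof -
  have c: "A \<in> carrier_mat n n" "inv\<^bsub>GL n\<^esub> A \<in> carrier_mat n n" using A by auto
  show "inv\<^bsub>GL n\<^esub> A * (A * B) = B" "A * (inv\<^bsub>GL n\<^esub> A * B) = B"
    "B * A * inv\<^bsub>GL n\<^esub> A = B" "B * inv\<^bsub>GL n\<^esub> A * A = B"
    using c B GL_inv_mult[OF A]
    by (simp_all add: assoc_mult_mat[OF B] assoc_mult_mat[symmetric, OF _ _ B])
qed

lemma smult_smult: "a \<cdot>\<^sub>m (b \<cdot>\<^sub>m A) = (a * b :: complex) \<cdot>\<^sub>m A"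
  by (auto intro!: eq_matI)

lemma GL_smult:
  assumes "A \<in> carrier (GL n)" "c \<noteq> 0"
  shows "c \<cdot>\<^sub>m A \<in> carrier (GL n)"
proof (rule GL_I[of _ _ "inverse c \<cdot>\<^sub>m inv\<^bsub>GL n\<^esub> A"])
  have c: "A \<in> carrier_mat n n" "inv\<^bsub>GL n\<^esub> A \<in> carrier_mat n n" using assms by auto
  then have "inverse c \<cdot>\<^sub>m inv\<^bsub>GL n\<^esub> A * (c \<cdot>\<^sub>m A) = (inverse c * c) \<cdot>\<^sub>m (inv\<^bsub>GL n\<^esub> A * A)"
    by (simp add: mult_smult_distrib[of _ n n _ n] mult_smult_assoc_mat[of _ n n _ n] smult_smult mult.commute)
  then show "inverse c \<cdot>\<^sub>m inv\<^bsub>GL n\<^esub> A * (c \<cdot>\<^sub>m A) = 1\<^sub>m n"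
    using assms by (simp add: GL_inv_mult) (auto intro!: eq_matI)
qed (use assms in auto)

lemma GL_nonzero: "A \<in> carrier (GL n) \<Longrightarrow> n > 0 \<Longrightarrow> A \<noteq> 0\<^sub>m n n"
proof
  assume A: "A \<in> carrier (GL n)" and n: "n > 0" and 0: "A = 0\<^sub>m n n"
  have "1\<^sub>m n = inv\<^bsub>GL n\<^esub> A * A" using GL_inv_mult[OF A] by simp
  also have "\<dots> = 0\<^sub>m n n" unfolding 0 using GL_inv[OF A] by (intro right_mult_zero_mat) (auto simp: 0)
  finally have "(1\<^sub>m n :: complex mat) $$ (0, 0) = 0\<^sub>m n n $$ (0, 0)" by (rule arg_cong)
  then show False using n by simp
qed

lemma smult_mat_1 [simp]: "(1::complex) \<cdot>\<^sub>m A = A"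
  by (auto intro!: eq_matI)

lemma smult_zero_mat: "A \<in> carrier_mat n n \<Longrightarrow> (0::complex) \<cdot>\<^sub>m A = 0\<^sub>m n n"
  by (auto intro!: eq_matI)

lemma smult_mat_cancel:
  fixes A :: "complex mat"
  assumes "c \<cdot>\<^sub>m A = d \<cdot>\<^sub>m A" "A \<in> carrier_mat n n" "A \<noteq> 0\<^sub>m n n"
  shows "c = d"
proof (rule ccontr)
  assume "c \<noteq> d"
  have "A $$ (i, j) = 0" if "i < n" "j < n" for i j
  proof -
    have "c * A $$ (i, j) = d * A $$ (i, j)"
      using arg_cong[OF assms(1), of "\<lambda>M. M $$ (i, j)"] assms(2) that by auto
    then show ?thesis using \<open>c \<noteq> d\<close> by simp
  qed
  then have "A = 0\<^sub>m n n" using assms(2) by (intro eq_matI) auto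
  then show False using assms(3) by simp
qed

lemma mult_one_smult:
  fixes A :: "complex mat"
  assumes "A \<in> carrier_mat n n"
  shows "c \<cdot>\<^sub>m 1\<^sub>m n * A = c \<cdot>\<^sub>m A" "A * (c \<cdot>\<^sub>m 1\<^sub>m n) = c \<cdot>\<^sub>m A"
  using assms by (simp_all add: mult_smult_distrib[of _ n n _ n] mult_smult_assoc_mat[of _ n n _ n])

definition mat_trace :: "complex mat \<Rightarrow> complex" where
  "mat_trace A = (\<Sum>i<dim_row A. A $$ (i, i))"

lemma mat_trace_mult:
  assumes "A \<in> carrier_mat n n" "B \<in> carrier_mat n n"
  shows "mat_trace (A * B) = (\<Sum>i<n. \<Sum>j<n. A $$ (i, j) * B $$ (j, i))"
  using assms unfolding mat_trace_def
  by (auto simp: scalar_prod_def atLeast0LessThan intro!: sum.cong)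

lemma mat_trace_commute:
  assumes "A \<in> carrier_mat n n" "B \<in> carrier_mat n n"
  shows "mat_trace (A * B) = mat_trace (B * A)"
  unfolding mat_trace_mult[OF assms] mat_trace_mult[OF assms(2,1)]
  by (subst sum.swap) (simp add: mult.commute)

lemma mat_trace_smult: "A \<in> carrier_mat n n \<Longrightarrow> mat_trace (c \<cdot>\<^sub>m A) = c * mat_trace A"
  by (auto simp: mat_trace_def sum_distrib_left)

lemma mat_trace_one [simp]: "mat_trace (1\<^sub>m n) = of_nat n"
  by (simp add: mat_trace_def)

lemma mat_trace_nondegenerate:
  assumes A: "A \<in> carrier_mat n n" "A \<noteq> 0\<^sub>m n n"
  obtains B where "B \<in> carrier_mat n n" "mat_trace (B * A) \<noteq> 0"
proof -
  obtain k l where kl: "k < n" "l < n" "A $$ (k, l) \<noteq> 0"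
  proof -
    have "\<exists>k<n. \<exists>l<n. A $$ (k, l) \<noteq> 0"
    proof (rule ccontr)
      assume "\<not> ?thesis"
      then have "A = 0\<^sub>m n n" using A(1) by (intro eq_matI) auto
      then show False using A(2) by simp
    qed
    then show ?thesis using that by blast
  qed
  let ?B = "mat n n (\<lambda>(i, j). if i = l \<and> j = k then 1 else 0) :: complex mat"
  have "mat_trace (?B * A) = (\<Sum>i<n. \<Sum>j<n. if j = k then (if i = l then A $$ (k, l) else 0) else 0)"
    unfolding mat_trace_mult[of ?B, OF _ A(1), simplified] by (intro sum.cong) auto
  also have "\<dots> = A $$ (k, l)" using kl by simp
  finally show ?thesis using kl that[of ?B] by simp
qed

text \<open>Matrices of all sizes share one type, which is not an additive monoid, so the sum is formed
  entry by entry.\<close>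

definition mat_sum :: "nat \<Rightarrow> ('a \<Rightarrow> complex mat) \<Rightarrow> 'a set \<Rightarrow> complex mat" where
  "mat_sum n f I = mat n n (\<lambda>(i, j). \<Sum>x\<in>I. f x $$ (i, j))"

lemma mat_sum_carrier [simp, intro]: "mat_sum n f I \<in> carrier_mat n n"
  by (simp add: mat_sum_def)

lemma mat_sum_index: "i < n \<Longrightarrow> j < n \<Longrightarrow> mat_sum n f I $$ (i, j) = (\<Sum>x\<in>I. f x $$ (i, j))"
  by (simp add: mat_sum_def)

lemma mat_sum_cong: "(\<And>x. x \<in> I \<Longrightarrow> f x = g x) \<Longrightarrow> mat_sum n f I = mat_sum n g I"
  by (auto simp: mat_sum_def intro!: eq_matI sum.cong)

lemma mat_sum_reindex: "bij_betw h I J \<Longrightarrow> mat_sum n (\<lambda>x. f (h x)) I = mat_sum n f J"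
  using sum.reindex_bij_betw[of h I J] by (auto simp: mat_sum_def intro!: eq_matI)

lemma mult_mat_sum:
  assumes B: "B \<in> carrier_mat n n" and f: "\<And>x. x \<in> I \<Longrightarrow> f x \<in> carrier_mat n n"
  shows "B * mat_sum n f I = mat_sum n (\<lambda>x. B * f x) I"
proof (rule eq_matI)
  fix i j assume ij: "i < dim_row (mat_sum n (\<lambda>x. B * f x) I)" "j < dim_col (mat_sum n (\<lambda>x. B * f x) I)"
  then have ij: "i < n" "j < n" by (simp_all add: mat_sum_def)
  have "(B * mat_sum n f I) $$ (i, j) = (\<Sum>k<n. \<Sum>x\<in>I. B $$ (i, k) * f x $$ (k, j))"
    using B ij by (auto simp: scalar_prod_def mat_sum_index sum_distrib_left atLeast0LessThan mat_sum_def intro!: sum.cong)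
  also have "\<dots> = (\<Sum>x\<in>I. \<Sum>k<n. B $$ (i, k) * f x $$ (k, j))" by (rule sum.swap)
  also have "\<dots> = (\<Sum>x\<in>I. (B * f x) $$ (i, j))"
  proof (rule sum.cong[OF refl])
    fix x assume "x \<in> I"
    then have "f x \<in> carrier_mat n n" by (rule f)
    then show "(\<Sum>k<n. B $$ (i, k) * f x $$ (k, j)) = (B * f x) $$ (i, j)"
      using B ij by (auto simp: scalar_prod_def atLeast0LessThan)
  qed
  finally show "(B * mat_sum n f I) $$ (i, j) = mat_sum n (\<lambda>x. B * f x) I $$ (i, j)"
    using ij by (simp add: mat_sum_index)
qed (use B in \<open>auto simp: mat_sum_def\<close>)

lemma mat_sum_mult:
  assumes B: "B \<in> carrier_mat n n" and f: "\<And>x. x \<in> I \<Longrightarrow> f x \<in> carrier_mat n n"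
  shows "mat_sum n f I * B = mat_sum n (\<lambda>x. f x * B) I"
proof (rule eq_matI)
  fix i j assume ij: "i < dim_row (mat_sum n (\<lambda>x. f x * B) I)" "j < dim_col (mat_sum n (\<lambda>x. f x * B) I)"
  then have ij: "i < n" "j < n" by (simp_all add: mat_sum_def)
  have "(mat_sum n f I * B) $$ (i, j) = (\<Sum>k<n. \<Sum>x\<in>I. f x $$ (i, k) * B $$ (k, j))"
    using B ij by (auto simp: scalar_prod_def mat_sum_index sum_distrib_right atLeast0LessThan mat_sum_def intro!: sum.cong)
  also have "\<dots> = (\<Sum>x\<in>I. \<Sum>k<n. f x $$ (i, k) * B $$ (k, j))" by (rule sum.swap)
  also have "\<dots> = (\<Sum>x\<in>I. (f x * B) $$ (i, j))"
  proof (rule sum.cong[OF refl])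
    fix x assume "x \<in> I"
    then have "f x \<in> carrier_mat n n" by (rule f)
    then show "(\<Sum>k<n. f x $$ (i, k) * B $$ (k, j)) = (f x * B) $$ (i, j)"
      using B ij by (auto simp: scalar_prod_def atLeast0LessThan)
  qed
  finally show "(mat_sum n f I * B) $$ (i, j) = mat_sum n (\<lambda>x. f x * B) I $$ (i, j)"
    using ij by (simp add: mat_sum_index)
qed (use B in \<open>auto simp: mat_sum_def\<close>)

lemma smult_mat_sum:
  assumes f: "\<And>x. x \<in> I \<Longrightarrow> f x \<in> carrier_mat n n"
  shows "c \<cdot>\<^sub>m mat_sum n f I = mat_sum n (\<lambda>x. c \<cdot>\<^sub>m f x) I"
  by (rule eq_matI) (auto simp: mat_sum_def sum_distrib_left intro!: sum.cong simp: carrier_matD[OF f])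

lemma mat_trace_sum:
  assumes f: "\<And>x. x \<in> I \<Longrightarrow> f x \<in> carrier_mat n n"
  shows "mat_trace (mat_sum n f I) = (\<Sum>x\<in>I. mat_trace (f x))"
proof -
  have "mat_trace (mat_sum n f I) = (\<Sum>i<n. \<Sum>x\<in>I. f x $$ (i, i))"
    by (simp add: mat_trace_def mat_sum_def)
  also have "\<dots> = (\<Sum>x\<in>I. \<Sum>i<n. f x $$ (i, i))" by (rule sum.swap)
  also have "\<dots> = (\<Sum>x\<in>I. mat_trace (f x))"
    by (intro sum.cong refl) (auto simp: mat_trace_def carrier_matD[OF f])
  finally show ?thesis .
qed

text \<open>A matrix in reduced row echelon form has a generalized inverse made of zeros and ones, which
  can be read off its pivots; left multiplication by an invertible matrix transports it to \<open>N\<close>.\<close>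

lemma von_Neumann_regular:
  fixes N :: "complex mat"
  assumes N: "N \<in> carrier_mat n n"
  obtains Q where "Q \<in> carrier_mat n n" "N * Q * N = N"
proof -
  define R where "R = gauss_jordan_single N"
  note g = gauss_jordan_single[OF N R_def[symmetric]]
  have R: "R \<in> carrier_mat n n" using g(2) .
  obtain P P' where P: "R = P * N" "P \<in> carrier_mat n n" "P' \<in> carrier_mat n n" "P' * P = 1\<^sub>m n"
    using g(4) by blast
  obtain f where f: "pivot_fun R f n" using g(3) R unfolding row_echelon_form_def by auto
  have dR: "dim_row R = n" using R by simp
  note p = pivot_funD[OF dR f]
  define Q where "Q = mat n n (\<lambda>(j, i). if f i = j then 1 else 0 :: complex)"
  have Q: "Q \<in> carrier_mat n n" by (simp add: Q_def)
  \<comment> \<open>\<open>Q\<close> sends the row index of each pivot to its column, so \<open>R * Q\<close> is the projection onto the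
    rows that have a pivot; the other rows of \<open>R\<close> vanish.\<close>
  have RQ: "(R * Q) $$ (i, i') = (if i = i' \<and> f i < n then 1 else 0)" if "i < n" "i' < n" for i i'
  proof -
    have "(R * Q) $$ (i, i') = (\<Sum>j<n. R $$ (i, j) * (if f i' = j then 1 else 0))"
      using that R by (auto simp: Q_def scalar_prod_def atLeast0LessThan intro!: sum.cong)
    also have "\<dots> = (\<Sum>j<n. if f i' = j then R $$ (i, j) else 0)" by (intro sum.cong) auto
    also have "\<dots> = (if f i' < n then R $$ (i, f i') else 0)" by simp
    also have "\<dots> = (if i = i' \<and> f i < n then 1 else 0)" using p(4,5) that by auto
    finally show ?thesis .
  qed
  have "R * Q * R = R"
  proof (rule eq_matI)
    fix i j assume "i < dim_row R" "j < dim_col R"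
    then have ij: "i < n" "j < n" using R by auto
    have "(R * Q * R) $$ (i, j) = (\<Sum>k<n. (R * Q) $$ (i, k) * R $$ (k, j))"
    proof -
      have "(R * Q * R) $$ (i, j) = row (R * Q) i \<bullet> col R j"
        using ij R Q by (intro index_mult_mat(1)) auto
      also have "\<dots> = (\<Sum>k<n. (R * Q) $$ (i, k) * R $$ (k, j))"
        unfolding scalar_prod_def using ij R Q
        by (intro sum.cong) (auto simp: atLeast0LessThan)
      finally show ?thesis .
    qed
    also have "\<dots> = (\<Sum>k<n. if k = i then (if f i < n then R $$ (i, j) else 0) else 0)"
      using ij by (intro sum.cong) (auto simp: RQ simp del: index_mult_mat(1))
    also have "\<dots> = (if f i < n then R $$ (i, j) else 0)" using ij by simp
    also have "\<dots> = R $$ (i, j)" using p(1,2)[OF ij(1)] ij by (metis le_neq_implies_less)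
    finally show "(R * Q * R) $$ (i, j) = R $$ (i, j)" .
  qed (use R Q in auto)
  then have "P' * (P * (N * (Q * (P * N)))) = P' * (P * N)"
    unfolding P(1) using N P Q by (simp add: assoc_mult_mat[of _ n n _ n _ n])
  moreover have "P' * (P * Z) = Z" if "Z \<in> carrier_mat n n" for Z
    using that P by (simp add: assoc_mult_mat[symmetric, of P' n n P n Z n])
  ultimately have "N * (Q * (P * N)) = N" using N P Q by simp
  then have "N * (Q * P) * N = N" using N P Q by (simp add: assoc_mult_mat[of _ n n _ n _ n])
  then show ?thesis using P Q by (intro that[of "Q * P"]) auto
qed

text \<open>The superdiagonal of the \<open>k\<close>-th power of a Jordan block consists of the entries
  \<open>k * a ^ (k - 1)\<close>, which are nonzero if the diagonal is.\<close>

lemma jordan_block_power_scalar: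
  assumes "jordan_block m a ^\<^sub>m k = (c::complex) \<cdot>\<^sub>m 1\<^sub>m m" "c \<noteq> 0" "k > 0"
  shows "m \<le> 1"
proof (rule ccontr)
  assume "\<not> m \<le> 1"
  then have m: "0 < m" "1 < m" by auto
  have "a ^ k = c"
    using arg_cong[OF assms(1), of "\<lambda>M. M $$ (0, 0)"] m by (simp add: jordan_block_pow)
  moreover have "of_nat k * a ^ (k - 1) = 0"
    using arg_cong[OF assms(1), of "\<lambda>M. M $$ (0, 1)"] m by (simp add: jordan_block_pow)
  ultimately show False using assms(2,3) by (auto simp: power_0_left)
qed

lemma diagonal_diag_block_mat:
  assumes "\<And>A. A \<in> set As \<Longrightarrow> diagonal_mat A \<and> dim_row A = dim_col A"
  shows "diagonal_mat (diag_block_mat As)"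
  using assms
proof (induction As)
  case (Cons A As)
  define D where "D = diag_block_mat As"
  have sq: "dim_col D = dim_row D"
    using Cons.prems diag_block_mat_square[of As] by (simp add: D_def)
  have A: "diagonal_mat A" "dim_col A = dim_row A" using Cons.prems by auto
  have "diagonal_mat D" using Cons by (simp add: D_def)
  then show ?case using A sq unfolding diagonal_mat_def diag_block_mat.simps Let_def D_def[symmetric]
    by auto
qed (simp add: diagonal_mat_def)

lemma diag_block_mat_scalar:
  assumes "diag_block_mat As = (c::complex) \<cdot>\<^sub>m 1\<^sub>m m" "\<And>A. A \<in> set As \<Longrightarrow> dim_row A = dim_col A"
    "A \<in> set As"
  shows "A = c \<cdot>\<^sub>m 1\<^sub>m (dim_row A)"
  using assms
proof (induction As arbitrary: m)
  case (Cons B As)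
  define D where "D = diag_block_mat As"
  have sq: "dim_col B = dim_row B" "dim_col D = dim_row D"
    using Cons.prems(2) diag_block_mat_square[of As] by (simp_all add: D_def)
  have eq: "four_block_mat B (0\<^sub>m (dim_row B) (dim_col D)) (0\<^sub>m (dim_row D) (dim_col B)) D = c \<cdot>\<^sub>m 1\<^sub>m m"
    using Cons.prems(1) by (simp add: Let_def D_def)
  have m: "m = dim_row B + dim_row D" using arg_cong[OF eq, of dim_row] by simp
  have "B = c \<cdot>\<^sub>m 1\<^sub>m (dim_row B)"
  proof (rule eq_matI)
    fix i j assume "i < dim_row (c \<cdot>\<^sub>m 1\<^sub>m (dim_row B))" "j < dim_col (c \<cdot>\<^sub>m 1\<^sub>m (dim_row B))"
    then have "i < dim_row B" "j < dim_row B" by simp_all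
    then show "B $$ (i, j) = (c \<cdot>\<^sub>m 1\<^sub>m (dim_row B)) $$ (i, j)"
      using arg_cong[OF eq, of "\<lambda>M. M $$ (i, j)"] sq unfolding m by simp
  qed (use sq in auto)
  moreover have "D = c \<cdot>\<^sub>m 1\<^sub>m (dim_row D)"
  proof (rule eq_matI)
    fix i j assume "i < dim_row (c \<cdot>\<^sub>m 1\<^sub>m (dim_row D))" "j < dim_col (c \<cdot>\<^sub>m 1\<^sub>m (dim_row D))"
    then have "i < dim_row D" "j < dim_row D" by simp_all
    then show "D $$ (i, j) = (c \<cdot>\<^sub>m 1\<^sub>m (dim_row D)) $$ (i, j)"
      using arg_cong[OF eq, of "\<lambda>M. M $$ (i + dim_row B, j + dim_row B)"] sq unfolding m by simp
  qed (use sq in auto)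
  ultimately show ?case using Cons.IH[of "dim_row D"] Cons.prems(2,3) unfolding D_def by auto
qed simp

text \<open>Elements of finite order in \<open>PGL\<close> are semisimple: all Jordan blocks of a lift have size one,
  since a larger block has no nonzero scalar matrix among its positive powers.\<close>

lemma semisimple_if_power_scalar:
  assumes A: "A \<in> carrier_mat n n" and pow: "A ^\<^sub>m k = c \<cdot>\<^sub>m 1\<^sub>m n" and c: "c \<noteq> 0" "k > 0"
  shows "semisimple_mat A"
proof -
  obtain as where "char_poly A = (\<Prod>a\<leftarrow>as. [:- a, 1:])" using char_poly_factorized[OF A] by blast
  then obtain nas where nf: "jordan_nf A nas" using jordan_nf_exists[OF A] by blast
  let ?J = "jordan_matrix nas"
  have sim: "similar_mat A ?J" using nf by (simp add: jordan_nf_def)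
  then obtain P Q where "similar_mat_wit A ?J P Q" by (auto simp: similar_mat_def)
  then have wit: "similar_mat_wit ?J A Q P" by (rule similar_mat_wit_sym)
  note PQ = similar_mat_witD(1,6,7,5)[OF refl wit]
  have n: "dim_row ?J = n" using carrier_matD(1)[OF PQ(4)] carrier_matD(1)[OF A] by (rule trans[OF sym])
  have "?J ^\<^sub>m k = Q * (c \<cdot>\<^sub>m 1\<^sub>m n) * P" using similar_mat_wit_pow_id[OF wit, of k] pow by simp
  also have "\<dots> = c \<cdot>\<^sub>m 1\<^sub>m n"
    using PQ unfolding n by (simp add: mult_one_smult mult_smult_assoc_mat[of _ n n _ n])
  finally have J: "diag_block_mat (map (\<lambda>(m, a). jordan_block m a ^\<^sub>m k) nas) = c \<cdot>\<^sub>m 1\<^sub>m n"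
    unfolding jordan_matrix_pow .
  have le1: "m \<le> 1" if "(m, a) \<in> set nas" for m a
    using diag_block_mat_scalar[OF J, of "jordan_block m a ^\<^sub>m k"] that c
    by (intro jordan_block_power_scalar[of m a k c]) force+
  have "diagonal_mat ?J" unfolding jordan_matrix_def
    by (rule diagonal_diag_block_mat) (auto simp: diagonal_mat_def dest!: le1)
  then show ?thesis using sim by (auto simp: semisimple_mat_def)
qed

text \<open>Let \<open>T\<close> be the operator \<open>N \<mapsto> P * N * Q\<close>. If some power of \<open>T\<close> multiplies \<open>M\<close> by a nonzero
  scalar, then \<open>T\<close> has an eigenvector in the span of the \<open>T ^^ i\<close> applied to \<open>M\<close>. The conclusion shows
  the eigenvector as such a linear combination because every operator that commutes with \<open>T\<close> and has \<open>M\<close>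
  as an eigenvector then keeps it as an eigenvector; this is how a common eigenvector of several
  operators is built up.\<close>

lemma conjugation_eigenmatrix:
  assumes P: "P \<in> carrier_mat n n" and Q: "Q \<in> carrier_mat n n"
    and M: "M \<in> carrier_mat n n" "M \<noteq> 0\<^sub>m n n"
    and k: "k > 0" "c \<noteq> 0" and pow: "((\<lambda>N. P * N * Q) ^^ k) M = c \<cdot>\<^sub>m M"
  obtains a \<mu> where
    "mat_sum n (\<lambda>i. a i \<cdot>\<^sub>m ((\<lambda>N. P * N * Q) ^^ i) M) {..<k} \<noteq> 0\<^sub>m n n"
    "P * mat_sum n (\<lambda>i. a i \<cdot>\<^sub>m ((\<lambda>N. P * N * Q) ^^ i) M) {..<k} * Q
      = \<mu> \<cdot>\<^sub>m mat_sum n (\<lambda>i. a i \<cdot>\<^sub>m ((\<lambda>N. P * N * Q) ^^ i) M) {..<k}"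
proof -
  define T where "T = (\<lambda>N. P * N * Q)"
  define S where "S z = mat_sum n (\<lambda>i. z ^ i \<cdot>\<^sub>m (T ^^ i) M) {..<k}" for z
  have T: "(T ^^ i) M \<in> carrier_mat n n" for i
    using P Q M by (induction i) (auto simp: T_def)
  have "\<exists>z. z ^ k = inverse c \<and> S z \<noteq> 0\<^sub>m n n"
  \<comment> \<open>Otherwise every entry of \<open>S z\<close>, a polynomial in \<open>z\<close> of degree less than \<open>k\<close>, has \<open>k\<close> roots,
    so its constant term vanishes; but \<open>M\<close> is the matrix of these constant terms.\<close>
  proof (rule ccontr)
    assume neg: "\<not> ?thesis"
    have "M $$ (i, j) = 0" if ij: "i < n" "j < n" for i j
    proof (rule ccontr)
      assume nz: "M $$ (i, j) \<noteq> 0"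
      let ?e = "\<lambda>r. (T ^^ r) M $$ (i, j)"
      have "finite {z. (\<Sum>r\<le>k-1. ?e r * z ^ r) = 0} \<and> card {z. (\<Sum>r\<le>k-1. ?e r * z ^ r) = 0} \<le> k - 1"
        by (rule polyfun_rootbound[of ?e 0]) (use nz in auto)
      moreover have "{z. z ^ k = inverse c} \<subseteq> {z. (\<Sum>r\<le>k-1. ?e r * z ^ r) = 0}"
      proof safe
        fix z assume "z ^ k = inverse c"
        then have "S z $$ (i, j) = 0" using neg ij by auto
        then have "(\<Sum>r<k. z ^ r * ?e r) = 0"
          using ij T by (simp add: S_def mat_sum_index carrier_matD[OF T])
        moreover have "{..<k} = {..k-1}" using k by auto
        ultimately show "(\<Sum>r\<le>k-1. ?e r * z ^ r) = 0" by (simp add: mult.commute)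
      qed
      ultimately have "card {z. z ^ k = inverse c} \<le> k - 1" using card_mono order_trans by blast
      then show False using card_nth_roots[of "inverse c" k] k by simp
    qed
    then have "M = 0\<^sub>m n n" using M by (intro eq_matI) auto
    then show False using M by simp
  qed
  then obtain z where z: "z ^ k = inverse c" "S z \<noteq> 0\<^sub>m n n" by blast
  have z0: "z \<noteq> 0" using z(1) k by (metis inverse_nonzero_iff_nonzero power_eq_0_iff)
  have "P * S z * Q = inverse z \<cdot>\<^sub>m S z"
  proof -
    have Tc: "z ^ i \<cdot>\<^sub>m (T ^^ i) M \<in> carrier_mat n n" for i using T by simp
    have "P * S z * Q = mat_sum n (\<lambda>i. P * (z ^ i \<cdot>\<^sub>m (T ^^ i) M) * Q) {..<k}"
      unfolding S_def using P Q Tc by (simp add: mult_mat_sum mat_sum_mult)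
    also have "\<dots> = mat_sum n (\<lambda>i. inverse z \<cdot>\<^sub>m (z ^ Suc i \<cdot>\<^sub>m (T ^^ Suc i) M)) {..<k}"
    proof (rule mat_sum_cong)
      fix i
      have "P * (z ^ i \<cdot>\<^sub>m (T ^^ i) M) * Q = z ^ i \<cdot>\<^sub>m (P * (T ^^ i) M * Q)"
        using P Q T[of i] by (simp add: mult_smult_distrib[of _ n n _ n] mult_smult_assoc_mat[of _ n n _ n])
      then show "P * (z ^ i \<cdot>\<^sub>m (T ^^ i) M) * Q = inverse z \<cdot>\<^sub>m (z ^ Suc i \<cdot>\<^sub>m (T ^^ Suc i) M)"
        using z0 by (simp add: smult_smult T_def mult.assoc[symmetric])
    qed
    also have "\<dots> = inverse z \<cdot>\<^sub>m mat_sum n (\<lambda>i. z ^ Suc i \<cdot>\<^sub>m (T ^^ Suc i) M) {..<k}"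
      using Tc[of "Suc _"] by (subst smult_mat_sum) auto
    also have "mat_sum n (\<lambda>i. z ^ Suc i \<cdot>\<^sub>m (T ^^ Suc i) M) {..<k} = S z"
    proof (rule eq_matI)
      fix i j assume "i < dim_row (S z)" "j < dim_col (S z)"
      then have ij: "i < n" "j < n" by (auto simp: S_def mat_sum_def)
      let ?g = "\<lambda>r. (z ^ r \<cdot>\<^sub>m (T ^^ r) M) $$ (i, j)"
      have "?g k = ?g 0" using z ij M k pow by (simp add: T_def[symmetric])
      then have "(\<Sum>r<k. ?g (Suc r)) = (\<Sum>r<k. ?g r)"
        using sum.lessThan_Suc_shift[of ?g k] sum.lessThan_Suc[of ?g k] by simp
      then show "mat_sum n (\<lambda>i. z ^ Suc i \<cdot>\<^sub>m (T ^^ Suc i) M) {..<k} $$ (i, j) = S z $$ (i, j)"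
        using ij by (simp add: S_def mat_sum_index del: funpow.simps power_Suc)
    qed (auto simp: S_def mat_sum_def)
    finally show ?thesis .
  qed
  then show ?thesis using z(2) that[of "\<lambda>i. z ^ i" "inverse z"] by (simp add: S_def T_def)
qed

section \<open>Elements of PGL as classes of matrices\<close>

definition pgl :: "nat \<Rightarrow> complex mat \<Rightarrow> complex mat set" where
  "pgl n A = scalars n #>\<^bsub>GL n\<^esub> A"

lemma mem_pgl_iff:
  assumes "A \<in> carrier_mat n n"
  shows "B \<in> pgl n A \<longleftrightarrow> (\<exists>c. c \<noteq> 0 \<and> B = c \<cdot>\<^sub>m A)"
proof -
  have "B \<in> pgl n A \<longleftrightarrow> (\<exists>c. c \<noteq> 0 \<and> B = c \<cdot>\<^sub>m 1\<^sub>m n * A)"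
    unfolding pgl_def r_coset_def scalars_def by auto
  then show ?thesis using assms by (simp add: mult_one_smult)
qed

lemma pgl_self: "A \<in> carrier_mat n n \<Longrightarrow> A \<in> pgl n A"
  by (simp add: mem_pgl_iff) (metis one_neq_zero smult_mat_1)

lemma pgl_eq_iff:
  assumes A: "A \<in> carrier_mat n n" and B: "B \<in> carrier_mat n n"
  shows "pgl n A = pgl n B \<longleftrightarrow> (\<exists>c. c \<noteq> 0 \<and> A = c \<cdot>\<^sub>m B)"
proof
  assume "pgl n A = pgl n B"
  then show "\<exists>c. c \<noteq> 0 \<and> A = c \<cdot>\<^sub>m B" using pgl_self[OF A] mem_pgl_iff[OF B] by auto
next
  assume "\<exists>c. c \<noteq> 0 \<and> A = c \<cdot>\<^sub>m B"
  then obtain c where c: "c \<noteq> 0" "A = c \<cdot>\<^sub>m B" by blast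
  show "pgl n A = pgl n B"
  proof (rule Set.set_eqI)
    fix X
    have "(\<exists>d. d \<noteq> 0 \<and> X = d \<cdot>\<^sub>m A) \<longleftrightarrow> (\<exists>d. d \<noteq> 0 \<and> X = d \<cdot>\<^sub>m B)"
    proof
      assume "\<exists>d. d \<noteq> 0 \<and> X = d \<cdot>\<^sub>m A"
      then obtain d where "d \<noteq> 0" "X = d \<cdot>\<^sub>m A" by blast
      then show "\<exists>d. d \<noteq> 0 \<and> X = d \<cdot>\<^sub>m B"
        using c by (intro exI[of _ "d * c"]) (simp add: smult_smult)
    next
      assume "\<exists>d. d \<noteq> 0 \<and> X = d \<cdot>\<^sub>m B"
      then obtain d where "d \<noteq> 0" "X = d \<cdot>\<^sub>m B" by blast
      then show "\<exists>d. d \<noteq> 0 \<and> X = d \<cdot>\<^sub>m A"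
        using c by (intro exI[of _ "d / c"]) (simp add: smult_smult)
    qed
    then show "X \<in> pgl n A \<longleftrightarrow> X \<in> pgl n B" by (simp add: mem_pgl_iff[OF A] mem_pgl_iff[OF B])
  qed
qed

lemma pgl_smult: "A \<in> carrier_mat n n \<Longrightarrow> c \<noteq> 0 \<Longrightarrow> pgl n (c \<cdot>\<^sub>m A) = pgl n A"
  by (subst pgl_eq_iff) auto

lemma pgl_closed [simp, intro]: "A \<in> carrier (GL n) \<Longrightarrow> pgl n A \<in> carrier (PGL n)"
  unfolding PGL_def FactGroup_def pgl_def RCOSETS_def by auto

lemma pgl_cases:
  assumes "X \<in> carrier (PGL n)"
  obtains A where "A \<in> carrier (GL n)" "X = pgl n A"
  using assms unfolding PGL_def FactGroup_def pgl_def RCOSETS_def by auto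

lemma pgl_mult:
  assumes "A \<in> carrier (GL n)" "B \<in> carrier (GL n)"
  shows "pgl n A \<otimes>\<^bsub>PGL n\<^esub> pgl n B = pgl n (A * B)"
  using normal.rcos_sum[OF scalars_normal assms] unfolding PGL_def FactGroup_def pgl_def by simp

lemma group_hom_pgl: "group_hom (GL n) (PGL n) (pgl n)"
  by (intro group_hom.intro group_hom_axioms.intro group_GL group_PGL homI)
    (auto simp: pgl_mult)

lemma pgl_one: "pgl n (1\<^sub>m n) = \<one>\<^bsub>PGL n\<^esub>"
  using group_hom.hom_one[OF group_hom_pgl] by simp

lemma pgl_inv: "A \<in> carrier (GL n) \<Longrightarrow> inv\<^bsub>PGL n\<^esub> pgl n A = pgl n (inv\<^bsub>GL n\<^esub> A)"
  using group_hom.hom_inv[OF group_hom_pgl] by simp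

lemma mem_carrier_PGL:
  assumes "X \<in> carrier (PGL n)" "A \<in> X"
  shows "A \<in> carrier (GL n)" "pgl n A = X"
proof -
  obtain B where B: "B \<in> carrier (GL n)" "X = pgl n B" using assms(1) by (rule pgl_cases)
  then obtain c where c: "c \<noteq> 0" "A = c \<cdot>\<^sub>m B" using assms(2) by (auto simp: mem_pgl_iff)
  show "A \<in> carrier (GL n)" using c B GL_smult by auto
  show "pgl n A = X" using c B by (simp add: pgl_smult)
qed

section \<open>Projective representations of finite groups\<close>

locale projective_rep = group H for H :: "('h, 'm) monoid_scheme" (structure) and n :: nat and A :: "'h \<Rightarrow> complex mat" +
  assumes n_pos: "n > 0"
    and fin: "finite (carrier H)"
    and A_GL [simp, intro]: "x \<in> carrier H \<Longrightarrow> A x \<in> carrier (GL n)"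
    and A_mult: "\<lbrakk>x \<in> carrier H; y \<in> carrier H\<rbrakk> \<Longrightarrow> \<exists>c. c \<noteq> 0 \<and> A x * A y = c \<cdot>\<^sub>m A (x \<otimes> y)"
begin

abbreviation A_inv :: "'h \<Rightarrow> complex mat" where
  "A_inv x \<equiv> inv\<^bsub>GL n\<^esub> A x"

lemma A_carrier [simp, intro]:
  "x \<in> carrier H \<Longrightarrow> A x \<in> carrier_mat n n" "x \<in> carrier H \<Longrightarrow> A_inv x \<in> carrier_mat n n"
  by auto

lemma A_nonzero: "x \<in> carrier H \<Longrightarrow> A x \<noteq> 0\<^sub>m n n"
  using GL_nonzero n_pos by blast

lemma A_one: "\<exists>c. c \<noteq> 0 \<and> A \<one> = c \<cdot>\<^sub>m 1\<^sub>m n"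
proof -
  obtain c where c: "c \<noteq> 0" "A \<one> * A \<one> = c \<cdot>\<^sub>m A \<one>" using A_mult[of \<one> \<one>] by auto
  have "A \<one> = A_inv \<one> * (A \<one> * A \<one>)" using GL_inv_cancel(1)[of "A \<one>" n "A \<one>"] by simp
  also have "\<dots> = c \<cdot>\<^sub>m (A_inv \<one> * A \<one>)" unfolding c(2)
    by (rule mult_smult_distrib[of _ n n _ n]) auto
  finally show ?thesis using c(1) GL_inv_mult(1)[of "A \<one>" n] by auto
qed

lemma hom_pgl: "(\<lambda>x. pgl n (A x)) \<in> hom H (PGL n)"
proof (rule homI)
  fix x y assume xy: "x \<in> carrier H" "y \<in> carrier H"
  then obtain c where "c \<noteq> 0" "A x * A y = c \<cdot>\<^sub>m A (x \<otimes> y)" using A_mult by blast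
  then show "pgl n (A (x \<otimes> y)) = pgl n (A x) \<otimes>\<^bsub>PGL n\<^esub> pgl n (A y)"
    using xy by (simp add: pgl_mult pgl_smult)
qed auto

lemma A_pow: "x \<in> carrier H \<Longrightarrow> \<exists>c. c \<noteq> 0 \<and> A x ^\<^sub>m k = c \<cdot>\<^sub>m A (x [^] k)"
proof (induction k)
  case 0
  obtain c where "c \<noteq> 0" "A \<one> = c \<cdot>\<^sub>m 1\<^sub>m n" using A_one by blast
  then show ?case using carrier_matD(1)[OF A_carrier(1)[OF 0]]
    by (intro exI[of _ "inverse c"]) (auto simp: smult_smult)
next
  case (Suc k)
  then obtain c where c: "c \<noteq> 0" "A x ^\<^sub>m k = c \<cdot>\<^sub>m A (x [^] k)" by blast
  obtain d where d: "d \<noteq> 0" "A (x [^] k) * A x = d \<cdot>\<^sub>m A (x [^] k \<otimes> x)"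
    using A_mult[of "x [^] k" x] Suc.prems by auto
  have "A x ^\<^sub>m Suc k = c \<cdot>\<^sub>m (A (x [^] k) * A x)"
    using Suc.prems by (simp add: c mult_smult_assoc_mat[of _ n n _ n])
  then show ?case using c(1) d Suc.prems by (intro exI[of _ "c * d"]) (simp add: smult_smult)
qed

lemma A_pow_order: "x \<in> carrier H \<Longrightarrow> \<exists>c. c \<noteq> 0 \<and> A x ^\<^sub>m card (carrier H) = c \<cdot>\<^sub>m 1\<^sub>m n"
proof -
  assume x: "x \<in> carrier H"
  obtain c where c: "c \<noteq> 0" "A x ^\<^sub>m card (carrier H) = c \<cdot>\<^sub>m A \<one>"
    using A_pow[OF x, of "card (carrier H)"] pow_order_eq_1[OF x] by (auto simp: Coset.order_def)
  obtain d where d: "d \<noteq> 0" "A \<one> = d \<cdot>\<^sub>m 1\<^sub>m n" using A_one by blast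
  show ?thesis using c d by (intro exI[of _ "c * d"]) (simp add: smult_smult)
qed

lemma card_pos: "card (carrier H) > 0"
  using fin by (auto simp: card_gt_0_iff)

definition commutes :: "complex mat \<Rightarrow> bool" where
  "commutes C \<longleftrightarrow> C \<in> carrier_mat n n \<and> (\<forall>x \<in> carrier H. C * A x = A x * C)"

text \<open>The sum over the group, not divided by its order: a multiple of the projection of the space of
  matrices onto the commutant of the representation.\<close>

definition avg :: "complex mat \<Rightarrow> complex mat" where
  "avg M = mat_sum n (\<lambda>x. A x * M * A_inv x) (carrier H)"

lemma avg_carrier [simp, intro]: "avg M \<in> carrier_mat n n"
  by (simp add: avg_def)

text \<open>Conjugation by \<open>A y\<close> takes the conjugate of \<open>M\<close> by \<open>A x\<close> to its conjugate by \<open>A (y \<otimes> x)\<close>: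
  the scalar by which \<open>A\<close> fails to be multiplicative cancels. So it permutes the summands of \<open>avg M\<close>.\<close>

lemma A_conj_mult:
  assumes xy: "x \<in> carrier H" "y \<in> carrier H" and M: "M \<in> carrier_mat n n"
  shows "A y * (A x * M * A_inv x) = A (y \<otimes> x) * M * A_inv (y \<otimes> x) * A y"
proof -
  obtain c where c: "c \<noteq> 0" "A y * A x = c \<cdot>\<^sub>m A (y \<otimes> x)" using A_mult xy by blast
  have z: "y \<otimes> x \<in> carrier H" using xy by simp
  have "A_inv (y \<otimes> x) * A y = A_inv (y \<otimes> x) * (A y * A x) * A_inv x"
    using xy z GL_inv_cancel(3)[of "A x" n "A_inv (y \<otimes> x) * A y"]
    by (simp add: assoc_mult_mat[of _ n n _ n _ n])
  also have "A_inv (y \<otimes> x) * (A y * A x) = c \<cdot>\<^sub>m 1\<^sub>m n"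
    unfolding c(2) using z GL_inv_mult(1)[of "A (y \<otimes> x)" n] mult_smult_distrib[of "A_inv (y \<otimes> x)" n n "A (y \<otimes> x)" n c]
    by simp
  finally have "A_inv (y \<otimes> x) * A y = c \<cdot>\<^sub>m A_inv x" using xy by (simp add: mult_one_smult)
  then have "A (y \<otimes> x) * M * A_inv (y \<otimes> x) * A y = c \<cdot>\<^sub>m (A (y \<otimes> x) * M * A_inv x)"
    using xy z M
    by (simp add: assoc_mult_mat[of _ n n _ n _ n] mult_smult_distrib[of _ n n _ n])
  also have "\<dots> = c \<cdot>\<^sub>m A (y \<otimes> x) * (M * A_inv x)"
    using xy z M mult_smult_assoc_mat[of "A (y \<otimes> x)" n n "M * A_inv x" n c]
    by (simp add: assoc_mult_mat[of _ n n _ n _ n])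
  also have "\<dots> = A y * (A x * M * A_inv x)"
    unfolding c(2)[symmetric] using xy M by (simp add: assoc_mult_mat[of _ n n _ n _ n])
  finally show ?thesis by simp
qed

lemma commutes_avg:
  assumes M: "M \<in> carrier_mat n n"
  shows "commutes (avg M)"
  unfolding commutes_def
proof (intro conjI ballI)
  fix y assume y: "y \<in> carrier H"
  have car: "A x * M * A_inv x \<in> carrier_mat n n" if "x \<in> carrier H" for x
    using M that by auto
  have "A y * avg M = mat_sum n (\<lambda>x. A y * (A x * M * A_inv x)) (carrier H)"
    unfolding avg_def using y car by (simp add: mult_mat_sum)
  also have "\<dots> = mat_sum n (\<lambda>x. (\<lambda>z. A z * M * A_inv z * A y) (y \<otimes> x)) (carrier H)"
    using A_conj_mult y M by (intro mat_sum_cong) simp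
  also have "\<dots> = mat_sum n (\<lambda>z. A z * M * A_inv z * A y) (carrier H)"
    by (rule mat_sum_reindex, rule bij_betw_byWitness[where f' = "\<lambda>z. inv y \<otimes> z"])
      (use y in \<open>auto simp: m_assoc[symmetric]\<close>)
  also have "\<dots> = avg M * A y"
    unfolding avg_def using y car by (subst mat_sum_mult) auto
  finally show "avg M * A y = A y * avg M" by simp
qed simp

lemma commutes_mult_avg:
  assumes N: "commutes N" and M: "M \<in> carrier_mat n n"
  shows "avg (N * M) = N * avg M" "avg (M * N) = avg M * N"
proof -
  have Nc: "N \<in> carrier_mat n n" and NA: "\<And>x. x \<in> carrier H \<Longrightarrow> N * A x = A x * N"
    using N by (auto simp: commutes_def)
  have car: "A x * M * A_inv x \<in> carrier_mat n n" if "x \<in> carrier H" for x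
    using M that by auto
  have NA': "N * A_inv x = A_inv x * N" if x: "x \<in> carrier H" for x
  proof -
    have "A_inv x * N = A_inv x * (N * A x * A_inv x)"
      using Nc x GL_inv_cancel(3)[of "A x" n N] by simp
    also have "\<dots> = A_inv x * (A x * (N * A_inv x))"
      unfolding NA[OF x] using Nc x by (simp add: assoc_mult_mat[of _ n n _ n _ n])
    also have "\<dots> = N * A_inv x" using Nc x GL_inv_cancel(1)[of "A x" n "N * A_inv x"] by simp
    finally show ?thesis by simp
  qed
  have "N * avg M = mat_sum n (\<lambda>x. N * (A x * M * A_inv x)) (carrier H)"
    unfolding avg_def using Nc car by (simp add: mult_mat_sum)
  also have "\<dots> = avg (N * M)" unfolding avg_def
  proof (rule mat_sum_cong)
    fix x assume x: "x \<in> carrier H"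
    have "N * (A x * M * A_inv x) = (N * A x) * (M * A_inv x)"
      using Nc M x by (simp add: assoc_mult_mat[of _ n n _ n _ n])
    then show "N * (A x * M * A_inv x) = A x * (N * M) * A_inv x"
      unfolding NA[OF x] using Nc M x by (simp add: assoc_mult_mat[of _ n n _ n _ n])
  qed
  finally show "avg (N * M) = N * avg M" by simp
  have "avg M * N = mat_sum n (\<lambda>x. A x * M * A_inv x * N) (carrier H)"
    unfolding avg_def using Nc car by (simp add: mat_sum_mult)
  also have "\<dots> = avg (M * N)" unfolding avg_def
  proof (rule mat_sum_cong)
    fix x assume x: "x \<in> carrier H"
    have "A x * M * A_inv x * N = A x * M * (A_inv x * N)"
      using Nc M x by (simp add: assoc_mult_mat[of _ n n _ n _ n])
    then show "A x * M * A_inv x * N = A x * (M * N) * A_inv x"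
      unfolding NA'[OF x, symmetric] using Nc M x by (simp add: assoc_mult_mat[of _ n n _ n _ n])
  qed
  finally show "avg (M * N) = avg M * N" by simp
qed

lemma mat_trace_avg:
  assumes M: "M \<in> carrier_mat n n"
  shows "mat_trace (avg M) = of_nat (card (carrier H)) * mat_trace M"
proof -
  have "mat_trace (avg M) = (\<Sum>x\<in>carrier H. mat_trace (A x * M * A_inv x))"
    unfolding avg_def using M by (intro mat_trace_sum) auto
  also have "\<dots> = (\<Sum>x\<in>carrier H. mat_trace M)"
  proof (rule sum.cong[OF refl])
    fix x assume x: "x \<in> carrier H"
    have "mat_trace (A x * M * A_inv x) = mat_trace (A_inv x * (A x * M))"
      using M x by (intro mat_trace_commute) auto
    then show "mat_trace (A x * M * A_inv x) = mat_trace M"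
      using M x GL_inv_cancel(1)[of "A x" n M] by simp
  qed
  finally show ?thesis by simp
qed

lemma commutes_one: "commutes (c \<cdot>\<^sub>m 1\<^sub>m n)"
  unfolding commutes_def using mult_one_smult by auto

lemma ex_singular_shift:
  assumes C: "(C :: complex mat) \<in> carrier_mat n n"
  obtains e v where "v \<in> carrier_vec n" "v \<noteq> 0\<^sub>v n" "(C - e \<cdot>\<^sub>m 1\<^sub>m n) *\<^sub>v v = 0\<^sub>v n"
proof -
  obtain e where "eigenvalue C e" using spectrum_non_empty[OF C n_pos] by (auto simp: spectrum_def)
  then obtain v where v: "v \<in> carrier_vec n" "v \<noteq> 0\<^sub>v n" "C *\<^sub>v v = e \<cdot>\<^sub>v v"
    using C by (auto simp: eigenvalue_def eigenvector_def)
  have "(C - e \<cdot>\<^sub>m 1\<^sub>m n) *\<^sub>v v = C *\<^sub>v v - (e \<cdot>\<^sub>m 1\<^sub>m n) *\<^sub>v v"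
    using C v by (intro minus_mult_distrib_mat_vec) auto
  also have "(e \<cdot>\<^sub>m 1\<^sub>m n) *\<^sub>v v = e \<cdot>\<^sub>v v" using v by (auto intro!: eq_vecI)
  finally have "(C - e \<cdot>\<^sub>m 1\<^sub>m n) *\<^sub>v v = 0\<^sub>v n" using v by simp
  then show ?thesis using v that by blast
qed

text \<open>The commutant inherits regularity from the full matrix algebra. Subtracting an eigenvalue from \<open>C\<close>
  gives a singular \<open>N \<noteq> 0\<close> in the commutant. If \<open>N * Q * N = N\<close>, then averaging this equation over the group
  shows that \<open>Q\<close> can be replaced by the normalized average of \<open>Q\<close>, which lies in the commutant. Then
  \<open>N * Q\<close> is an idempotent of the commutant with the same image as \<open>N\<close>.\<close>

lemma ex_commuting_idempotent:
  assumes C: "commutes C" and ns: "\<nexists>c. C = c \<cdot>\<^sub>m 1\<^sub>m n"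
  obtains E where "commutes E" "E * E = E" "E \<noteq> 0\<^sub>m n n" "E \<noteq> 1\<^sub>m n"
proof -
  have Cc: "C \<in> carrier_mat n n" using C by (simp add: commutes_def)
  obtain e v where v: "v \<in> carrier_vec n" "v \<noteq> 0\<^sub>v n" "(C - e \<cdot>\<^sub>m 1\<^sub>m n) *\<^sub>v v = 0\<^sub>v n"
    using ex_singular_shift[OF Cc] by blast
  define N where "N = C - e \<cdot>\<^sub>m 1\<^sub>m n"
  have Nc: "N \<in> carrier_mat n n" using Cc unfolding N_def by (intro minus_carrier_mat) auto
  have N0: "N \<noteq> 0\<^sub>m n n"
  proof
    assume N: "N = 0\<^sub>m n n"
    have "C = e \<cdot>\<^sub>m 1\<^sub>m n"
    proof (rule eq_matI)
      fix i j assume "i < dim_row (e \<cdot>\<^sub>m 1\<^sub>m n)" "j < dim_col (e \<cdot>\<^sub>m 1\<^sub>m n)"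
      then show "C $$ (i, j) = (e \<cdot>\<^sub>m 1\<^sub>m n) $$ (i, j)"
        using arg_cong[OF N, of "\<lambda>M. M $$ (i, j)"] Cc by (simp add: N_def)
    qed (use Cc in auto)
    then show False using ns by blast
  qed
  have N: "commutes N"
    using C commutes_one[of e] A_carrier(1) Cc unfolding commutes_def N_def
    by (auto simp: minus_mult_distrib_mat[of _ n n _ _ n] mult_minus_distrib_mat[of _ n n _ n])
  obtain Q where Q: "Q \<in> carrier_mat n n" "N * Q * N = N" using von_Neumann_regular[OF Nc] .
  define q where "q = inverse (of_nat (card (carrier H)) :: complex)"
  define E where "E = q \<cdot>\<^sub>m (N * avg Q)"
  have Ec: "E \<in> carrier_mat n n" using Nc by (simp add: E_def)
  have "avg N = of_nat (card (carrier H)) \<cdot>\<^sub>m N"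
  proof -
    have "avg N = mat_sum n (\<lambda>x. N) (carrier H)" unfolding avg_def
    proof (rule mat_sum_cong)
      fix x assume x: "x \<in> carrier H"
      then have "A x * N = N * A x" using N by (simp add: commutes_def)
      then show "A x * N * A_inv x = N" using x Nc GL_inv_cancel(3)[of "A x" n N] by simp
    qed
    then show ?thesis using Nc by (auto simp: mat_sum_def intro!: eq_matI)
  qed
  moreover have "avg (N * Q * N) = N * avg Q * N"
    using commutes_mult_avg[OF N] Q(1) Nc by (simp del: assoc_mult_mat)
  ultimately have "N * avg Q * N = of_nat (card (carrier H)) \<cdot>\<^sub>m N" using Q(2) by simp
  then have EN: "E * N = N"
    using Nc card_pos by (simp add: E_def q_def mult_smult_assoc_mat[of _ n n _ n] smult_smult)
  have "E * E = q \<cdot>\<^sub>m (E * N * avg Q)"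
    using Ec Nc unfolding E_def
    by (simp add: mult_smult_distrib[of _ n n _ n] assoc_mult_mat[of _ n n _ n _ n])
  then have EE: "E * E = E" unfolding EN by (simp add: E_def)
  have "commutes E"
  proof -
    have "commutes (avg Q)" using commutes_avg Q(1) .
    have "N * avg Q * A x = A x * (N * avg Q)" if x: "x \<in> carrier H" for x
    proof -
      have "N * avg Q * A x = N * (A x * avg Q)"
        using x Nc \<open>commutes (avg Q)\<close>
        by (simp add: commutes_def assoc_mult_mat[of _ n n _ n _ n])
      also have "\<dots> = (N * A x) * avg Q" using x Nc by (simp add: assoc_mult_mat[of _ n n _ n _ n])
      also have "\<dots> = A x * (N * avg Q)" using x N Nc by (simp add: commutes_def assoc_mult_mat[of _ n n _ n _ n])
      finally show ?thesis .
    qed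
    then show ?thesis using Nc unfolding commutes_def E_def
      by (auto simp: mult_smult_distrib[of _ n n _ n] mult_smult_assoc_mat[of _ n n _ n])
  qed
  moreover have "E \<noteq> 0\<^sub>m n n" using EN N0 Nc by auto
  moreover have "E \<noteq> 1\<^sub>m n"
  proof
    assume "E = 1\<^sub>m n"
    then have "N * (q \<cdot>\<^sub>m avg Q) = 1\<^sub>m n"
      using Nc by (simp add: E_def mult_smult_distrib[of _ n n _ n])
    then have "q \<cdot>\<^sub>m avg Q * N = 1\<^sub>m n" 
      by (rule mat_mult_left_right_inverse[OF Nc smult_carrier_mat[OF avg_carrier]])
    then have "v = (q \<cdot>\<^sub>m avg Q * N) *\<^sub>v v" using v by simp
    also have "\<dots> = (q \<cdot>\<^sub>m avg Q) *\<^sub>v (N *\<^sub>v v)" using v Nc by (intro assoc_mult_mat_vec[of _ n n _ n]) auto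
    also have "\<dots> = (q \<cdot>\<^sub>m avg Q) *\<^sub>v 0\<^sub>v n" using v(3) by (simp add: N_def)
    also have "\<dots> = 0\<^sub>v n" by (rule eq_vecI) (auto simp: scalar_prod_def carrier_matD[OF avg_carrier])
    finally show False using v(2) by simp
  qed
  ultimately show ?thesis using EE that by blast
qed

end

section \<open>Heisenberg representations\<close>

text \<open>The projective representations that correspond to finite maximal diagonalizable subgroups. Since
  the commutator of \<open>A x\<close> and \<open>A y\<close> does not change when the lifts are multiplied by scalars, \<open>p\<close> is
  determined by the elements \<open>pgl n (A x)\<close>; it is a parameter so that representations with the same
  pairing can be compared.\<close>

locale heisenberg_rep = projective_rep H n A + comm_group H
  for H :: "('h, 'm) monoid_scheme" (structure) and n A +
  fixes p :: "'h \<Rightarrow> 'h \<Rightarrow> complex"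
  assumes A_commute: "\<lbrakk>x \<in> carrier H; y \<in> carrier H\<rbrakk> \<Longrightarrow> A x * A y = p x y \<cdot>\<^sub>m (A y * A x)"
    and irreducible: "commutes C \<Longrightarrow> \<exists>c. C = c \<cdot>\<^sub>m 1\<^sub>m n"
    and faithful: "\<lbrakk>x \<in> carrier H; A x = c \<cdot>\<^sub>m 1\<^sub>m n\<rbrakk> \<Longrightarrow> x = \<one>"
begin

lemma p_eqI:
  assumes "x \<in> carrier H" "y \<in> carrier H" "A x * A y = c \<cdot>\<^sub>m (A y * A x)"
  shows "p x y = c"
proof (rule smult_mat_cancel)
  show "p x y \<cdot>\<^sub>m (A y * A x) = c \<cdot>\<^sub>m (A y * A x)" using A_commute assms by metis
  show "A y * A x \<noteq> 0\<^sub>m n n" using assms n_pos by (intro GL_nonzero) auto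
qed (use assms in auto)

lemma p_nonzero:
  assumes "x \<in> carrier H" "y \<in> carrier H"
  shows "p x y \<noteq> 0"
proof
  assume "p x y = 0"
  then have "A x * A y = 0 \<cdot>\<^sub>m (A y * A x)" using A_commute assms by metis
  also have "\<dots> = 0\<^sub>m n n" using assms by (intro smult_zero_mat) auto
  finally show False using GL_nonzero[of "A x * A y" n] assms n_pos by auto
qed

lemma p_antisym:
  assumes xy: "x \<in> carrier H" "y \<in> carrier H"
  shows "p x y = inverse (p y x)"
proof (rule p_eqI[OF xy])
  have "inverse (p y x) \<cdot>\<^sub>m (A y * A x) = inverse (p y x) \<cdot>\<^sub>m (p y x \<cdot>\<^sub>m (A x * A y))"
    using A_commute[OF xy(2,1)] by simp
  then show "A x * A y = inverse (p y x) \<cdot>\<^sub>m (A y * A x)"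
    using p_nonzero[OF xy(2,1)] by (simp add: smult_smult)
qed

lemma p_mult_left:
  assumes x: "x \<in> carrier H" and y: "y \<in> carrier H" and z: "z \<in> carrier H"
  shows "p (x \<otimes> y) z = p x z * p y z"
proof (rule p_eqI)
  obtain c where c: "c \<noteq> 0" "A x * A y = c \<cdot>\<^sub>m A (x \<otimes> y)" using A_mult x y by blast
  have xy: "A (x \<otimes> y) \<in> carrier_mat n n" using x y by auto
  note sm = mult_smult_distrib[of _ n n _ n] mult_smult_assoc_mat[of _ n n _ n]
    assoc_mult_mat[of _ n n _ n _ n] smult_smult
  have "c \<cdot>\<^sub>m (A (x \<otimes> y) * A z) = A x * A y * A z" unfolding c(2) using x y z xy by (simp add: sm)
  also have "\<dots> = A x * (p y z \<cdot>\<^sub>m (A z * A y))" using x y z A_commute[OF y z] by (simp add: sm)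
  also have "\<dots> = p y z \<cdot>\<^sub>m (A x * A z * A y)" using x y z by (simp add: sm)
  also have "A x * A z * A y = p x z \<cdot>\<^sub>m (A z * (A x * A y))"
    unfolding A_commute[OF x z] using x y z by (simp add: sm)
  also have "A z * (A x * A y) = c \<cdot>\<^sub>m (A z * A (x \<otimes> y))" unfolding c(2) using x y z xy by (simp add: sm)
  finally have "inverse c \<cdot>\<^sub>m (c \<cdot>\<^sub>m (A (x \<otimes> y) * A z))
      = inverse c \<cdot>\<^sub>m (p y z \<cdot>\<^sub>m (p x z \<cdot>\<^sub>m (c \<cdot>\<^sub>m (A z * A (x \<otimes> y)))))" by simp
  moreover have "inverse c * (p y z * (p x z * c)) = p x z * p y z" using c(1) by simp
  ultimately show "A (x \<otimes> y) * A z = (p x z * p y z) \<cdot>\<^sub>m (A z * A (x \<otimes> y))"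
    using c(1) by (simp add: smult_smult)
qed (use x y z in auto)

lemma symplectic: "symplectic_abelian_group H p"
proof (intro symplectic_abelian_group.intro symplectic_abelian_group_axioms.intro)
  show "comm_group H" by (rule comm_group_axioms)
next
  fix x y z assume xyz: "x \<in> carrier H" "y \<in> carrier H" "z \<in> carrier H"
  have "p x (y \<otimes> z) = inverse (p y x * p z x)"
    using xyz p_antisym[of x "y \<otimes> z"] p_mult_left[of y z x] by simp
  also have "\<dots> = p x y * p x z"
    using xyz p_antisym[of x y] p_antisym[of x z] by simp
  finally show "p x (y \<otimes> z) = p x y * p x z" .
next
  fix x assume x: "x \<in> carrier H"
  show "p x x = 1" by (rule p_eqI[OF x x]) simp
qed (use p_nonzero p_mult_left p_antisym in \<open>blast+\<close>)

text \<open>A matrix \<open>A x\<close> with \<open>x\<close> in the radical lies in the commutant, so it is scalar.\<close>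

lemma nonsingular: "nonsingular_pairing H p"
  unfolding nonsingular_pairing_def
proof (intro ballI impI)
  fix x assume x: "x \<in> carrier H" and 1: "\<forall>y \<in> carrier H. p x y = 1"
  have "commutes (A x)" unfolding commutes_def using x 1 A_commute[OF x] by auto
  then show "x = \<one>" using irreducible faithful x by blast
qed

lemma A_inv_commute:
  assumes x: "x \<in> carrier H" and y: "y \<in> carrier H"
  shows "A y * A_inv x = p x y \<cdot>\<^sub>m (A_inv x * A y)"
proof -
  note sm = mult_smult_distrib[of _ n n _ n] mult_smult_assoc_mat[of _ n n _ n]
    assoc_mult_mat[of _ n n _ n _ n] smult_smult
  have "A y * A_inv x = A_inv x * (A x * A y) * A_inv x"
    using x y GL_inv_cancel(1)[of "A x" n "A y"] by simp
  also have "\<dots> = p x y \<cdot>\<^sub>m (A_inv x * (A y * (A x * A_inv x)))"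
    unfolding A_commute[OF x y] using x y by (simp add: sm)
  also have "A x * A_inv x = 1\<^sub>m n" using x by (simp add: GL_inv_mult)
  also have "A y * 1\<^sub>m n = A y" using y by (intro right_mult_one_mat) auto
  finally show ?thesis .
qed

text \<open>Conjugation by \<open>A y\<close> preserves the trace and multiplies \<open>X\<close> by a scalar other than \<open>1\<close>.\<close>

lemma trace_zero:
  assumes X: "X \<in> carrier_mat n n" and y: "y \<in> carrier H"
    and XA: "X * A y = c \<cdot>\<^sub>m (A y * X)" and c: "c \<noteq> 1"
  shows "mat_trace X = 0"
proof -
  have "mat_trace X = mat_trace (X * A y * A_inv y)" using X y GL_inv_cancel(3)[of "A y" n X] by simp
  also have "\<dots> = mat_trace (A_inv y * (X * A y))" using X y by (intro mat_trace_commute) auto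
  also have "A_inv y * (X * A y) = c \<cdot>\<^sub>m X" unfolding XA
    using X y GL_inv_cancel(1)[of "A y" n X] by (simp add: mult_smult_distrib[of _ n n _ n])
  finally have "mat_trace X = c * mat_trace X" using mat_trace_smult[OF X] by simp
  then show ?thesis using c by simp
qed

lemma trace_A_zero:
  assumes x: "x \<in> carrier H" "x \<noteq> \<one>"
  shows "mat_trace (A x) = 0"
proof -
  obtain y where y: "y \<in> carrier H" "p x y \<noteq> 1"
    using nonsingular x unfolding nonsingular_pairing_def by blast
  show ?thesis by (rule trace_zero[OF A_carrier(1)[OF x(1)] y(1) A_commute[OF x(1) y(1)] y(2)])
qed

lemma avg_scalar:
  assumes M: "M \<in> carrier_mat n n"
  shows "avg M = (of_nat (card (carrier H)) * mat_trace M / of_nat n) \<cdot>\<^sub>m 1\<^sub>m n"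
proof -
  obtain c where c: "avg M = c \<cdot>\<^sub>m 1\<^sub>m n" using irreducible commutes_avg M by blast
  then have "c * of_nat n = of_nat (card (carrier H)) * mat_trace M"
    using mat_trace_avg[OF M] mat_trace_smult[of "1\<^sub>m n" n c] by simp
  then have "c = of_nat (card (carrier H)) * mat_trace M / of_nat n"
    using n_pos by (simp add: field_simps)
  then show ?thesis using c by simp
qed

text \<open>Schur orthogonality: this is an entry of the average of a matrix unit, which is a scalar matrix
  with known trace.\<close>

lemma orthogonality:
  assumes "i < n" "j < n" "k < n" "l < n"
  shows "(\<Sum>x\<in>carrier H. A x $$ (k, i) * A_inv x $$ (j, l))
    = (if i = j \<and> k = l then of_nat (card (carrier H)) / of_nat n else 0)"
proof -
  let ?E = "mat n n (\<lambda>(a, b). if a = i \<and> b = j then 1 else 0) :: complex mat"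
  have E: "?E \<in> carrier_mat n n" by simp
  have "mat_trace ?E = (\<Sum>a<n. if a = i then (if i = j then 1 else 0) else 0)"
    unfolding mat_trace_def by (auto intro!: sum.cong)
  then have tr: "mat_trace ?E = (if i = j then 1 else 0)" using assms by simp
  have "(A x * ?E * A_inv x) $$ (k, l) = A x $$ (k, i) * A_inv x $$ (j, l)" if x: "x \<in> carrier H" for x
  proof -
    have c: "A x \<in> carrier_mat n n" "A_inv x \<in> carrier_mat n n" using x by auto
    have AE: "(A x * ?E) $$ (k, b) = (if b = j then A x $$ (k, i) else 0)" if b: "b < n" for b
    proof -
      have "(A x * ?E) $$ (k, b) = (\<Sum>a<n. A x $$ (k, a) * ?E $$ (a, b))"
        using assms b c by (auto simp: scalar_prod_def atLeast0LessThan intro!: sum.cong)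
      also have "\<dots> = (\<Sum>a<n. if a = i then (if b = j then A x $$ (k, i) else 0) else 0)"
        using b by (intro sum.cong) auto
      finally show ?thesis using assms by simp
    qed
    have "(A x * ?E * A_inv x) $$ (k, l) = row (A x * ?E) k \<bullet> col (A_inv x) l"
      using assms c by (intro index_mult_mat(1)) auto
    also have "\<dots> = (\<Sum>b<n. (A x * ?E) $$ (k, b) * A_inv x $$ (b, l))"
      unfolding scalar_prod_def using assms c carrier_matD[OF c(1)] carrier_matD[OF c(2)]
      by (intro sum.cong) (auto simp: atLeast0LessThan)
    also have "\<dots> = (\<Sum>b<n. if b = j then A x $$ (k, i) * A_inv x $$ (j, l) else 0)"
      by (intro sum.cong) (auto simp: AE simp del: index_mult_mat(1))
    finally show ?thesis using assms by simp
  qed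
  then have "(\<Sum>x\<in>carrier H. A x $$ (k, i) * A_inv x $$ (j, l)) = avg ?E $$ (k, l)"
    unfolding avg_def using assms by (simp add: mat_sum_index cong: sum.cong)
  also have "\<dots> = (if i = j \<and> k = l then of_nat (card (carrier H)) / of_nat n else 0)"
    unfolding avg_scalar[OF E] tr using assms by simp
  finally show ?thesis .
qed

text \<open>Sum the orthogonality relations over \<open>k = i\<close> and \<open>l = j\<close>. One side becomes the order of \<open>H\<close>;
  on the other side, a sum of products of traces, only the identity contributes.\<close>

theorem card_eq: "card (carrier H) = n\<^sup>2"
proof -
  have "(\<Sum>x\<in>carrier H. mat_trace (A x) * mat_trace (A_inv x))
    = (\<Sum>x\<in>carrier H. \<Sum>k<n. \<Sum>j<n. A x $$ (k, k) * A_inv x $$ (j, j))"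
  proof (rule sum.cong[OF refl])
    fix x assume x: "x \<in> carrier H"
    show "mat_trace (A x) * mat_trace (A_inv x) = (\<Sum>k<n. \<Sum>j<n. A x $$ (k, k) * A_inv x $$ (j, j))"
      using carrier_matD(1)[OF A_carrier(1)[OF x]] carrier_matD(1)[OF A_carrier(2)[OF x]]
      by (simp add: mat_trace_def sum_product)
  qed
  also have "\<dots> = (\<Sum>k<n. \<Sum>x\<in>carrier H. \<Sum>j<n. A x $$ (k, k) * A_inv x $$ (j, j))"
    by (rule sum.swap)
  also have "\<dots> = (\<Sum>k<n. \<Sum>j<n. \<Sum>x\<in>carrier H. A x $$ (k, k) * A_inv x $$ (j, j))"
    by (intro sum.cong refl sum.swap)
  also have "\<dots> = (\<Sum>k<n. \<Sum>j<n. if k = j then of_nat (card (carrier H)) / of_nat n else 0)"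
    by (intro sum.cong refl) (simp add: orthogonality)
  also have "\<dots> = of_nat (card (carrier H))" using n_pos by simp
  finally have 1: "(\<Sum>x\<in>carrier H. mat_trace (A x) * mat_trace (A_inv x)) = of_nat (card (carrier H))" .
  have "(\<Sum>x\<in>carrier H. mat_trace (A x) * mat_trace (A_inv x))
    = (\<Sum>x\<in>{\<one>}. mat_trace (A x) * mat_trace (A_inv x))"
    using fin by (intro sum.mono_neutral_right) (auto simp: trace_A_zero)
  also have "\<dots> = mat_trace (A \<one>) * mat_trace (A_inv \<one>)" by simp
  also have "\<dots> = of_nat n * of_nat n"
  proof -
    obtain c where c: "c \<noteq> 0" "A \<one> = c \<cdot>\<^sub>m 1\<^sub>m n" using A_one by blast
    have "1\<^sub>m n = c \<cdot>\<^sub>m A_inv \<one>"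
      using GL_inv_mult(1)[OF A_GL[OF one_closed]] mult_one_smult(2)[OF A_carrier(2)[OF one_closed], of c]
      unfolding c(2) by metis
    then have "of_nat n = c * mat_trace (A_inv \<one>)"
      using mat_trace_smult[of "A_inv \<one>" n c] mat_trace_one[of n] by (metis A_carrier(2) one_closed)
    then show ?thesis using c mat_trace_smult[of "1\<^sub>m n" n c] by simp
  qed
  finally have "(of_nat (card (carrier H)) :: complex) = of_nat (n\<^sup>2)"
    unfolding 1 by (simp add: power2_eq_square)
  then show ?thesis by (simp only: of_nat_eq_iff)
qed

text \<open>By orthogonality, \<open>X\<close> is a nonzero multiple of the sum of the \<open>mat_trace (X * A_inv x) \<cdot>\<^sub>m A x\<close>.\<close>

lemma ex_trace_nonzero:
  assumes X: "X \<in> carrier_mat n n" "X \<noteq> 0\<^sub>m n n"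
  obtains x where "x \<in> carrier H" "mat_trace (X * A_inv x) \<noteq> 0"
proof -
  have "\<exists>x \<in> carrier H. mat_trace (X * A_inv x) \<noteq> 0"
  proof (rule ccontr)
    assume "\<not> ?thesis"
    then have 0: "(\<Sum>l<n. \<Sum>j<n. X $$ (l, j) * A_inv x $$ (j, l)) = 0" if "x \<in> carrier H" for x
      using that mat_trace_mult[OF X(1) A_carrier(2)] by auto
    have "X $$ (k, i) = 0" if ki: "k < n" "i < n" for k i
    proof -
      have "0 = (\<Sum>x\<in>carrier H. A x $$ (k, i) * (\<Sum>l<n. \<Sum>j<n. X $$ (l, j) * A_inv x $$ (j, l)))"
        by (simp add: 0)
      also have "\<dots> = (\<Sum>x\<in>carrier H. \<Sum>l<n. \<Sum>j<n. X $$ (l, j) * (A x $$ (k, i) * A_inv x $$ (j, l)))"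
        by (simp add: sum_distrib_left mult_ac)
      also have "\<dots> = (\<Sum>l<n. \<Sum>j<n. \<Sum>x\<in>carrier H. X $$ (l, j) * (A x $$ (k, i) * A_inv x $$ (j, l)))"
        by (subst sum.swap) (intro sum.cong refl sum.swap)
      also have "\<dots> = (\<Sum>l<n. \<Sum>j<n. if i = j then
          (if k = l then X $$ (k, i) * (of_nat (card (carrier H)) / of_nat n) else 0) else 0)"
        using ki by (intro sum.cong refl) (auto simp: orthogonality sum_distrib_left[symmetric])
      also have "\<dots> = X $$ (k, i) * (of_nat (card (carrier H)) / of_nat n)" using ki by simp
      finally show ?thesis using n_pos card_pos fin by auto
    qed
    then have "X = 0\<^sub>m n n" using X by (intro eq_matI) auto
    then show False using X by simp
  qed
  then show ?thesis using that by blast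
qed

text \<open>The image of \<open>H\<close> in \<open>PGL\<close> is its own centralizer. Some \<open>X * A_inv x\<close> has nonzero trace. It still
  commutes with each \<open>A y\<close> up to a scalar, and by \<open>trace_zero\<close> this scalar is \<open>1\<close>. By
  irreducibility \<open>X * A_inv x\<close> is then a scalar matrix.\<close>

lemma self_centralizing:
  assumes X: "X \<in> carrier (GL n)"
    and XA: "\<And>y. y \<in> carrier H \<Longrightarrow> \<exists>c. X * A y = c \<cdot>\<^sub>m (A y * X)"
  obtains x where "x \<in> carrier H" "pgl n X = pgl n (A x)"
proof -
  have Xc: "X \<in> carrier_mat n n" using X by auto
  obtain x where x: "x \<in> carrier H" and tr: "mat_trace (X * A_inv x) \<noteq> 0"
    using ex_trace_nonzero[OF Xc GL_nonzero[OF X n_pos]] by blast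
  note sm = mult_smult_distrib[of _ n n _ n] mult_smult_assoc_mat[of _ n n _ n]
    assoc_mult_mat[of _ n n _ n _ n] smult_smult
  define Y where "Y = X * A_inv x"
  have Y: "Y \<in> carrier_mat n n" using Xc x by (auto simp: Y_def)
  have "commutes Y" unfolding commutes_def
  proof (intro conjI ballI Y)
    fix y assume y: "y \<in> carrier H"
    obtain c where c: "X * A y = c \<cdot>\<^sub>m (A y * X)" using XA y by blast
    have "A_inv x * A y = inverse (p x y) \<cdot>\<^sub>m (A y * A_inv x)"
      unfolding A_inv_commute[OF x y] using p_nonzero[OF x y] by (simp add: smult_smult)
    then have "Y * A y = inverse (p x y) \<cdot>\<^sub>m (X * A y * A_inv x)"
      unfolding Y_def using Xc x y by (simp add: sm)
    also have "\<dots> = (inverse (p x y) * c) \<cdot>\<^sub>m (A y * Y)"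
      unfolding c Y_def using Xc x y by (simp add: sm)
    finally have YA: "Y * A y = (inverse (p x y) * c) \<cdot>\<^sub>m (A y * Y)" .
    then have "inverse (p x y) * c = 1" using trace_zero[OF Y y YA] tr by (auto simp: Y_def)
    then show "Y * A y = A y * Y" using YA by simp
  qed
  then obtain d where d: "Y = d \<cdot>\<^sub>m 1\<^sub>m n" using irreducible by blast
  have "X = Y * A x" using Xc x GL_inv_cancel(4)[of "A x" n X] by (simp add: Y_def)
  then have XdA: "X = d \<cdot>\<^sub>m A x" using d x by (simp add: mult_one_smult)
  moreover have "d \<noteq> 0"
  proof
    assume "d = 0"
    then have "X = 0\<^sub>m n n" using XdA smult_zero_mat[OF A_carrier(1)[OF x]] by simp
    then show False using GL_nonzero[OF X n_pos] by simp
  qed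
  ultimately show ?thesis using x that by (simp add: pgl_smult)
qed

definition image_PGL :: "complex mat set set" where
  "image_PGL = (\<lambda>x. pgl n (A x)) ` carrier H"

lemma inj_pgl: "inj_on (\<lambda>x. pgl n (A x)) (carrier H)"
proof -
  interpret gh: group_hom H "PGL n" "\<lambda>x. pgl n (A x)"
    by (intro group_hom.intro group_hom_axioms.intro group_PGL hom_pgl) unfold_locales
  have "x = \<one>" if x: "x \<in> carrier H" "pgl n (A x) = \<one>\<^bsub>PGL n\<^esub>" for x
  proof -
    obtain c where "A x = c \<cdot>\<^sub>m 1\<^sub>m n"
      using x pgl_eq_iff[OF A_carrier(1)[OF x(1)] one_carrier_mat] by (auto simp: pgl_one)
    then show ?thesis using faithful x by blast
  qed
  then show ?thesis by (intro gh.inj_on_one_iff[THEN iffD2] ballI impI) auto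
qed

text \<open>Every abelian subgroup that contains the image centralizes it, and so is contained in it by
  \<open>self_centralizing\<close>.\<close>

theorem image_maximal: "image_PGL \<in> finite_maximal_diagonalizable_subgroups n"
proof -
  interpret gh: group_hom H "PGL n" "\<lambda>x. pgl n (A x)"
    by (intro group_hom.intro group_hom_axioms.intro group_PGL hom_pgl) unfold_locales
  have "semisimple_PGL n (pgl n (A x))" if x: "x \<in> carrier H" for x
  proof -
    obtain c where "c \<noteq> 0" "A x ^\<^sub>m card (carrier H) = c \<cdot>\<^sub>m 1\<^sub>m n" using A_pow_order[OF x] by blast
    then have "semisimple_mat (A x)" using semisimple_if_power_scalar[OF A_carrier(1)[OF x]] card_pos by blast
    then show ?thesis unfolding semisimple_PGL_def using x pgl_self[of "A x" n] by auto
  qed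
  moreover have "pgl n (A x) \<otimes>\<^bsub>PGL n\<^esub> pgl n (A y) = pgl n (A y) \<otimes>\<^bsub>PGL n\<^esub> pgl n (A x)"
    if "x \<in> carrier H" "y \<in> carrier H" for x y
    using that gh.hom_mult[of x y] gh.hom_mult[of y x] m_comm[of x y] by simp
  ultimately have diag: "diagonalizable_subgroup n image_PGL"
    unfolding diagonalizable_subgroup_def image_PGL_def using gh.img_is_subgroup by auto
  have "F = image_PGL" if F: "diagonalizable_subgroup n F" "image_PGL \<subseteq> F" for F
  proof (rule ccontr)
    assume "F \<noteq> image_PGL"
    then obtain Z where Z: "Z \<in> F" "Z \<notin> image_PGL" using F(2) by blast
    have "F \<subseteq> carrier (PGL n)" using F(1) subgroup.subset unfolding diagonalizable_subgroup_def by blast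
    then obtain X where X: "X \<in> carrier (GL n)" "Z = pgl n X" using Z(1) by (auto elim: pgl_cases)
    have "\<exists>c. X * A y = c \<cdot>\<^sub>m (A y * X)" if y: "y \<in> carrier H" for y
    proof -
      have "pgl n (A y) \<in> F" using F(2) y by (auto simp: image_PGL_def)
      then have "pgl n X \<otimes>\<^bsub>PGL n\<^esub> pgl n (A y) = pgl n (A y) \<otimes>\<^bsub>PGL n\<^esub> pgl n X"
        using F(1) Z(1) X(2) unfolding diagonalizable_subgroup_def by blast
      then have "pgl n (X * A y) = pgl n (A y * X)" using X(1) y by (simp add: pgl_mult)
      then show ?thesis using X(1) y pgl_eq_iff[of "X * A y" n "A y * X"] by auto
    qed
    then obtain x where "x \<in> carrier H" "pgl n X = pgl n (A x)"
      using self_centralizing[OF X(1)] by blast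
    then show False using Z(2) X(2) by (auto simp: image_PGL_def)
  qed
  then show ?thesis
    unfolding finite_maximal_diagonalizable_subgroups_def maximal_diagonalizable_subgroup_def
    using diag fin by (auto simp: image_PGL_def)
qed

end

section \<open>Finite maximal diagonalizable subgroups come from Heisenberg representations\<close>

lemma pow_mat_mult_family:
  assumes A: "A \<in> carrier_mat n n" and Z: "\<And>t::complex. Z t \<in> carrier_mat n n"
    and AZ: "\<And>t. A * Z t = Z t * A" and ZZ: "\<And>s t. Z s * Z t = Z (s * t)" and Z1: "Z 1 = 1\<^sub>m n"
  shows "(A * Z t) ^\<^sub>m k = A ^\<^sub>m k * Z (t ^ k)"
proof (induction k)
  case 0
  then show ?case using A Z1 by simp
next
  case (Suc k)
  have Ak: "A ^\<^sub>m k \<in> carrier_mat n n" using A by simp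
  have "(A * Z t) ^\<^sub>m Suc k = A ^\<^sub>m k * (Z (t ^ k) * A) * Z t"
    using A Ak Z[of "t ^ k"] Z[of t] by (simp add: Suc assoc_mult_mat[of _ n n _ n _ n])
  also have "\<dots> = A ^\<^sub>m k * A * (Z (t ^ k) * Z t)"
    unfolding AZ[symmetric] using A Ak Z[of "t ^ k"] Z[of t] by (simp add: assoc_mult_mat[of _ n n _ n _ n])
  finally show ?case by (simp add: ZZ mult.commute)
qed

text \<open>With \<open>D = 1 - E\<close>, the matrices \<open>E + t * D\<close> form a one-parameter group: \<open>E\<close> and \<open>D\<close> are complementary
  orthogonal idempotents. Different parameters stay different modulo scalars because neither idempotent
  vanishes.\<close>

lemma idempotent_torus:
  fixes E :: "complex mat"
  assumes E: "E \<in> carrier_mat n n" "E * E = E" "E \<noteq> 0\<^sub>m n n" "E \<noteq> 1\<^sub>m n"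
  defines "Z \<equiv> \<lambda>t. E + t \<cdot>\<^sub>m (1\<^sub>m n - E)"
  shows "Z t \<in> carrier_mat n n" "Z s * Z t = Z (s * t)" "Z 1 = 1\<^sub>m n"
    "Z s = c \<cdot>\<^sub>m Z t \<Longrightarrow> s = t"
proof -
  define D where "D = 1\<^sub>m n - E"
  have D: "D \<in> carrier_mat n n" using E by (simp add: D_def minus_carrier_mat)
  have ED: "E * D = 0\<^sub>m n n" "D * E = 0\<^sub>m n n" "D * D = D"
  proof -
    have EE0: "E - E = 0\<^sub>m n n" using E by auto
    show "E * D = 0\<^sub>m n n" "D * E = 0\<^sub>m n n"
      using E EE0 unfolding D_def
      by (simp_all add: mult_minus_distrib_mat[of _ n n _ n] minus_mult_distrib_mat[of _ n n _ _ n])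
    then show "D * D = D" unfolding D_def using E(1) D
      by (subst minus_mult_distrib_mat[of _ n n _ _ n]) (auto simp: D_def[symmetric])
  qed
  have D0: "D \<noteq> 0\<^sub>m n n"
  proof
    assume 0: "D = 0\<^sub>m n n"
    have "E $$ (i, j) = 1\<^sub>m n $$ (i, j)" if "i < n" "j < n" for i j
      using arg_cong[OF 0, of "\<lambda>M. M $$ (i, j)"] that E(1) by (simp add: D_def)
    then have "E = 1\<^sub>m n" using E(1) by (intro eq_matI) auto
    then show False using E(4) by simp
  qed
  note [simp] = mult_smult_distrib[of _ n n _ n] mult_smult_assoc_mat[of _ n n _ n] smult_smult
    add_mult_distrib_mat[of _ n n _ _ n] mult_add_distrib_mat[of _ n n _ n]
  show "Z t \<in> carrier_mat n n" for t using E D by (simp add: Z_def D_def[symmetric])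
  show "Z s * Z t = Z (s * t)" for s t
    unfolding Z_def D_def[symmetric] using E(1,2) D ED by (auto simp: mult.commute intro!: eq_matI)
  show "Z 1 = 1\<^sub>m n" unfolding Z_def using E(1) by (auto intro!: eq_matI)
  assume eq: "Z s = c \<cdot>\<^sub>m Z t"
  have ZE: "Z s * E = E" "Z s * D = s \<cdot>\<^sub>m D" for s
    unfolding Z_def D_def[symmetric] using E(1,2) D ED by (auto intro!: eq_matI)
  have "1 \<cdot>\<^sub>m E = c \<cdot>\<^sub>m E"
    using ZE(1)[of s] ZE(1)[of t] E(1) \<open>\<And>t. Z t \<in> carrier_mat n n\<close> unfolding eq by simp
  then have c: "c = 1" using smult_mat_cancel[of 1 E c] E by simp
  have "s \<cdot>\<^sub>m D = t \<cdot>\<^sub>m D" using ZE(2)[of s] ZE(2)[of t] eq c by simp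
  then show "s = t" using smult_mat_cancel D D0 by blast
qed

text \<open>A nonscalar matrix in the commutant yields an idempotent \<open>E\<close> in it, and thus a torus of matrices
  \<open>Z t = E + t * (1 - E)\<close> that commute with all \<open>A x\<close>. The products \<open>A x * Z t\<close>, with \<open>t\<close> a root of unity
  of fixed order, have finite order modulo scalars, so they are semisimple. They form a diagonalizable
  subgroup that is too large if that order exceeds the order of the given maximal subgroup.\<close>

lemma (in projective_rep) scalar_commutant_if_maximal:
  assumes comm: "\<And>x y. x \<in> carrier H \<Longrightarrow> y \<in> carrier H \<Longrightarrow> x \<otimes> y = y \<otimes> x"
    and max: "maximal_diagonalizable_subgroup n ((\<lambda>x. pgl n (A x)) ` carrier H)"
    and C: "commutes C"
  shows "\<exists>c. C = c \<cdot>\<^sub>m 1\<^sub>m n"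
proof (rule ccontr)
  assume "\<nexists>c. C = c \<cdot>\<^sub>m 1\<^sub>m n"
  then obtain E where E: "commutes E" "E * E = E" "E \<noteq> 0\<^sub>m n n" "E \<noteq> 1\<^sub>m n"
    using ex_commuting_idempotent[OF C] by blast
  then have Ec: "E \<in> carrier_mat n n" by (simp add: commutes_def)
  define Z where "Z t = E + t \<cdot>\<^sub>m (1\<^sub>m n - E)" for t
  note Z = idempotent_torus[OF Ec E(2-4), folded Z_def]
  let ?F = "(\<lambda>x. pgl n (A x)) ` carrier H"
  \<comment> \<open>The group of roots of unity of this order has more elements than \<open>?F\<close>.\<close>
  define m where "m = Suc (card ?F)"
  define U where "U = {t::complex. t ^ m = 1}"
  have m: "m > 0" by (simp add: m_def)
  have U1: "1 \<in> U" by (simp add: U_def)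
  have Umult: "s * t \<in> U" if "s \<in> U" "t \<in> U" for s t using that by (simp add: U_def power_mult_distrib)
  have Uinv: "inverse t \<in> U" if "t \<in> U" for t using that by (simp add: U_def power_inverse)
  have U0: "t \<noteq> 0" if "t \<in> U" for t using that m by (auto simp: U_def power_0_left)
  have ZGL: "Z t \<in> carrier (GL n)" if "t \<in> U" for t
    using Z(1)[of t] Z(1)[of "inverse t"] Z(2)[of "inverse t" t] Z(3) U0[OF that] by (intro GL_I) auto
  have AZ: "A x * Z t = Z t * A x" if x: "x \<in> carrier H" for x t
  proof -
    have AE: "E * A x = A x * E" using E(1) x by (simp add: commutes_def)
    have D: "1\<^sub>m n - E \<in> carrier_mat n n" using Ec by (simp add: minus_carrier_mat)
    have "A x * (1\<^sub>m n - E) = (1\<^sub>m n - E) * A x"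
      using x Ec AE A_carrier(1)[OF x]
      by (simp add: mult_minus_distrib_mat[of _ n n _ n] minus_mult_distrib_mat[of _ n n _ _ n]
          right_mult_one_mat[of _ n n] left_mult_one_mat[of _ n n])
    then show ?thesis unfolding Z_def using x Ec AE D
      by (simp add: mult_smult_distrib[of _ n n _ n] mult_smult_assoc_mat[of _ n n _ n]
          add_mult_distrib_mat[of _ n n _ _ n] mult_add_distrib_mat[of _ n n _ n])
  qed
  have mult: "pgl n (A x * Z s) \<otimes>\<^bsub>PGL n\<^esub> pgl n (A y * Z t) = pgl n (A (x \<otimes> y) * Z (s * t))"
    if xy: "x \<in> carrier H" "y \<in> carrier H" and st: "s \<in> U" "t \<in> U" for x y s t
  proof -
    obtain c where c: "c \<noteq> 0" "A x * A y = c \<cdot>\<^sub>m A (x \<otimes> y)" using A_mult xy by blast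
    have "A x * Z s * (A y * Z t) = A x * (Z s * A y) * Z t"
      using xy Z(1)[of s] Z(1)[of t] by (simp add: assoc_mult_mat[of _ n n _ n _ n])
    also have "\<dots> = A x * A y * (Z s * Z t)"
      unfolding AZ[OF xy(2), symmetric] using xy Z(1)[of s] Z(1)[of t]
      by (simp add: assoc_mult_mat[of _ n n _ n _ n])
    also have "\<dots> = c \<cdot>\<^sub>m (A (x \<otimes> y) * Z (s * t))"
      unfolding c(2) Z(2) using xy Z(1)[of "s * t"] by (simp add: mult_smult_assoc_mat[of _ n n _ n])
    finally have "A x * Z s * (A y * Z t) = c \<cdot>\<^sub>m (A (x \<otimes> y) * Z (s * t))" .
    then have "pgl n (A x * Z s * (A y * Z t)) = pgl n (A (x \<otimes> y) * Z (s * t))"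
      using c(1) xy Z(1)[of "s * t"] by (simp add: pgl_smult)
    moreover have "A x * Z s \<in> carrier (GL n)" "A y * Z t \<in> carrier (GL n)"
      using xy st ZGL by auto
    ultimately show ?thesis by (simp add: pgl_mult)
  qed
  define F' where "F' = (\<lambda>(x, t). pgl n (A x * Z t)) ` (carrier H \<times> U)"
  interpret PGL: group "PGL n" by (rule group_PGL)
  have one: "pgl n (A \<one> * Z 1) = \<one>\<^bsub>PGL n\<^esub>"
  proof -
    obtain c where c: "c \<noteq> 0" "A \<one> = c \<cdot>\<^sub>m 1\<^sub>m n" using A_one by blast
    then show ?thesis by (simp add: Z(3) pgl_smult pgl_one)
  qed
  have closed: "pgl n (A x * Z t) \<in> carrier (PGL n)" if "x \<in> carrier H" "t \<in> U" for x t
    using that ZGL by (intro pgl_closed GL_mult) auto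
  have "subgroup F' (PGL n)"
  proof (rule PGL.subgroupI)
    show "F' \<subseteq> carrier (PGL n)" using closed by (auto simp: F'_def)
    show "F' \<noteq> {}" using U1 one_closed unfolding F'_def by blast
  next
    fix X assume "X \<in> F'"
    then obtain x t where x: "x \<in> carrier H" "t \<in> U" and X: "X = pgl n (A x * Z t)"
      by (auto simp: F'_def)
    have "pgl n (A (inv x) * Z (inverse t)) \<otimes>\<^bsub>PGL n\<^esub> X = \<one>\<^bsub>PGL n\<^esub>"
      unfolding X using mult[OF inv_closed[OF x(1)] x(1) Uinv[OF x(2)] x(2)] x(1) U0[OF x(2)] one by simp
    then have "inv\<^bsub>PGL n\<^esub> X = pgl n (A (inv x) * Z (inverse t))"
      using closed x Uinv X by (intro PGL.inv_equality) auto
    then show "inv\<^bsub>PGL n\<^esub> X \<in> F'" using x Uinv unfolding F'_def by blast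
  next
    fix X Y assume "X \<in> F'" "Y \<in> F'"
    then obtain x s y t where xy: "x \<in> carrier H" "y \<in> carrier H" "s \<in> U" "t \<in> U"
      and XY: "X = pgl n (A x * Z s)" "Y = pgl n (A y * Z t)"
      by (auto simp: F'_def)
    show "X \<otimes>\<^bsub>PGL n\<^esub> Y \<in> F'"
      unfolding XY mult[OF xy] F'_def using xy Umult by (intro image_eqI[of _ _ "(x \<otimes> y, s * t)"]) auto
  qed
  moreover have "X \<otimes>\<^bsub>PGL n\<^esub> Y = Y \<otimes>\<^bsub>PGL n\<^esub> X" if "X \<in> F'" "Y \<in> F'" for X Y
    using that by (auto simp: F'_def mult comm mult.commute)
  moreover have "semisimple_PGL n X" if XF: "X \<in> F'" for X
  proof -
    obtain x t where x: "x \<in> carrier H" "t \<in> U" and X: "X = pgl n (A x * Z t)"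
      using XF by (auto simp: F'_def)
    let ?k = "card (carrier H)"
    obtain c where c: "c \<noteq> 0" "A x ^\<^sub>m (?k * m) = c \<cdot>\<^sub>m A (x [^] (?k * m))" using A_pow[OF x(1)] by blast
    have "x [^] (?k * m) = \<one>"
      using pow_order_eq_1[OF x(1)] x(1) by (simp add: Coset.order_def nat_pow_pow[symmetric])
    moreover obtain d where d: "d \<noteq> 0" "A \<one> = d \<cdot>\<^sub>m 1\<^sub>m n" using A_one by blast
    ultimately have Apow: "A x ^\<^sub>m (?k * m) = (c * d) \<cdot>\<^sub>m 1\<^sub>m n" using c(2) by (simp add: smult_smult)
    have "(A x * Z t) ^\<^sub>m (?k * m) = A x ^\<^sub>m (?k * m) * Z (t ^ (?k * m))"
      by (rule pow_mat_mult_family) (use x AZ Z in auto)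
    also have "t ^ (?k * m) = 1" using x(2) by (simp add: U_def mult.commute[of ?k] power_mult)
    finally have "(A x * Z t) ^\<^sub>m (?k * m) = (c * d) \<cdot>\<^sub>m 1\<^sub>m n" by (simp add: Apow Z(3))
    then have "semisimple_mat (A x * Z t)"
      using semisimple_if_power_scalar[of "A x * Z t" n "?k * m" "c * d"] x(1) Z(1)[of t] c(1) d(1) card_pos m by auto
    then show ?thesis unfolding semisimple_PGL_def X
      using closed[OF x] pgl_self[of "A x * Z t" n] x(1) Z(1)[of t] by auto
  qed
  ultimately have "diagonalizable_subgroup n F'" unfolding diagonalizable_subgroup_def by blast
  moreover have "?F \<subseteq> F'"
  proof safe
    fix x assume x: "x \<in> carrier H"
    have "A x = A x * Z 1" using right_mult_one_mat[OF A_carrier(1)[OF x]] by (simp add: Z(3))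
    then show "pgl n (A x) \<in> F'" using x U1 unfolding F'_def by (intro image_eqI[of _ _ "(x, 1)"]) auto
  qed
  ultimately have F': "F' = ?F" using max unfolding maximal_diagonalizable_subgroup_def by blast
  have "pgl n (A \<one> * Z t) = pgl n (Z t)" for t
    using A_one Z(1)[of t] by (auto simp: mult_one_smult pgl_smult)
  then have "(\<lambda>t. pgl n (Z t)) ` U \<subseteq> F'" using one_closed unfolding F'_def by force
  moreover have "inj_on (\<lambda>t. pgl n (Z t)) U"
    by (rule inj_onI) (use Z(1,4) in \<open>auto simp: pgl_eq_iff\<close>)
  ultimately have "card U \<le> card ?F" unfolding F' using fin by (intro card_inj_on_le) auto
  then show False using card_roots_unity_eq[OF m] by (simp add: U_def m_def)
qed

text \<open>Arbitrary lifts of the elements of \<open>F\<close> to \<open>GL\<close> form a projective representation of \<open>F\<close>.\<close>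

lemma heisenberg_rep_if_maximal:
  assumes n: "n > 0" and F: "F \<in> finite_maximal_diagonalizable_subgroups n"
  obtains A p where "heisenberg_rep ((PGL n)\<lparr>carrier := F\<rparr>) n A p"
    "(\<lambda>X. pgl n (A X)) ` F = F"
proof -
  let ?H = "(PGL n)\<lparr>carrier := F\<rparr>"
  have fin: "finite F" and max: "maximal_diagonalizable_subgroup n F"
    using F by (auto simp: finite_maximal_diagonalizable_subgroups_def)
  have sub: "subgroup F (PGL n)"
    and comm: "\<And>X Y. X \<in> F \<Longrightarrow> Y \<in> F \<Longrightarrow> X \<otimes>\<^bsub>PGL n\<^esub> Y = Y \<otimes>\<^bsub>PGL n\<^esub> X"
    using max by (auto simp: maximal_diagonalizable_subgroup_def diagonalizable_subgroup_def)
  have FPGL: "F \<subseteq> carrier (PGL n)" using subgroup.subset[OF sub] .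
  have grp: "group ?H" using subgroup.subgroup_is_group[OF sub group_PGL] .
  define A where "A X = (SOME A. A \<in> X)" for X :: "complex mat set"
  have A: "A X \<in> carrier (GL n)" "pgl n (A X) = X" if X: "X \<in> F" for X
  proof -
    obtain B where "B \<in> carrier (GL n)" "X = pgl n B" using X FPGL by (auto elim: pgl_cases)
    then have "B \<in> X" using pgl_self by auto
    then have "A X \<in> X" unfolding A_def by (rule someI)
    then show "A X \<in> carrier (GL n)" "pgl n (A X) = X" using mem_carrier_PGL X FPGL by blast+
  qed
  have mult: "pgl n (A X * A Y) = X \<otimes>\<^bsub>PGL n\<^esub> Y" if "X \<in> F" "Y \<in> F" for X Y
    using that A pgl_mult[of "A X" n "A Y"] by simp
  have closed: "X \<otimes>\<^bsub>PGL n\<^esub> Y \<in> F" if "X \<in> F" "Y \<in> F" for X Y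
    using that subgroup.m_closed[OF sub] by blast
  have rep: "projective_rep ?H n A"
  proof (intro projective_rep.intro grp projective_rep_axioms.intro)
    fix X Y assume XY: "X \<in> carrier ?H" "Y \<in> carrier ?H"
    then have "pgl n (A X * A Y) = pgl n (A (X \<otimes>\<^bsub>PGL n\<^esub> Y))" using mult closed A(2) by simp
    then show "\<exists>c. c \<noteq> 0 \<and> A X * A Y = c \<cdot>\<^sub>m A (X \<otimes>\<^bsub>?H\<^esub> Y)"
      using XY A(1) closed pgl_eq_iff[of "A X * A Y" n "A (X \<otimes>\<^bsub>PGL n\<^esub> Y)"] by auto
  qed (use n fin A in auto)
  interpret projective_rep ?H n A by (rule rep)
  have "\<exists>c. A X * A Y = c \<cdot>\<^sub>m (A Y * A X)" if "X \<in> F" "Y \<in> F" for X Y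
    using that mult comm A(1) pgl_eq_iff[of "A X * A Y" n "A Y * A X"] by auto
  then obtain p where p: "A X * A Y = p X Y \<cdot>\<^sub>m (A Y * A X)" if "X \<in> F" "Y \<in> F" for X Y by metis
  have im: "(\<lambda>X. pgl n (A X)) ` F = F" using A(2) by simp
  have "heisenberg_rep ?H n A p"
  proof (intro heisenberg_rep.intro rep heisenberg_rep_axioms.intro)
    show "comm_group ?H" using comm by (intro group.group_comm_groupI[OF grp]) auto
    show "\<exists>c. C = c \<cdot>\<^sub>m 1\<^sub>m n" if "commutes C" for C
      using scalar_commutant_if_maximal[of C] that comm max im by auto
    show "X = \<one>\<^bsub>?H\<^esub>" if X: "X \<in> carrier ?H" "A X = c \<cdot>\<^sub>m 1\<^sub>m n" for X c
    proof -
      have "c \<noteq> 0"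
      proof
        assume "c = 0"
        then have "A X = 0\<^sub>m n n" using X(2) by (simp add: smult_zero_mat)
        then show False using A_nonzero X(1) by blast
      qed
      then have "X = pgl n (1\<^sub>m n)" using X A(2) by (metis partial_object.select_convs(1) partial_object.surjective partial_object.update_convs(1) pgl_smult one_carrier_mat)
      then show ?thesis by (simp add: pgl_one)
    qed
  qed (rule p; simp)
  then show ?thesis using im that by blast
qed

section \<open>Uniqueness\<close>

text \<open>The operators \<open>M \<mapsto> B x * M * inv (A x)\<close> do not depend on the choice of lifts up to scalars, and
  they commute with each other, since the commutators of the \<open>B x\<close> and those of the \<open>A x\<close> cancel. Each
  has a power that is a nonzero scalar, so there is a common eigenvector. In this way no cocycles
  of \<open>A\<close> and \<open>B\<close> have to be compared.\<close>

lemma proportional_intertwiner: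
  assumes A: "heisenberg_rep H n A p" and B: "heisenberg_rep H n B p"
  obtains M where "M \<in> carrier_mat n n" "M \<noteq> 0\<^sub>m n n"
    "\<And>x. x \<in> carrier H \<Longrightarrow> \<exists>c. B x * M * inv\<^bsub>GL n\<^esub> A x = c \<cdot>\<^sub>m M"
proof -
  interpret A: heisenberg_rep H n A p by (rule A)
  interpret B: heisenberg_rep H n B p by (rule B)
  define T where "T x N = B x * N * A.A_inv x" for x N
  have T: "T x N \<in> carrier_mat n n" if "x \<in> carrier H" "N \<in> carrier_mat n n" for x N
    using that by (auto simp: T_def)
  note sm = mult_smult_distrib[of _ n n _ n] mult_smult_assoc_mat[of _ n n _ n]
    assoc_mult_mat[of _ n n _ n _ n] smult_smult
  have T_smult: "T x (c \<cdot>\<^sub>m N) = c \<cdot>\<^sub>m T x N" if "x \<in> carrier H" "N \<in> carrier_mat n n" for x c N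
    using that by (simp add: T_def sm)
  \<comment> \<open>The two commutator factors cancel: \<open>A\<close> and \<open>B\<close> have the same pairing.\<close>
  have T_commute: "T x (T y N) = T y (T x N)"
    if xy: "x \<in> carrier H" "y \<in> carrier H" and N: "N \<in> carrier_mat n n" for x y N
  proof -
    have inv: "A.A_inv x * A.A_inv y = p x y \<cdot>\<^sub>m (A.A_inv y * A.A_inv x)"
    proof -
      have "A.A_inv y * (A y * A.A_inv x) * A.A_inv y = p x y \<cdot>\<^sub>m (A.A_inv y * (A.A_inv x * (A y * A.A_inv y)))"
        unfolding A.A_inv_commute[OF xy] using xy by (simp add: sm)
      then show ?thesis using xy GL_inv_cancel(1)[of "A y" n "A.A_inv x"]
        by (simp add: GL_inv_mult right_mult_one_mat[of _ n n])
    qed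
    have "T x (T y N) = B x * B y * (N * (A.A_inv y * A.A_inv x))"
      using xy N by (simp add: T_def sm)
    also have "\<dots> = B y * B x * (N * (p x y \<cdot>\<^sub>m (A.A_inv y * A.A_inv x)))"
      unfolding B.A_commute[OF xy] using xy N by (simp add: sm)
    also have "\<dots> = T y (T x N)" unfolding inv[symmetric] using xy N by (simp add: T_def sm)
    finally show ?thesis .
  qed
  have T_power: "(T x ^^ k) N * A x ^\<^sub>m k = B x ^\<^sub>m k * N \<and> (T x ^^ k) N \<in> carrier_mat n n"
    if x: "x \<in> carrier H" and N: "N \<in> carrier_mat n n" for x k N
    using N
  proof (induction k arbitrary: N)
    case 0
    then show ?case using carrier_matD[OF A.A_carrier(1)[OF x]] carrier_matD[OF B.A_carrier(1)[OF x]]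
      by (simp add: right_mult_one_mat[of _ n n] left_mult_one_mat[of _ n n])
  next
    case (Suc k)
    note IH = Suc.IH[OF T[OF x Suc.prems]]
    have c: "A x ^\<^sub>m k \<in> carrier_mat n n" "B x ^\<^sub>m k \<in> carrier_mat n n"
      using x by (auto intro: pow_carrier_mat)
    have "(T x ^^ k) (T x N) * A x ^\<^sub>m Suc k = (T x ^^ k) (T x N) * A x ^\<^sub>m k * A x"
      using conjunct2[OF IH] c x by (simp add: assoc_mult_mat[of _ n n _ n _ n])
    also have "\<dots> = B x ^\<^sub>m k * T x N * A x" by (simp only: conjunct1[OF IH])
    also have "\<dots> = B x ^\<^sub>m k * (T x N * A x)"
      using c x T[OF x Suc.prems] by (simp add: assoc_mult_mat[of _ n n _ n _ n])
    also have "T x N * A x = B x * N"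
      unfolding T_def using x Suc.prems GL_inv_cancel(4)[of "A x" n "B x * N"] by simp
    also have "B x ^\<^sub>m k * (B x * N) = B x ^\<^sub>m Suc k * N"
      using x c Suc.prems by (simp add: assoc_mult_mat[of _ n n _ n _ n])
    finally show ?case using IH unfolding funpow_Suc_right comp_apply by blast
  qed
  have T_order: "\<exists>c. c \<noteq> 0 \<and> (T x ^^ card (carrier H)) N = c \<cdot>\<^sub>m N"
    if x: "x \<in> carrier H" and N: "N \<in> carrier_mat n n" for x N
  proof -
    let ?k = "card (carrier H)"
    obtain a where a: "a \<noteq> 0" "A x ^\<^sub>m ?k = a \<cdot>\<^sub>m 1\<^sub>m n" using A.A_pow_order[OF x] by blast
    obtain b where b: "b \<noteq> 0" "B x ^\<^sub>m ?k = b \<cdot>\<^sub>m 1\<^sub>m n" using B.A_pow_order[OF x] by blast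
    have "a \<cdot>\<^sub>m (T x ^^ ?k) N = b \<cdot>\<^sub>m N"
      using T_power[OF x N, of ?k] mult_one_smult(1)[OF N, of b] mult_one_smult(2)[of "(T x ^^ ?k) N" n a]
      by (simp add: a(2) b(2))
    then have "inverse a \<cdot>\<^sub>m (a \<cdot>\<^sub>m (T x ^^ ?k) N) = inverse a \<cdot>\<^sub>m (b \<cdot>\<^sub>m N)" by (rule arg_cong)
    then have "(T x ^^ ?k) N = (inverse a * b) \<cdot>\<^sub>m N" using a(1) by (simp add: smult_smult)
    then show ?thesis using a(1) b(1) by (intro exI[of _ "inverse a * b"]) simp
  qed
  have "\<exists>M \<in> carrier_mat n n. M \<noteq> 0\<^sub>m n n \<and> (\<forall>x \<in> S. \<exists>c. T x M = c \<cdot>\<^sub>m M)"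
    if "finite S" "S \<subseteq> carrier H" for S
    using that
  proof (induction S)
    case empty
    have "1\<^sub>m n \<in> carrier (GL n)" by (rule GL_I[of _ _ "1\<^sub>m n"]) simp_all
    then have "(1\<^sub>m n :: complex mat) \<noteq> 0\<^sub>m n n" using GL_nonzero A.n_pos by blast
    then show ?case by (intro bexI[of _ "1\<^sub>m n"]) auto
  next
    case (insert x S)
    then obtain M where M: "M \<in> carrier_mat n n" "M \<noteq> 0\<^sub>m n n" "\<forall>y \<in> S. \<exists>c. T y M = c \<cdot>\<^sub>m M"
      by auto
    have x: "x \<in> carrier H" using insert.prems by simp
    obtain c where c: "c \<noteq> 0" "(T x ^^ card (carrier H)) M = c \<cdot>\<^sub>m M" using T_order[OF x M(1)] by blast
    have Tx: "T x = (\<lambda>N. B x * N * A.A_inv x)" by (rule ext) (simp add: T_def)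
    obtain a \<mu> where
      nz: "mat_sum n (\<lambda>i. a i \<cdot>\<^sub>m (T x ^^ i) M) {..<card (carrier H)} \<noteq> 0\<^sub>m n n" and
      ev: "B x * mat_sum n (\<lambda>i. a i \<cdot>\<^sub>m (T x ^^ i) M) {..<card (carrier H)} * A.A_inv x
          = \<mu> \<cdot>\<^sub>m mat_sum n (\<lambda>i. a i \<cdot>\<^sub>m (T x ^^ i) M) {..<card (carrier H)}"
      using conjugation_eigenmatrix[OF B.A_carrier(1)[OF x] A.A_carrier(2)[OF x] M(1,2) A.card_pos c(1)
          c(2)[unfolded Tx]] unfolding Tx by blast
    let ?M = "mat_sum n (\<lambda>i. a i \<cdot>\<^sub>m (T x ^^ i) M) {..<card (carrier H)}"
    have car: "(T x ^^ i) M \<in> carrier_mat n n" for i using T_power[OF x M(1)] by blast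
    have "\<exists>c. T y ?M = c \<cdot>\<^sub>m ?M" if y: "y \<in> S" for y
    proof -
      have yH: "y \<in> carrier H" using y insert.prems by auto
      obtain d where d: "T y M = d \<cdot>\<^sub>m M" using M(3) y by blast
      have Ty: "T y ((T x ^^ i) M) = d \<cdot>\<^sub>m (T x ^^ i) M" for i
        by (induction i) (simp_all add: d T_commute[OF yH x car] T_smult[OF x car])
      have "T y ?M = mat_sum n (\<lambda>i. T y (a i \<cdot>\<^sub>m (T x ^^ i) M)) {..<card (carrier H)}"
        unfolding T_def[of y] using yH car by (simp add: mult_mat_sum mat_sum_mult)
      also have "\<dots> = mat_sum n (\<lambda>i. d \<cdot>\<^sub>m (a i \<cdot>\<^sub>m (T x ^^ i) M)) {..<card (carrier H)}"
        by (intro mat_sum_cong) (simp add: T_smult[OF yH car] Ty smult_smult mult.commute)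
      also have "\<dots> = d \<cdot>\<^sub>m ?M" using car by (subst smult_mat_sum) auto
      finally show ?thesis by blast
    qed
    moreover have "T x ?M = \<mu> \<cdot>\<^sub>m ?M" using ev by (simp add: T_def[of x ?M])
    ultimately have "\<forall>y \<in> insert x S. \<exists>c. T y ?M = c \<cdot>\<^sub>m ?M" by blast
    then show ?case using nz by (intro bexI[of _ ?M]) auto
  qed
  then obtain M where "M \<in> carrier_mat n n" "M \<noteq> 0\<^sub>m n n" "\<forall>x \<in> carrier H. \<exists>c. T x M = c \<cdot>\<^sub>m M"
    using A.fin by blast
  then show ?thesis using that unfolding T_def by blast
qed

text \<open>A Stone-von Neumann theorem. By \<open>proportional_intertwiner\<close> there is \<open>M \<noteq> 0\<close> with \<open>B x * M\<close>
  proportional to \<open>M * A x\<close>. As in the proof of Schur's lemma, \<open>M\<close> is invertible: an average gives an \<open>L\<close>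
  for which \<open>L * M\<close> lies in the commutant of \<open>A\<close> and has nonzero trace, so it is a nonzero scalar.\<close>

theorem heisenberg_rep_unique:
  assumes A: "heisenberg_rep H n A p" and B: "heisenberg_rep H n B p"
  obtains M where "M \<in> carrier (GL n)"
    "\<And>x. x \<in> carrier H \<Longrightarrow> pgl n (B x) = pgl n (M * A x * inv\<^bsub>GL n\<^esub> M)"
proof -
  interpret A: heisenberg_rep H n A p by (rule A)
  interpret B: heisenberg_rep H n B p by (rule B)
  obtain M where M: "M \<in> carrier_mat n n" "M \<noteq> 0\<^sub>m n n"
    and ev: "\<And>x. x \<in> carrier H \<Longrightarrow> \<exists>c. B x * M * A.A_inv x = c \<cdot>\<^sub>m M"
    using proportional_intertwiner[OF A B] by blast
  note sm = mult_smult_distrib[of _ n n _ n] mult_smult_assoc_mat[of _ n n _ n]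
    assoc_mult_mat[of _ n n _ n _ n] smult_smult
  have BM: "\<exists>c. c \<noteq> 0 \<and> B x * M = c \<cdot>\<^sub>m (M * A x)" if x: "x \<in> carrier H" for x
  proof -
    obtain c where c: "B x * M * A.A_inv x = c \<cdot>\<^sub>m M" using ev x by blast
    have "B x * M = B x * M * A.A_inv x * A x"
      using x M GL_inv_cancel(4)[of "A x" n "B x * M"] by simp
    then have eq: "B x * M = c \<cdot>\<^sub>m (M * A x)" unfolding c using x M by (simp add: sm)
    have "c \<noteq> 0"
    proof
      assume "c = 0"
      then have "B x * M = 0\<^sub>m n n" using eq M x by (simp add: smult_zero_mat)
      then have "B.A_inv x * (B x * M) = 0\<^sub>m n n" using x by (simp add: right_mult_zero_mat[of _ n n])
      then show False using x M GL_inv_cancel(1)[of "B x" n M] by simp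
    qed
    then show ?thesis using eq by blast
  qed
  obtain K where K: "K \<in> carrier_mat n n" "mat_trace (K * M) \<noteq> 0"
    using mat_trace_nondegenerate[OF M] by blast
  have "\<exists>R. R \<in> carrier_mat n n \<and> R * M = M * A.A_inv x" if x: "x \<in> carrier H" for x
  proof -
    obtain c where c: "c \<noteq> 0" "B x * M = c \<cdot>\<^sub>m (M * A x)" using BM x by blast
    have "c \<cdot>\<^sub>m B.A_inv x * M = B.A_inv x * (c \<cdot>\<^sub>m (M * A x)) * A.A_inv x"
      using x M GL_inv_mult(2)[of "A x" n] by (simp add: sm right_mult_one_mat[of _ n n])
    also have "\<dots> = M * A.A_inv x"
      unfolding c(2)[symmetric] using x M GL_inv_cancel(1)[of "B x" n M] by simp
    finally show ?thesis using x by (intro exI[of _ "c \<cdot>\<^sub>m B.A_inv x"]) auto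
  qed
  then obtain R where R: "R x \<in> carrier_mat n n" "R x * M = M * A.A_inv x" if "x \<in> carrier H" for x
    by metis
  \<comment> \<open>As \<open>R x\<close> can be moved past \<open>M\<close>, the product of this sum with \<open>M\<close> is the average of
    \<open>K * M\<close>, a scalar of nonzero trace.\<close>
  define L where "L = mat_sum n (\<lambda>x. A x * K * R x) (carrier H)"
  have L: "L \<in> carrier_mat n n" by (simp add: L_def)
  have "L * M = A.avg (K * M)"
  proof -
    have "L * M = mat_sum n (\<lambda>x. A x * K * R x * M) (carrier H)"
      unfolding L_def using R K M by (intro mat_sum_mult) auto
    also have "\<dots> = A.avg (K * M)" unfolding A.avg_def
    proof (rule mat_sum_cong)
      fix x assume x: "x \<in> carrier H"
      have "A x * K * R x * M = A x * K * (R x * M)" using R(1)[OF x] x K M by (simp add: sm)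
      also have "\<dots> = A x * (K * M) * A.A_inv x" unfolding R(2)[OF x] using x K M by (simp add: sm)
      finally show "A x * K * R x * M = A x * (K * M) * A.A_inv x" .
    qed
    finally show ?thesis .
  qed
  then have "L * M = (of_nat (card (carrier H)) * mat_trace (K * M) / of_nat n) \<cdot>\<^sub>m 1\<^sub>m n"
    using A.avg_scalar[of "K * M"] K M by simp
  moreover have "of_nat (card (carrier H)) * mat_trace (K * M) / of_nat n \<noteq> 0"
    using K A.n_pos A.card_pos by simp
  ultimately obtain d where d: "L * M = d \<cdot>\<^sub>m 1\<^sub>m n" "d \<noteq> 0" by blast
  have "inverse d \<cdot>\<^sub>m L * M = 1\<^sub>m n" using L M d by (simp add: sm)
  then have MGL: "M \<in> carrier (GL n)" using L M by (intro GL_I[of M n "inverse d \<cdot>\<^sub>m L"]) auto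
  have "pgl n (B x) = pgl n (M * A x * inv\<^bsub>GL n\<^esub> M)" if x: "x \<in> carrier H" for x
  proof -
    obtain c where c: "c \<noteq> 0" "B x * M = c \<cdot>\<^sub>m (M * A x)" using BM x by blast
    have "B x = B x * M * inv\<^bsub>GL n\<^esub> M" using x MGL GL_inv_cancel(3)[of M n "B x"] by simp
    also have "\<dots> = c \<cdot>\<^sub>m (M * A x * inv\<^bsub>GL n\<^esub> M)"
      unfolding c(2) using x M MGL GL_carrier_mat[OF GL_inv[OF MGL]] by (simp add: sm)
    finally have "pgl n (B x) = pgl n (c \<cdot>\<^sub>m (M * A x * inv\<^bsub>GL n\<^esub> M))" by (rule arg_cong)
    also have "\<dots> = pgl n (M * A x * inv\<^bsub>GL n\<^esub> M)"
      using x M MGL c(1) by (intro pgl_smult) auto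
    finally show ?thesis .
  qed
  then show ?thesis using MGL that by blast
qed

section \<open>Polarizations of symplectic abelian groups\<close>

text \<open>By Lagrange's theorem, proved by multiplying all elements of \<open>G\<close>, the elements of \<open>G\<close> are roots of
  unity of order \<open>card G\<close>, and there are only \<open>card G\<close> of these.\<close>

lemma finite_multiplicative_subgroup_eq_roots:
  fixes G :: "complex set"
  assumes fin: "finite G" and 0: "0 \<notin> G" and 1: "1 \<in> G" and mult: "\<And>x y. x \<in> G \<Longrightarrow> y \<in> G \<Longrightarrow> x * y \<in> G"
  shows "G = {z. z ^ card G = 1}"
proof (rule card_subset_eq)
  have pos: "card G > 0" using fin 1 card_gt_0_iff by blast
  show "finite {z::complex. z ^ card G = 1}" using pos by (intro finite_nth_roots)
  show "card G = card {z::complex. z ^ card G = 1}" using card_roots_unity_eq[OF pos] by simp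
  show "G \<subseteq> {z. z ^ card G = 1}"
  proof
    fix z assume z: "z \<in> G"
    then have z0: "z \<noteq> 0" using 0 by auto
    have inj: "inj_on ((*) z) G" using z0 by (auto intro: inj_onI)
    have "bij_betw ((*) z) G G"
      using endo_inj_surj[OF fin _ inj] mult[OF z] inj by (auto simp: bij_betw_def)
    then have "(\<Prod>g\<in>G. z * g) = \<Prod>G" using prod.reindex_bij_betw[of "(*) z" G G "\<lambda>g. g"] by simp
    then have "z ^ card G * \<Prod>G = \<Prod>G" by (simp add: prod.distrib)
    moreover have "\<Prod>G \<noteq> 0" using 0 fin by auto
    ultimately show "z \<in> {z. z ^ card G = 1}" by simp
  qed
qed

context symplectic_abelian_group
begin

lemma pairing_one [simp]:
  assumes "x \<in> carrier H"
  shows "pairing x \<one> = 1" "pairing \<one> x = 1"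
  using pairing_mult_right[OF assms one_closed one_closed] pairing_nonzero[OF assms one_closed]
    pairing_mult_left[OF one_closed one_closed assms] pairing_nonzero[OF one_closed assms] by simp_all

lemma pairing_inv:
  assumes "x \<in> carrier H" "y \<in> carrier H"
  shows "pairing x (inv y) = inverse (pairing x y)" "pairing (inv x) y = inverse (pairing x y)"
proof -
  have "pairing x (inv y) * pairing x y = 1" "pairing (inv x) y * pairing x y = 1"
    using pairing_mult_right[of x "inv y" y] pairing_mult_left[of "inv x" x y] assms by simp_all
  then show "pairing x (inv y) = inverse (pairing x y)" "pairing (inv x) y = inverse (pairing x y)"
    by (metis inverse_unique mult.commute)+
qed

lemma subgroup_nat_pow_closed: "subgroup K H \<Longrightarrow> x \<in> K \<Longrightarrow> x [^] (k::nat) \<in> K"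
  by (induction k) (auto intro: subgroup.one_closed subgroup.m_closed)

lemma pairing_pow:
  fixes k :: nat
  assumes "x \<in> carrier H" "y \<in> carrier H"
  shows "pairing x (y [^] k) = pairing x y ^ k" "pairing (x [^] k) y = pairing x y ^ k"
  using assms by (induction k) (simp_all add: pairing_mult_left pairing_mult_right)

lemma pairing_generate:
  assumes S: "S \<subseteq> carrier H" and 1: "\<And>x y. x \<in> S \<Longrightarrow> y \<in> S \<Longrightarrow> pairing x y = 1"
    and xy: "x \<in> generate H S" "y \<in> generate H S"
  shows "pairing x y = 1"
proof -
  have car: "z \<in> carrier H" if "z \<in> generate H S" for z using that S generate_incl by blast
  have *: "pairing x y = 1" if x: "x \<in> S" and y: "y \<in> generate H S" for x y
    using y by induction (use x S 1 car in \<open>auto simp: pairing_inv pairing_mult_right subset_iff\<close>)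
  show ?thesis using xy(1)
    by induction (use xy(2) S * car in \<open>auto simp: pairing_inv pairing_mult_left subset_iff\<close>)
qed

text \<open>Choose \<open>a\<close> such that its group of pairing values has maximal order \<open>m\<close>, and \<open>b\<close> such that
  \<open>pairing a b\<close> is a primitive root of unity of order \<open>m\<close>. The group of pairing values of \<open>b\<close> contains
  all roots of unity of order \<open>m\<close>, so by maximality it consists of these. Hence all values at \<open>a\<close> and at \<open>b\<close>
  are powers of \<open>pairing a b\<close>.\<close>

lemma hyperbolic_pair:
  assumes K: "subgroup K H" "finite K" "K \<noteq> {\<one>}"
    and ns: "\<And>x. x \<in> K \<Longrightarrow> (\<And>y. y \<in> K \<Longrightarrow> pairing x y = 1) \<Longrightarrow> x = \<one>"
  obtains a b where "a \<in> K" "b \<in> K" "pairing a b \<noteq> 1"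
    "\<And>h. h \<in> K \<Longrightarrow> \<exists>i j. pairing a h = pairing a b ^ i \<and> pairing h b = pairing a b ^ j"
proof -
  interpret K: subgroup K H by (rule K)
  have Kc [simp]: "x \<in> carrier H" if "x \<in> K" for x using that K.subset by blast
  have roots: "pairing x ` K = {z. z ^ card (pairing x ` K) = 1}" if x: "x \<in> K" for x
  proof (rule finite_multiplicative_subgroup_eq_roots)
    show "0 \<notin> pairing x ` K" using x pairing_nonzero by fastforce
    show "1 \<in> pairing x ` K" using x K.one_closed by (intro image_eqI[of _ _ \<one>]) simp_all
    fix u v assume "u \<in> pairing x ` K" "v \<in> pairing x ` K"
    then obtain y z where "y \<in> K" "z \<in> K" "u = pairing x y" "v = pairing x z" by blast
    then show "u * v \<in> pairing x ` K" using x by (intro image_eqI[of _ _ "y \<otimes> z"]) (auto simp: pairing_mult_right)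
  qed (use K in auto)
  define m where "m = Max ((\<lambda>x. card (pairing x ` K)) ` K)"
  have "m \<in> (\<lambda>x. card (pairing x ` K)) ` K" unfolding m_def using K(2) K.one_closed by (intro Max_in) blast+
  then obtain a where a: "a \<in> K" "m = card (pairing a ` K)" by blast
  have max: "card (pairing x ` K) \<le> m" if "x \<in> K" for x unfolding m_def using K that by (intro Max_ge) auto
  have m: "m > 1"
  proof -
    obtain x where x: "x \<in> K" "x \<noteq> \<one>" using K(3) K.one_closed by blast
    then obtain y where y: "y \<in> K" "pairing x y \<noteq> 1" using ns by blast
    have "1 \<in> pairing x ` K" using x K.one_closed by (intro image_eqI[of _ _ \<one>]) simp_all
    then have "{1, pairing x y} \<subseteq> pairing x ` K" using y by blast
    then have "card {1, pairing x y} \<le> card (pairing x ` K)" using K by (intro card_mono) auto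
    then show ?thesis using max[OF x(1)] y by auto
  qed
  define \<zeta> where "\<zeta> = cis (2 * pi / real m)"
  have pow: "\<exists>k::nat. z = \<zeta> ^ k" if "z ^ m = 1" for z
  proof -
    have "z \<in> (\<lambda>k. cis (2 * pi * real k / real m)) ` {..<m}"
      using bij_betw_roots_unity[of m] m that by (auto simp: bij_betw_def)
    then obtain k where "z = cis (2 * pi * real k / real m)" by blast
    then have "z = \<zeta> ^ k" by (simp add: \<zeta>_def DeMoivre mult_ac)
    then show ?thesis by blast
  qed
  have "\<zeta> ^ m = 1" using m by (simp add: \<zeta>_def DeMoivre)
  then have "\<zeta> \<in> pairing a ` K" using roots[OF a(1)] unfolding a(2) by blast
  then obtain b where b: "b \<in> K" "pairing a b = \<zeta>" by blast
  have ba: "pairing b a = inverse \<zeta>" using pairing_antisym[of b a] a b by simp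
  have "{z. z ^ m = 1} \<subseteq> pairing b ` K"
  proof
    fix z :: complex assume "z \<in> {z. z ^ m = 1}"
    then have "(inverse z) ^ m = 1" by (simp add: power_inverse)
    then obtain k :: nat where "inverse z = \<zeta> ^ k" using pow by blast
    then have "z = inverse \<zeta> ^ k" by (metis inverse_inverse_eq power_inverse)
    also have "\<dots> = pairing b (a [^] k)" using a b ba by (simp add: pairing_pow)
    finally show "z \<in> pairing b ` K" using subgroup_nat_pow_closed[OF K(1) a(1)] by blast
  qed
  moreover have "card (pairing b ` K) \<le> card {z::complex. z ^ m = 1}"
    using max[OF b(1)] m card_roots_unity_eq[of m] by simp
  ultimately have Kb: "pairing b ` K = {z. z ^ m = 1}" using K(2) card_seteq[of "pairing b ` K"] by blast
  have "\<exists>i j. pairing a h = \<zeta> ^ i \<and> pairing h b = \<zeta> ^ j" if h: "h \<in> K" for h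
  proof -
    have "pairing a h ^ m = 1" using roots[OF a(1)] a(2) h by blast
    moreover have "pairing b h ^ m = 1" using Kb h by blast
    then have "pairing h b ^ m = 1" using pairing_antisym[of h b] h b by (simp add: power_inverse)
    ultimately show ?thesis using pow by blast
  qed
  moreover have "\<zeta> \<noteq> 1"
  proof
    assume "\<zeta> = 1"
    then have "{z::complex. z ^ m = 1} \<subseteq> {1}" using pow by auto
    then show False using card_roots_unity_eq[of m] m card_mono[of "{1::complex}" "{z. z ^ m = 1}"] by simp
  qed
  ultimately show ?thesis using that a(1) b by blast
qed

text \<open>Let \<open>a\<close> and \<open>b\<close> be as in \<open>hyperbolic_pair\<close>, and let \<open>K'\<close> be their orthogonal complement. Every
  element of \<open>K\<close> becomes orthogonal to \<open>a\<close> and \<open>b\<close> when it is divided by suitable powers of \<open>a\<close> and \<open>b\<close>,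
  so \<open>K\<close> is generated by \<open>a\<close>, \<open>b\<close> and \<open>K'\<close>. Apply induction to \<open>K'\<close>, and adjoin \<open>a\<close> to one of its isotropic
  subgroups and \<open>b\<close> to the other one. The statement is about subgroups of a fixed group in order to make
  this induction possible.\<close>

theorem ex_polarization:
  assumes K: "subgroup K H" "finite K"
    and ns: "\<And>x. x \<in> K \<Longrightarrow> (\<And>y. y \<in> K \<Longrightarrow> pairing x y = 1) \<Longrightarrow> x = \<one>"
  shows "\<exists>L M. subgroup L H \<and> subgroup M H \<and> L \<subseteq> K \<and> M \<subseteq> K \<and>
    (\<forall>x \<in> L. \<forall>y \<in> L. pairing x y = 1) \<and> (\<forall>x \<in> M. \<forall>y \<in> M. pairing x y = 1) \<and>
    (\<forall>x \<in> K. \<exists>l \<in> L. \<exists>m \<in> M. x = l \<otimes> m)"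
  using assms
proof (induction "card K" arbitrary: K rule: less_induct)
  case less
  interpret K: subgroup K H by (rule less.prems)
  have Kc [simp]: "x \<in> carrier H" if "x \<in> K" for x using that K.subset by blast
  show ?case
  proof (cases "K = {\<one>}")
    case True
    then show ?thesis using less.prems(1) by (intro exI[of _ K]) auto
  next
    case False
    obtain a b where a: "a \<in> K" and b: "b \<in> K" and ab: "pairing a b \<noteq> 1"
      and pow: "\<And>h. h \<in> K \<Longrightarrow> \<exists>i j. pairing a h = pairing a b ^ i \<and> pairing h b = pairing a b ^ j"
      using hyperbolic_pair[OF less.prems(1,2) False less.prems(3)] by metis
    have a_pow: "a [^] j \<in> K" "b [^] j \<in> K" for j :: nat
      using a b subgroup_nat_pow_closed[OF less.prems(1)] by blast+
    define K' where "K' = {h \<in> K. pairing a h = 1 \<and> pairing h b = 1}"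
    have K'K: "K' \<subseteq> K" by (auto simp: K'_def)
    have "\<one> \<in> K'" using a b K.one_closed by (simp add: K'_def)
    then have "K' \<noteq> {}" by blast
    then have "subgroup K' H"
      using a b by (intro subgroupI)
        (simp_all add: K'_def pairing_inv pairing_mult_left pairing_mult_right subset_iff)
    have decomp: "\<exists>(j::nat) (i::nat). \<exists>k \<in> K'. h = a [^] j \<otimes> b [^] i \<otimes> k" if h: "h \<in> K" for h
    proof -
      obtain i j :: nat where ij: "pairing a h = pairing a b ^ i" "pairing h b = pairing a b ^ j"
        using pow[OF h] by blast
      define k where "k = inv (a [^] j \<otimes> b [^] i) \<otimes> h"
      have c: "a [^] j \<otimes> b [^] i \<in> K" using a_pow by simp
      have k: "k \<in> K" using c h by (simp add: k_def)
      have ab0: "pairing a b \<noteq> 0" using a b pairing_nonzero by simp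
      have "pairing a k = 1"
        unfolding k_def using a b c h ij ab0 a_pow
        by (simp add: pairing_mult_right pairing_inv pairing_pow pairing_alternating)
      moreover have "pairing k b = 1"
        unfolding k_def using a b c h ij ab0 a_pow
        by (simp add: pairing_mult_left pairing_inv pairing_pow pairing_alternating)
      moreover have "h = a [^] j \<otimes> b [^] i \<otimes> k"
        unfolding k_def using c h a_pow by (simp add: m_assoc[symmetric] del: m_assoc)
      ultimately show ?thesis using k unfolding K'_def by blast
    qed
    have ns': "x = \<one>" if x: "x \<in> K'" and orth: "\<And>y. y \<in> K' \<Longrightarrow> pairing x y = 1" for x
    proof (rule less.prems(3))
      show "x \<in> K" using x K'K by blast
      fix y assume "y \<in> K"
      then obtain j i :: nat and k where y: "k \<in> K'" "y = a [^] j \<otimes> b [^] i \<otimes> k" using decomp by blast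
      have "pairing x a = 1" using pairing_antisym[of x a] x a by (simp add: K'_def)
      moreover have "pairing x b = 1" using x by (simp add: K'_def)
      ultimately show "pairing x y = 1"
        using orth[OF y(1)] x y a b K'K by (auto simp: K'_def pairing_mult_right pairing_pow)
    qed
    have "K' \<subset> K" using K'K a ab by (auto simp: K'_def)
    then have "card K' < card K" using less.prems(2) by (intro psubset_card_mono)
    then obtain L M where LM: "subgroup L H" "subgroup M H" "L \<subseteq> K'" "M \<subseteq> K'"
      and iso: "\<forall>x \<in> L. \<forall>y \<in> L. pairing x y = 1" "\<forall>x \<in> M. \<forall>y \<in> M. pairing x y = 1"
      and split: "\<forall>x \<in> K'. \<exists>l \<in> L. \<exists>m \<in> M. x = l \<otimes> m"
      using less.hyps[OF _ \<open>subgroup K' H\<close> finite_subset[OF K'K less.prems(2)] ns'] by blast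
    let ?L = "generate H (insert a L)" and ?M = "generate H (insert b M)"
    have sub: "insert a L \<subseteq> carrier H" "insert b M \<subseteq> carrier H" using a b LM K'K by auto
    have subL: "subgroup ?L H" "subgroup ?M H" using sub generate_is_subgroup by blast+
    moreover have "?L \<subseteq> K" "?M \<subseteq> K"
      using a b LM(3,4) K'K by (intro generate_subgroup_incl less.prems(1); blast)+
    moreover have "\<forall>x \<in> ?L. \<forall>y \<in> ?L. pairing x y = 1"
    proof (intro ballI, rule pairing_generate[OF sub(1)])
      fix x y assume xy: "x \<in> insert a L" "y \<in> insert a L"
      have "pairing a z = 1" "pairing z a = 1" if "z \<in> L" for z
        using that LM(3) K'K a pairing_antisym[of z a] by (auto simp: K'_def)
      then show "pairing x y = 1" using xy iso(1) a by (auto simp: pairing_alternating)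
    qed
    moreover have "\<forall>x \<in> ?M. \<forall>y \<in> ?M. pairing x y = 1"
    proof (intro ballI, rule pairing_generate[OF sub(2)])
      fix x y assume xy: "x \<in> insert b M" "y \<in> insert b M"
      have "pairing z b = 1" "pairing b z = 1" if "z \<in> M" for z
        using that LM(4) K'K b pairing_antisym[of b z] by (auto simp: K'_def)
      then show "pairing x y = 1" using xy iso(2) b by (auto simp: pairing_alternating)
    qed
    moreover have "\<exists>l \<in> ?L. \<exists>m \<in> ?M. x = l \<otimes> m" if x: "x \<in> K" for x
    proof -
      obtain j i :: nat and k where k: "k \<in> K'" "x = a [^] j \<otimes> b [^] i \<otimes> k" using decomp[OF x] by blast
      then obtain l m where lm: "l \<in> L" "m \<in> M" "k = l \<otimes> m" using split by blast
      have "a \<in> ?L" "b \<in> ?M" "l \<in> ?L" "m \<in> ?M" using lm(1,2) by (auto intro: generate.incl)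
      then have ab': "a [^] j \<in> ?L" "b [^] i \<in> ?M" "l \<in> ?L" "m \<in> ?M"
        using subL by (simp_all add: subgroup_nat_pow_closed)
      then have "a [^] j \<otimes> l \<in> ?L" "b [^] i \<otimes> m \<in> ?M" using subL subgroup.m_closed by metis+
      moreover have "l \<in> carrier H" "m \<in> carrier H" using lm LM K'K by auto
      then have "x = a [^] j \<otimes> l \<otimes> (b [^] i \<otimes> m)"
        unfolding k(2) lm(3) using a b by (simp add: m_ac)
      ultimately show ?thesis by blast
    qed
    ultimately show ?thesis by blast
  qed
qed

end

section \<open>Existence\<close>

text \<open>On functions on \<open>M\<close>, let \<open>M\<close> act by translations and \<open>L\<close> by multiplication with the characters
  \<open>p l\<close>. The matrices \<open>U x\<close> below describe this action with respect to the point masses, numbered by \<open>enum\<close>.\<close>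

locale polarized_group = symplectic_abelian_group H p
  for H :: "('h, 'm) monoid_scheme" (structure) and p +
  fixes L M
  assumes finite_carrier: "finite (carrier H)"
    and nonsing: "nonsingular_pairing H p"
    and L: "subgroup L H" and M: "subgroup M H"
    and L_isotropic: "\<lbrakk>x \<in> L; y \<in> L\<rbrakk> \<Longrightarrow> p x y = 1"
    and M_isotropic: "\<lbrakk>x \<in> M; y \<in> M\<rbrakk> \<Longrightarrow> p x y = 1"
    and split: "x \<in> carrier H \<Longrightarrow> \<exists>l \<in> L. \<exists>m \<in> M. x = l \<otimes> m"
begin

sublocale L: subgroup L H by (rule L)
sublocale M: subgroup M H by (rule M)

lemma trivial_if_orthogonal:
  assumes x: "x \<in> carrier H" and 1: "\<And>l. l \<in> L \<Longrightarrow> p x l = 1" "\<And>m. m \<in> M \<Longrightarrow> p x m = 1"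
  shows "x = \<one>"
proof -
  have "p x y = 1" if y: "y \<in> carrier H" for y
  proof -
    obtain l m where "l \<in> L" "m \<in> M" "y = l \<otimes> m" using split[OF y] by blast
    then show ?thesis using x 1 by (simp add: pairing_mult_right)
  qed
  then show ?thesis using nonsing x unfolding nonsingular_pairing_def by blast
qed

text \<open>An element of both \<open>L\<close> and \<open>M\<close> is orthogonal to everything.\<close>

lemma split_unique:
  assumes "l \<in> L" "m \<in> M" "l' \<in> L" "m' \<in> M" and eq: "l \<otimes> m = l' \<otimes> m'"
  shows "l = l'" "m = m'"
proof -
  have c: "l \<in> carrier H" "m \<in> carrier H" "l' \<in> carrier H" "m' \<in> carrier H" using assms by auto
  have "inv l' \<otimes> l = inv l' \<otimes> (l \<otimes> m) \<otimes> inv m" using c by (simp add: m_assoc)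
  also have "\<dots> = m' \<otimes> inv m" unfolding eq using c by (simp add: m_assoc[symmetric])
  finally have x: "inv l' \<otimes> l = m' \<otimes> inv m" .
  have "inv l' \<otimes> l = \<one>"
  proof (rule trivial_if_orthogonal)
    show "inv l' \<otimes> l \<in> carrier H" using c by simp
    show "p (inv l' \<otimes> l) y = 1" if "y \<in> L" for y using that assms by (intro L_isotropic) auto
    show "p (inv l' \<otimes> l) y = 1" if "y \<in> M" for y unfolding x using that assms by (intro M_isotropic) auto
  qed
  then show "l = l'" using c by (metis inv_closed inv_equality inv_inv)
  then show "m = m'" using eq c by simp
qed

definition L_part where "L_part x = (SOME l. l \<in> L \<and> (\<exists>m \<in> M. x = l \<otimes> m))"
definition M_part where "M_part x = (SOME m. m \<in> M \<and> x = L_part x \<otimes> m)"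

lemma parts:
  assumes "x \<in> carrier H"
  shows "L_part x \<in> L" "M_part x \<in> M" "x = L_part x \<otimes> M_part x"
proof -
  have L: "L_part x \<in> L \<and> (\<exists>m \<in> M. x = L_part x \<otimes> m)"
    unfolding L_part_def by (rule someI_ex) (use split[OF assms] in blast)
  then have "\<exists>m. m \<in> M \<and> x = L_part x \<otimes> m" by blast
  then have "M_part x \<in> M \<and> x = L_part x \<otimes> M_part x"
    unfolding M_part_def by (rule someI_ex)
  with L show "L_part x \<in> L" "M_part x \<in> M" "x = L_part x \<otimes> M_part x" by blast+
qed

lemma parts_eq:
  assumes "l \<in> L" "m \<in> M"
  shows "L_part (l \<otimes> m) = l" "M_part (l \<otimes> m) = m"
proof -
  have "l \<otimes> m \<in> carrier H" using assms by simp
  from parts[OF this] split_unique[of "L_part (l \<otimes> m)" "M_part (l \<otimes> m)" l m] assms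
  show "L_part (l \<otimes> m) = l" "M_part (l \<otimes> m) = m" by auto
qed

lemma parts_mult:
  assumes x: "x \<in> carrier H" and y: "y \<in> carrier H"
  shows "L_part (x \<otimes> y) = L_part x \<otimes> L_part y" "M_part (x \<otimes> y) = M_part x \<otimes> M_part y"
proof -
  note px = parts[OF x] and py = parts[OF y]
  have "x \<otimes> y = (L_part x \<otimes> M_part x) \<otimes> (L_part y \<otimes> M_part y)"
    using px(3) py(3) by simp
  also have "\<dots> = (L_part x \<otimes> L_part y) \<otimes> (M_part x \<otimes> M_part y)"
    using px(1,2) py(1,2) by (simp add: m_ac)
  finally show "L_part (x \<otimes> y) = L_part x \<otimes> L_part y" "M_part (x \<otimes> y) = M_part x \<otimes> M_part y"
    using parts_eq px(1,2) py(1,2) by simp_all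
qed

definition dim :: nat where "dim = card M"

definition enum where "enum = (SOME e. bij_betw e {..<dim} M)"

lemma finite_M: "finite M"
  using finite_carrier M.subset finite_subset by blast

lemma enum: "bij_betw enum {..<dim} M"
  unfolding enum_def dim_def
  using ex_bij_betw_nat_finite[OF finite_M, unfolded atLeast0LessThan] by (rule someI_ex)

lemma enum_M [simp, intro]: "i < dim \<Longrightarrow> enum i \<in> M"
  using enum by (auto simp: bij_betw_def)

lemma enum_inj: "i < dim \<Longrightarrow> j < dim \<Longrightarrow> enum i = enum j \<longleftrightarrow> i = j"
  using enum by (auto simp: bij_betw_def inj_on_def)

lemma enum_surj:
  assumes "m \<in> M" obtains i where "i < dim" "enum i = m"
proof -
  have "m \<in> enum ` {..<dim}" using assms enum by (simp add: bij_betw_def)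
  then show ?thesis using that by blast
qed

lemma dim_pos: "dim > 0"
  unfolding dim_def using finite_M M.one_closed card_gt_0_iff by blast

definition U :: "'h \<Rightarrow> complex mat" where
  "U x = mat dim dim (\<lambda>(i, j). if enum i = M_part x \<otimes> enum j then p (L_part x) (enum i) else 0)"

lemma U_carrier [simp, intro]: "U x \<in> carrier_mat dim dim"
  by (simp add: U_def)

text \<open>The scalar comes from moving the \<open>L\<close>-part of \<open>y\<close> past the translation by the \<open>M\<close>-part of \<open>x\<close>.\<close>

lemma U_mult:
  assumes x: "x \<in> carrier H" and y: "y \<in> carrier H"
  shows "U x * U y = inverse (p (L_part y) (M_part x)) \<cdot>\<^sub>m U (x \<otimes> y)"
proof (rule eq_matI)
  fix i j assume "i < dim_row (inverse (p (L_part y) (M_part x)) \<cdot>\<^sub>m U (x \<otimes> y))"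
    "j < dim_col (inverse (p (L_part y) (M_part x)) \<cdot>\<^sub>m U (x \<otimes> y))"
  then have ij: "i < dim" "j < dim" by (simp_all add: U_def)
  note px = parts(1,2)[OF x] and py = parts(1,2)[OF y]
  obtain r where r: "r < dim" "enum r = M_part y \<otimes> enum j"
    using enum_surj[of "M_part y \<otimes> enum j"] py ij by auto
  have "(U x * U y) $$ (i, j) = (\<Sum>k<dim. U x $$ (i, k) * U y $$ (k, j))"
    using ij carrier_matD[OF U_carrier] by (auto simp: scalar_prod_def atLeast0LessThan)
  also have "\<dots> = (\<Sum>k<dim. if k = r then U x $$ (i, r) * p (L_part y) (enum r) else 0)"
    using r ij by (intro sum.cong) (auto simp: U_def enum_inj[OF _ r(1)] r(2)[symmetric])
  also have "\<dots> = U x $$ (i, r) * p (L_part y) (enum r)" using r by simp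
  also have "\<dots> = inverse (p (L_part y) (M_part x)) * U (x \<otimes> y) $$ (i, j)"
  proof (cases "enum i = M_part x \<otimes> M_part y \<otimes> enum j")
    case True
    then have e: "enum i = M_part x \<otimes> enum r" using r px py ij by (simp add: m_assoc)
    have "p (L_part y) (enum i) = p (L_part y) (M_part x) * p (L_part y) (enum r)"
      unfolding e using px py r ij by (intro pairing_mult_right) auto
    moreover have "p (L_part y) (M_part x) \<noteq> 0" using px py by (intro pairing_nonzero) auto
    moreover have "p (L_part x \<otimes> L_part y) (enum i) = p (L_part x) (enum i) * p (L_part y) (enum i)"
      using px py ij by (intro pairing_mult_left) auto
    ultimately show ?thesis using True e ij r by (simp add: U_def parts_mult[OF x y])
  next
    case False
    then have "enum i \<noteq> M_part x \<otimes> enum r" using r px py ij by (simp add: m_assoc)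
    then show ?thesis using False ij r by (simp add: U_def parts_mult[OF x y])
  qed
  finally show "(U x * U y) $$ (i, j) = (inverse (p (L_part y) (M_part x)) \<cdot>\<^sub>m U (x \<otimes> y)) $$ (i, j)"
    using ij by (simp add: U_def)
qed (simp_all add: U_def)

lemma U_one: "U \<one> = 1\<^sub>m dim"
proof -
  have "L_part \<one> = \<one>" "M_part \<one> = \<one>" using parts_eq[OF L.one_closed M.one_closed] by simp_all
  then show ?thesis by (intro eq_matI) (auto simp: U_def enum_inj)
qed

lemma U_GL:
  assumes x: "x \<in> carrier H"
  shows "U x \<in> carrier (GL dim)"
proof -
  let ?c = "p (L_part x) (M_part (inv x))"
  have "?c \<noteq> 0" using x parts by (intro pairing_nonzero) auto
  then have "?c \<cdot>\<^sub>m U (inv x) * U x = 1\<^sub>m dim"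
    using U_mult[of "inv x" x] x
    by (simp add: U_one mult_smult_assoc_mat[of _ dim dim _ dim] smult_smult)
  then show ?thesis by (intro GL_I[of _ _ "?c \<cdot>\<^sub>m U (inv x)"]) auto
qed

lemma U_commute:
  assumes x: "x \<in> carrier H" and y: "y \<in> carrier H"
  shows "U x * U y = p x y \<cdot>\<^sub>m (U y * U x)"
proof -
  note px = parts(1,2)[OF x] and py = parts(1,2)[OF y]
  have c: "L_part x \<in> carrier H" "M_part x \<in> carrier H" "L_part y \<in> carrier H" "M_part y \<in> carrier H"
    using px py by auto
  have "p x y = p (L_part x \<otimes> M_part x) (L_part y \<otimes> M_part y)" using parts(3) x y by simp
  also have "\<dots> = p (L_part x) (M_part y) * p (M_part x) (L_part y)"
    using c px py by (simp add: pairing_mult_left pairing_mult_right L_isotropic M_isotropic)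
  also have "p (M_part x) (L_part y) = inverse (p (L_part y) (M_part x))"
    using c by (rule_tac pairing_antisym) auto
  finally have "p x y * inverse (p (L_part x) (M_part y)) = inverse (p (L_part y) (M_part x))"
    using pairing_nonzero[OF c(1,4)] by simp
  then show ?thesis
    by (simp add: U_mult[OF x y] U_mult[OF y x] smult_smult m_comm[OF y x])
qed

text \<open>Commuting with \<open>L\<close> makes \<open>C\<close> diagonal, because the elements of \<open>M\<close> are separated by the characters
  \<open>p l\<close>. Commuting with the translations by \<open>M\<close> makes the diagonal constant.\<close>

lemma U_irreducible:
  assumes C: "C \<in> carrier_mat dim dim" and CU: "\<And>x. x \<in> carrier H \<Longrightarrow> C * U x = U x * C"
  shows "\<exists>c. C = c \<cdot>\<^sub>m 1\<^sub>m dim"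
proof -
  have entry: "(\<Sum>k<dim. C $$ (i, k) * U x $$ (k, j)) = (\<Sum>k<dim. U x $$ (i, k) * C $$ (k, j))"
    if "x \<in> carrier H" "i < dim" "j < dim" for x i j
    using arg_cong[OF CU[OF that(1)], of "\<lambda>X. X $$ (i, j)"] that C carrier_matD[OF U_carrier]
    by (simp add: scalar_prod_def atLeast0LessThan)
  have diag: "C $$ (i, j) = 0" if ij: "i < dim" "j < dim" "i \<noteq> j" for i j
  proof -
    let ?z = "enum i \<otimes> inv (enum j)"
    have z: "?z \<in> M" "?z \<in> carrier H" using ij by auto
    have e: "enum i \<in> carrier H" "enum j \<in> carrier H" using ij by auto
    have "?z \<noteq> \<one>" using enum_inj ij e by (metis inv_equality inv_inv inv_closed)
    then obtain l where l: "l \<in> L" "p ?z l \<noteq> 1"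
      using trivial_if_orthogonal[OF z(2)] M_isotropic[OF z(1)] by blast
    have lc: "l \<in> carrier H" using l by auto
    have ne: "p l (enum i) \<noteq> p l (enum j)"
    proof
      assume eq: "p l (enum i) = p l (enum j)"
      have "p l ?z = 1" using pairing_nonzero[OF lc e(2)] lc e
        by (simp add: pairing_mult_right pairing_inv eq)
      then show False using l(2) pairing_antisym[of ?z l] z lc by simp
    qed
    have lp: "L_part l = l" "M_part l = \<one>" using parts_eq[OF l(1) M.one_closed] lc by simp_all
    have Ul: "U l $$ (k, k') = (if k = k' then p l (enum k) else 0)" if "k < dim" "k' < dim" for k k'
      using that by (auto simp: U_def lp enum_inj)
    have "(\<Sum>k<dim. C $$ (i, k) * U l $$ (k, j)) = (\<Sum>k<dim. if k = j then C $$ (i, j) * p l (enum j) else 0)"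
      using ij by (intro sum.cong) (auto simp: Ul)
    moreover have "(\<Sum>k<dim. U l $$ (i, k) * C $$ (k, j)) = (\<Sum>k<dim. if k = i then p l (enum i) * C $$ (i, j) else 0)"
      using ij by (intro sum.cong) (auto simp: Ul)
    ultimately have "C $$ (i, j) * p l (enum j) = p l (enum i) * C $$ (i, j)"
      using entry[OF lc ij(1,2)] ij by auto
    then show ?thesis using ne by simp
  qed
  have const: "C $$ (i, i) = C $$ (j, j)" if ij: "i < dim" "j < dim" for i j
  proof -
    define m where "m = enum i \<otimes> inv (enum j)"
    have m: "m \<in> M" "m \<in> carrier H" using ij by (auto simp: m_def)
    have e: "enum i \<in> carrier H" "enum j \<in> carrier H" using ij by auto
    have mp: "L_part m = \<one>" "M_part m = m" using parts_eq[OF L.one_closed m(1)] m(2) by simp_all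
    have mj: "enum i = m \<otimes> enum j" using e by (simp add: m_def m_assoc)
    have Um: "U m $$ (i, j) = 1" using ij e by (simp add: U_def mp mj[symmetric])
    have "(\<Sum>k<dim. C $$ (i, k) * U m $$ (k, j)) = (\<Sum>k<dim. if k = i then C $$ (i, i) else 0)"
      using ij diag by (intro sum.cong) (auto simp: Um)
    moreover have "(\<Sum>k<dim. U m $$ (i, k) * C $$ (k, j)) = (\<Sum>k<dim. if k = j then C $$ (j, j) else 0)"
      using ij diag by (intro sum.cong) (auto simp: Um)
    ultimately show ?thesis using entry[OF m(2) ij] ij by simp
  qed
  have "C = C $$ (0, 0) \<cdot>\<^sub>m 1\<^sub>m dim"
  proof (rule eq_matI)
    fix i j assume "i < dim_row (C $$ (0, 0) \<cdot>\<^sub>m 1\<^sub>m dim)" "j < dim_col (C $$ (0, 0) \<cdot>\<^sub>m 1\<^sub>m dim)"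
    then have ij: "i < dim" "j < dim" by simp_all
    show "C $$ (i, j) = (C $$ (0, 0) \<cdot>\<^sub>m 1\<^sub>m dim) $$ (i, j)"
      using ij diag[OF ij] const[OF ij(1) dim_pos] by (cases "i = j") simp_all
  qed (use C in auto)
  then show ?thesis by blast
qed

theorem U_heisenberg_rep: "heisenberg_rep H dim U p"
proof -
  have rep: "projective_rep H dim U"
  proof (intro projective_rep.intro projective_rep_axioms.intro)
    fix x y assume xy: "x \<in> carrier H" "y \<in> carrier H"
    have "p (L_part y) (M_part x) \<noteq> 0" using xy parts by (intro pairing_nonzero) auto
    then show "\<exists>c. c \<noteq> 0 \<and> U x * U y = c \<cdot>\<^sub>m U (x \<otimes> y)"
      using U_mult[OF xy] by (intro exI[of _ "inverse (p (L_part y) (M_part x))"]) auto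
  qed (simp_all add: is_group dim_pos finite_carrier U_GL)
  interpret projective_rep H dim U by (rule rep)
  show ?thesis
  proof (intro heisenberg_rep.intro rep comm_group_axioms heisenberg_rep_axioms.intro)
    show "U x * U y = p x y \<cdot>\<^sub>m (U y * U x)" if "x \<in> carrier H" "y \<in> carrier H" for x y
      using U_commute that .
    show "\<exists>c. C = c \<cdot>\<^sub>m 1\<^sub>m dim" if "commutes C" for C
      using U_irreducible that by (simp add: commutes_def)
    show "x = \<one>" if x: "x \<in> carrier H" "U x = c \<cdot>\<^sub>m 1\<^sub>m dim" for x c
    proof -
      have "p x y = 1" if y: "y \<in> carrier H" for y
      proof (rule smult_mat_cancel)
        have "U x * U y = U y * U x" unfolding x(2) by (simp add: mult_one_smult[OF U_carrier])
        then show "p x y \<cdot>\<^sub>m (U y * U x) = 1 \<cdot>\<^sub>m (U y * U x)" using U_commute[OF x(1) y] by simp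
        show "U y * U x \<noteq> 0\<^sub>m dim dim" using x(1) y U_GL dim_pos by (intro GL_nonzero) auto
        show "U y * U x \<in> carrier_mat dim dim" by auto
      qed
      then show ?thesis using nonsing x(1) unfolding nonsingular_pairing_def by blast
    qed
  qed
qed

end

text \<open>The representation attached to a polarization has the required degree by \<open>card_eq\<close>.\<close>

corollary ex_heisenberg_rep:
  assumes H: "symplectic_abelian_group H p" "nonsingular_pairing H p"
    and card: "finite (carrier H)" "card (carrier H) = n\<^sup>2"
  shows "\<exists>A. heisenberg_rep H n A p"
proof -
  interpret symplectic_abelian_group H p by (rule H)
  have ns: "x = \<one>\<^bsub>H\<^esub>" if "x \<in> carrier H" "\<And>y. y \<in> carrier H \<Longrightarrow> p x y = 1" for x
    using H(2) that unfolding nonsingular_pairing_def by blast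
  obtain L M where LM: "subgroup L H" "subgroup M H"
    "\<forall>x \<in> L. \<forall>y \<in> L. p x y = 1" "\<forall>x \<in> M. \<forall>y \<in> M. p x y = 1"
    "\<forall>x \<in> carrier H. \<exists>l \<in> L. \<exists>m \<in> M. x = l \<otimes>\<^bsub>H\<^esub> m"
    using ex_polarization[OF subgroup_self card(1) ns] by auto
  interpret polarized_group H p L M
    by (intro polarized_group.intro polarized_group_axioms.intro) (use H card LM in auto)
  have "dim\<^sup>2 = n\<^sup>2" using heisenberg_rep.card_eq[OF U_heisenberg_rep] card(2) by simp
  then have "dim = n" by simp
  then show ?thesis using U_heisenberg_rep by blast
qed

section \<open>The correspondence\<close>

lemma (in heisenberg_rep) iso_image:
  "(\<lambda>x. pgl n (A x)) \<in> iso H ((PGL n)\<lparr>carrier := image_PGL\<rparr>)"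
  using hom_pgl inj_pgl by (auto simp: iso_def hom_def bij_betw_def image_PGL_def)

text \<open>This turns a conjugation of image subgroups into an equality of image subgroups.\<close>

lemma (in heisenberg_rep) heisenberg_rep_conjugate:
  assumes M: "M \<in> carrier (GL n)"
  shows "heisenberg_rep H n (\<lambda>x. M * A x * inv\<^bsub>GL n\<^esub> M) p"
proof -
  let ?M = "inv\<^bsub>GL n\<^esub> M" and ?B = "\<lambda>x. M * A x * inv\<^bsub>GL n\<^esub> M"
  note sm = mult_smult_distrib[of _ n n _ n] mult_smult_assoc_mat[of _ n n _ n]
    assoc_mult_mat[of _ n n _ n _ n] smult_smult
  have Mc: "M \<in> carrier_mat n n" "?M \<in> carrier_mat n n" using M by auto
  have conj_mult: "M * X * ?M * (M * Y * ?M) = M * (X * Y) * ?M"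
    if "X \<in> carrier_mat n n" "Y \<in> carrier_mat n n" for X Y
    using that Mc GL_inv_cancel(1)[OF M, of "Y * ?M"] by (simp add: sm)
  have conj_smult: "M * (c \<cdot>\<^sub>m X) * ?M = c \<cdot>\<^sub>m (M * X * ?M)" if "X \<in> carrier_mat n n" for c X
    using that Mc by (simp add: sm)
  have conj_scalar: "X = c \<cdot>\<^sub>m 1\<^sub>m n" if "X \<in> carrier_mat n n" "M * X * ?M = c \<cdot>\<^sub>m 1\<^sub>m n" for c X
  proof -
    have "X = ?M * (M * X * ?M) * M"
      using that(1) Mc GL_inv_cancel(1)[OF M, of X] GL_inv_cancel(4)[OF M, of X] by (simp add: sm)
    also have "\<dots> = c \<cdot>\<^sub>m 1\<^sub>m n"
      unfolding that(2) using Mc GL_inv_mult(1)[OF M] by (simp add: sm mult_one_smult)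
    finally show ?thesis .
  qed
  have rep: "projective_rep H n ?B"
  proof (intro projective_rep.intro projective_rep_axioms.intro is_group n_pos fin)
    show "?B x \<in> carrier (GL n)" if "x \<in> carrier H" for x using that M by auto
    fix x y assume xy: "x \<in> carrier H" "y \<in> carrier H"
    then obtain c where c: "c \<noteq> 0" "A x * A y = c \<cdot>\<^sub>m A (x \<otimes> y)" using A_mult by blast
    have "?B x * ?B y = M * (A x * A y) * ?M" using xy by (intro conj_mult) auto
    also have "\<dots> = c \<cdot>\<^sub>m ?B (x \<otimes> y)" unfolding c(2) using xy by (intro conj_smult) auto
    finally show "\<exists>c. c \<noteq> 0 \<and> ?B x * ?B y = c \<cdot>\<^sub>m ?B (x \<otimes> y)" using c(1) by blast
  qed
  show ?thesis
  proof (intro heisenberg_rep.intro rep comm_group_axioms heisenberg_rep_axioms.intro)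
    fix x y assume xy: "x \<in> carrier H" "y \<in> carrier H"
    have "?B x * ?B y = M * (A x * A y) * ?M" using xy by (intro conj_mult) auto
    also have "\<dots> = p x y \<cdot>\<^sub>m (M * (A y * A x) * ?M)"
      unfolding A_commute[OF xy] using xy by (intro conj_smult) auto
    also have "M * (A y * A x) * ?M = ?B y * ?B x" using xy by (intro conj_mult[symmetric]) auto
    finally show "?B x * ?B y = p x y \<cdot>\<^sub>m (?B y * ?B x)" .
  next
    fix C assume "projective_rep.commutes H n ?B C"
    then have C: "C \<in> carrier_mat n n" "\<And>x. x \<in> carrier H \<Longrightarrow> C * ?B x = ?B x * C"
      by (simp_all add: projective_rep.commutes_def[OF rep])
    define D where "D = ?M * C * M"
    have D: "D \<in> carrier_mat n n" "M * D * ?M = C"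
      using C(1) Mc GL_inv_cancel(2)[OF M, of C] GL_inv_cancel(3)[OF M, of C]
      by (auto simp: D_def sm)
    have "commutes D" unfolding commutes_def
    proof (intro conjI ballI D(1))
      fix x assume x: "x \<in> carrier H"
      have "M * (D * A x) * ?M = M * (A x * D) * ?M"
        using conj_mult[of D "A x"] conj_mult[of "A x" D] D x C(2)[OF x] by simp
      then have "?M * (M * (D * A x) * ?M) * M = ?M * (M * (A x * D) * ?M) * M" by simp
      moreover have "?M * (M * X * ?M) * M = X" if "X \<in> carrier_mat n n" for X
        using that Mc GL_inv_cancel(1)[OF M, of X] GL_inv_cancel(4)[OF M, of X] by (simp add: sm)
      ultimately show "D * A x = A x * D" using D(1) x by simp
    qed
    then obtain c where "D = c \<cdot>\<^sub>m 1\<^sub>m n" using irreducible by blast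
    then have "C = c \<cdot>\<^sub>m (M * 1\<^sub>m n * ?M)" using D(2) conj_smult[of "1\<^sub>m n" c] by simp
    then show "\<exists>c. C = c \<cdot>\<^sub>m 1\<^sub>m n" using Mc GL_inv_mult(2)[OF M] by (auto simp: right_mult_one_mat[of _ n n])
  next
    fix x c assume "x \<in> carrier H" "?B x = c \<cdot>\<^sub>m 1\<^sub>m n"
    then show "x = \<one>" using conj_scalar[of "A x" c] faithful by auto
  qed
qed

lemma (in heisenberg_rep) heisenberg_rep_pullback:
  assumes K: "comm_group K" and h: "h \<in> iso K H"
    and q: "\<And>a b. a \<in> carrier K \<Longrightarrow> b \<in> carrier K \<Longrightarrow> q a b = p (h a) (h b)"
  shows "heisenberg_rep K n (\<lambda>x. A (h x)) q" "(\<lambda>x. pgl n (A (h x))) ` carrier K = image_PGL"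
proof -
  interpret K: comm_group K by (rule K)
  have hH: "h a \<in> carrier H" if "a \<in> carrier K" for a using h that by (auto simp: iso_def hom_def)
  have hm: "h (a \<otimes>\<^bsub>K\<^esub> b) = h a \<otimes> h b" if "a \<in> carrier K" "b \<in> carrier K" for a b
    using h that by (auto simp: iso_def hom_def)
  have bij: "bij_betw h (carrier K) (carrier H)" using h by (simp add: iso_def)
  have hK: "h ` carrier K = carrier H" using bij by (simp add: bij_betw_def)
  have rep: "projective_rep K n (\<lambda>x. A (h x))"
    by (intro projective_rep.intro projective_rep_axioms.intro K.is_group n_pos)
      (use bij_betw_finite[OF bij] fin hH hm A_mult in auto)
  show "heisenberg_rep K n (\<lambda>x. A (h x)) q"
  proof (intro heisenberg_rep.intro rep K heisenberg_rep_axioms.intro)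
    show "A (h x) * A (h y) = q x y \<cdot>\<^sub>m (A (h y) * A (h x))" if "x \<in> carrier K" "y \<in> carrier K" for x y
      unfolding q[OF that] using that hH by (intro A_commute)
    show "\<exists>c. C = c \<cdot>\<^sub>m 1\<^sub>m n" if C: "projective_rep.commutes K n (\<lambda>x. A (h x)) C" for C
    proof (rule irreducible)
      have "\<forall>x \<in> h ` carrier K. C * A x = A x * C"
        using C unfolding projective_rep.commutes_def[OF rep] by blast
      then show "commutes C" using C unfolding projective_rep.commutes_def[OF rep] commutes_def hK by blast
    qed
    show "x = \<one>\<^bsub>K\<^esub>" if x: "x \<in> carrier K" "A (h x) = c \<cdot>\<^sub>m 1\<^sub>m n" for x c
    proof -
      have "h x = \<one>" using faithful hH x by blast
      also have "\<one> = h \<one>\<^bsub>K\<^esub>"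
        using h hom_one[of h K H] K.is_group is_group by (simp add: iso_def)
      finally show ?thesis using bij x(1) by (simp add: bij_betw_def inj_on_def)
    qed
  qed
  show "(\<lambda>x. pgl n (A (h x))) ` carrier K = image_PGL"
    unfolding image_PGL_def hK[symmetric] by (simp add: image_image)
qed

text \<open>Both groups are identified with the common image, where the pairing is the commutator pairing
  of lifts.\<close>

lemma isometric_if_same_image:
  assumes A: "heisenberg_rep H n A p" and B: "heisenberg_rep K n B q"
    and im: "(\<lambda>x. pgl n (A x)) ` carrier H = (\<lambda>x. pgl n (B x)) ` carrier K"
  shows "isometric (H, p) (K, q)"
proof -
  interpret A: heisenberg_rep H n A p by (rule A)
  interpret B: heisenberg_rep K n B q by (rule B)
  let ?f = "\<lambda>x. pgl n (A x)" and ?g = "\<lambda>x. pgl n (B x)"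
  have im': "A.image_PGL = B.image_PGL" using im by (simp add: A.image_PGL_def B.image_PGL_def)
  define h where "h = inv_into (carrier K) ?g \<circ> ?f"
  have "inv_into (carrier K) ?g \<in> iso ((PGL n)\<lparr>carrier := B.image_PGL\<rparr>) K"
    by (rule B.iso_set_sym[OF B.iso_image])
  then have iso: "h \<in> iso H K" unfolding h_def using A.iso_image im' iso_set_trans by metis
  have hK: "h x \<in> carrier K" if "x \<in> carrier H" for x using iso that by (auto simp: iso_def hom_def)
  have hB: "\<exists>c. c \<noteq> 0 \<and> B (h x) = c \<cdot>\<^sub>m A x" if x: "x \<in> carrier H" for x
  proof -
    have "?f x \<in> ?g ` carrier K" using im x by blast
    from f_inv_into_f[OF this] have "pgl n (B (h x)) = pgl n (A x)" by (simp add: h_def)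
    then show ?thesis using x hK pgl_eq_iff by blast
  qed
  have "q (h x) (h y) = p x y" if xy: "x \<in> carrier H" "y \<in> carrier H" for x y
  proof (rule B.p_eqI)
    obtain c d where c: "B (h x) = c \<cdot>\<^sub>m A x" "B (h y) = d \<cdot>\<^sub>m A y" using hB xy by blast
    note sm = mult_smult_distrib[of _ n n _ n] mult_smult_assoc_mat[of _ n n _ n] smult_smult
    have "B (h x) * B (h y) = (c * d) \<cdot>\<^sub>m (A x * A y)" unfolding c using xy by (simp add: sm mult.commute)
    also have "\<dots> = p x y \<cdot>\<^sub>m (B (h y) * B (h x))"
      unfolding c A.A_commute[OF xy] using xy by (simp add: sm mult_ac)
    finally show "B (h x) * B (h y) = p x y \<cdot>\<^sub>m (B (h y) * B (h x))" .
  qed (use xy hK in auto)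
  then show ?thesis unfolding isometric_def using iso by auto
qed

lemma conjugate_in_PGL_iff:
  "conjugate_in (PGL n) ((\<lambda>x. pgl n (A x)) ` I) F \<longleftrightarrow>
    (\<exists>M \<in> carrier (GL n). F = (\<lambda>x. pgl n (M * A x * inv\<^bsub>GL n\<^esub> M)) ` I)"
  if A: "\<And>x. x \<in> I \<Longrightarrow> A x \<in> carrier (GL n)" for F I
proof -
  have *: "(\<lambda>X. pgl n M \<otimes>\<^bsub>PGL n\<^esub> X \<otimes>\<^bsub>PGL n\<^esub> inv\<^bsub>PGL n\<^esub> pgl n M) ` (\<lambda>x. pgl n (A x)) ` I
      = (\<lambda>x. pgl n (M * A x * inv\<^bsub>GL n\<^esub> M)) ` I" if M: "M \<in> carrier (GL n)" for M
    unfolding image_image using M A by (intro image_cong) (simp_all add: pgl_mult pgl_inv)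
  show ?thesis
  proof
    assume "conjugate_in (PGL n) ((\<lambda>x. pgl n (A x)) ` I) F"
    then obtain g where g: "g \<in> carrier (PGL n)"
      "F = (\<lambda>X. g \<otimes>\<^bsub>PGL n\<^esub> X \<otimes>\<^bsub>PGL n\<^esub> inv\<^bsub>PGL n\<^esub> g) ` (\<lambda>x. pgl n (A x)) ` I"
      unfolding conjugate_in_def by blast
    obtain M where "M \<in> carrier (GL n)" "g = pgl n M" using g(1) by (rule pgl_cases)
    then show "\<exists>M \<in> carrier (GL n). F = (\<lambda>x. pgl n (M * A x * inv\<^bsub>GL n\<^esub> M)) ` I"
      using g(2) * by blast
  next
    assume "\<exists>M \<in> carrier (GL n). F = (\<lambda>x. pgl n (M * A x * inv\<^bsub>GL n\<^esub> M)) ` I"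
    then obtain M where "M \<in> carrier (GL n)" "F = (\<lambda>x. pgl n (M * A x * inv\<^bsub>GL n\<^esub> M)) ` I" by blast
    then show "conjugate_in (PGL n) ((\<lambda>x. pgl n (A x)) ` I) F"
      unfolding conjugate_in_def using * by (intro bexI[of _ "pgl n M"]) auto
  qed
qed

text \<open>The relation between a nonsingular symplectic group \<open>S\<close> and a subgroup \<open>F\<close> of \<open>PGL\<close> that
  induces the correspondence.\<close>

definition realizes where
  "realizes n S F \<longleftrightarrow> (\<exists>A. heisenberg_rep (fst S) n A (snd S) \<and>
    F = (\<lambda>x. pgl n (A x)) ` carrier (fst S))"

text \<open>If \<open>F'\<close> is a conjugate of \<open>F\<close>, then a conjugate of the representation of \<open>S\<close> has image \<open>F'\<close>, so
  \<open>S\<close> and \<open>S'\<close> are isometric. Conversely, an isometry turns the representation of \<open>S'\<close> into one of \<open>S\<close>,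
  and \<open>heisenberg_rep_unique\<close> provides the conjugating element.\<close>

lemma conjugate_iff_isometric:
  assumes S: "realizes n S F" and S': "realizes n S' F'"
  shows "conjugate_in (PGL n) F F' \<longleftrightarrow> isometric S S'"
proof -
  obtain H p K q where [simp]: "S = (H, p)" "S' = (K, q)" by (metis surj_pair)
  obtain A where A: "heisenberg_rep H n A p" and F: "F = (\<lambda>x. pgl n (A x)) ` carrier H"
    using S by (auto simp: realizes_def)
  obtain B where B: "heisenberg_rep K n B q" and F': "F' = (\<lambda>x. pgl n (B x)) ` carrier K"
    using S' by (auto simp: realizes_def)
  interpret A: heisenberg_rep H n A p by (rule A)
  interpret B: heisenberg_rep K n B q by (rule B)
  have conj: "conjugate_in (PGL n) F F' \<longleftrightarrow>
      (\<exists>M \<in> carrier (GL n). F' = (\<lambda>x. pgl n (M * A x * inv\<^bsub>GL n\<^esub> M)) ` carrier H)"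
    unfolding F by (rule conjugate_in_PGL_iff) auto
  show ?thesis
  proof
    assume "conjugate_in (PGL n) F F'"
    then obtain M where M: "M \<in> carrier (GL n)"
      and "F' = (\<lambda>x. pgl n (M * A x * inv\<^bsub>GL n\<^esub> M)) ` carrier H" unfolding conj by blast
    then show "isometric S S'"
      using isometric_if_same_image[OF A.heisenberg_rep_conjugate[OF M] B] F' by simp
  next
    assume "isometric S S'"
    then obtain h where h: "h \<in> iso H K"
      "\<And>a b. a \<in> carrier H \<Longrightarrow> b \<in> carrier H \<Longrightarrow> p a b = q (h a) (h b)"
      unfolding isometric_def by auto
    note pull = B.heisenberg_rep_pullback[OF A.comm_group_axioms h]
    obtain M where M: "M \<in> carrier (GL n)"
      "\<And>x. x \<in> carrier H \<Longrightarrow> pgl n (B (h x)) = pgl n (M * A x * inv\<^bsub>GL n\<^esub> M)"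
      using heisenberg_rep_unique[OF A pull(1)] by blast
    have "F' = (\<lambda>x. pgl n (B (h x))) ` carrier H" using pull(2) by (simp add: F' B.image_PGL_def)
    also have "\<dots> = (\<lambda>x. pgl n (M * A x * inv\<^bsub>GL n\<^esub> M)) ` carrier H" using M(2) by (intro image_cong) auto
    finally show "conjugate_in (PGL n) F F'" unfolding conj using M(1) by blast
  qed
qed

lemma ex_realized_by_subgroup:
  assumes "S \<in> nonsingular_symplectic_groups (n\<^sup>2)"
  shows "\<exists>F \<in> finite_maximal_diagonalizable_subgroups n. realizes n S F"
proof -
  obtain H p where S: "S = (H, p)" by (metis surj_pair)
  then have "symplectic_abelian_group H p" "nonsingular_pairing H p" "finite (carrier H)"
    "card (carrier H) = n\<^sup>2"
    using assms by (auto simp: nonsingular_symplectic_groups_def Coset.order_def)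
  then obtain A where A: "heisenberg_rep H n A p" using ex_heisenberg_rep by blast
  then have "(\<lambda>x. pgl n (A x)) ` carrier H \<in> finite_maximal_diagonalizable_subgroups n"
    using heisenberg_rep.image_maximal[OF A] by (simp add: heisenberg_rep.image_PGL_def[OF A])
  then show ?thesis using A S by (auto simp: realizes_def)
qed

lemma ex_realizing_group:
  assumes n: "n > 0" and F: "F \<in> finite_maximal_diagonalizable_subgroups n"
  shows "\<exists>S \<in> nonsingular_symplectic_groups (n\<^sup>2). realizes n S F"
proof -
  let ?H = "(PGL n)\<lparr>carrier := F\<rparr>"
  obtain A p where A: "heisenberg_rep ?H n A p" and im: "(\<lambda>X. pgl n (A X)) ` F = F"
    using heisenberg_rep_if_maximal[OF n F] by blast
  interpret A: heisenberg_rep ?H n A p by (rule A)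
  have "Coset.order ?H = n\<^sup>2" using A.card_eq by (simp add: Coset.order_def)
  then obtain S where S: "S \<in> nonsingular_symplectic_groups (n\<^sup>2)" "isometric (?H, p) S"
    using isometric_to_nat[OF A.symplectic A.nonsingular] A.fin by auto
  obtain K q where K: "S = (K, q)" by (metis surj_pair)
  have comm: "comm_group K"
    using S(1) by (simp add: K nonsingular_symplectic_groups_def symplectic_abelian_group_def)
  have "isometric S (?H, p)" using isometric_sym[OF _ S(2)] A.is_group by simp
  then obtain h where h: "h \<in> iso K ?H"
    "\<And>a b. a \<in> carrier K \<Longrightarrow> b \<in> carrier K \<Longrightarrow> q a b = p (h a) (h b)"
    unfolding isometric_def K by auto
  have "realizes n S F" unfolding realizes_def
    using A.heisenberg_rep_pullback[OF comm h] im by (auto simp: K A.image_PGL_def)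
  then show ?thesis using S(1) by blast
qed

lemma ex_bij_betw_quotients:
  assumes R: "equiv A R" and S: "equiv B S"
    and total: "\<And>a. a \<in> A \<Longrightarrow> \<exists>b \<in> B. P a b" and surj: "\<And>b. b \<in> B \<Longrightarrow> \<exists>a \<in> A. P a b"
    and iff: "\<And>a a' b b'. \<lbrakk>a \<in> A; a' \<in> A; b \<in> B; b' \<in> B; P a b; P a' b'\<rbrakk> \<Longrightarrow> (a, a') \<in> R \<longleftrightarrow> (b, b') \<in> S"
  shows "\<exists>\<Phi>. bij_betw \<Phi> (A // R) (B // S)"
proof -
  obtain f where f: "f a \<in> B" "P a (f a)" if "a \<in> A" for a using total by metis
  have fiff: "(a, a') \<in> R \<longleftrightarrow> (f a, f a') \<in> S" if "a \<in> A" "a' \<in> A" for a a'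
    using iff f that by blast
  define \<Phi> where "\<Phi> X = S `` (f ` X)" for X
  have \<Phi>: "\<Phi> (R `` {a}) = S `` {f a}" if a: "a \<in> A" for a
  proof -
    have "R `` {a} \<subseteq> A" using R by (auto simp: equiv_def refl_on_def)
    then have "S `` {f x} = S `` {f a}" if "x \<in> R `` {a}" for x
      using that a fiff[of a x] equiv_class_eq[OF S, of "f a" "f x"] by auto
    moreover have "a \<in> R `` {a}" using R a by (auto simp: equiv_def refl_on_def)
    moreover have "\<Phi> (R `` {a}) = (\<Union>x \<in> R `` {a}. S `` {f x})" by (auto simp: \<Phi>_def)
    ultimately show ?thesis by blast
  qed
  have "inj_on \<Phi> (A // R)"
  proof (rule inj_onI)
    fix X Y assume "X \<in> A // R" "Y \<in> A // R" and eq: "\<Phi> X = \<Phi> Y"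
    then obtain a a' where a: "a \<in> A" "a' \<in> A" "X = R `` {a}" "Y = R `` {a'}" by (auto simp: quotient_def)
    then have "S `` {f a} = S `` {f a'}" using eq \<Phi> by simp
    then have "(f a, f a') \<in> S" using eq_equiv_class[OF _ S] f(1) a(2) by blast
    then show "X = Y" using a fiff equiv_class_eq[OF R] by simp
  qed
  moreover have "\<Phi> ` (A // R) = B // S"
  proof (rule equalityI; rule subsetI)
    fix Y assume "Y \<in> \<Phi> ` (A // R)"
    then show "Y \<in> B // S" using \<Phi> f(1) by (auto simp: quotient_def)
  next
    fix Y assume "Y \<in> B // S"
    then obtain b where b: "b \<in> B" "Y = S `` {b}" by (auto simp: quotient_def)
    then obtain a where a: "a \<in> A" "P a b" using surj by blast
    then have "(f a, b) \<in> S" using iff[of a a "f a" b] f b R by (auto simp: equiv_def refl_on_def)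
    then have "Y = \<Phi> (R `` {a})" using \<Phi>[OF a(1)] b(2) equiv_class_eq[OF S] by simp
    then show "Y \<in> \<Phi> ` (A // R)" using a(1) by (auto simp: quotient_def)
  qed
  ultimately show ?thesis unfolding bij_betw_def by blast
qed

theorem proposition5p6:
  fixes n :: nat
  assumes "n > 0"
  shows "\<exists>\<Phi>. bij_betw \<Phi> (conjugacy_classes_fmds n) (isometry_classes_nsg (n\<^sup>2))"
  unfolding conjugacy_classes_fmds_def isometry_classes_nsg_def
proof (rule ex_bij_betw_quotients[OF equiv_conjugate equiv_isometric, where P = "\<lambda>F S. realizes n S F"])
  show "\<exists>S \<in> nonsingular_symplectic_groups (n\<^sup>2). realizes n S F"
    if "F \<in> finite_maximal_diagonalizable_subgroups n" for F
    using ex_realizing_group[OF assms that] .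
  show "\<exists>F \<in> finite_maximal_diagonalizable_subgroups n. realizes n S F"
    if "S \<in> nonsingular_symplectic_groups (n\<^sup>2)" for S
    using ex_realized_by_subgroup[OF that] .
qed (simp add: conjugate_iff_isometric)

end
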